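(* A coupling Poisson structure of a foliated manifold $(M,\mathcal F)$ is equivalent with a triple $(P'',H,\sigma)$, where $P''$ is a leaf-tangent Poisson structure, $H$ is a normal bundle of $\mathcal F$ and $\sigma$ is a non-degenerate cross section of $\wedge^2(\mathrm{ann}\,F)$ such that $$d'\sigma=0,$$ $$\sharp_{P''}\{d[\sigma(X,Y)]\}=-p_F[X,Y],\qquad\forall X,Y\in\mathcal V^{1,0}_{pr}(M),$$ $$L_XP''=0,\qquad\forall X\in\mathcal V^{1,0}_{pr}(M).$$
   Context: Everything is $C^\infty$. $\mathcal F$ is a regular foliation of $M$, $F=T\mathcal F$ is its tangent bundle, $\mathrm{ann}$ denotes the annihilator in $T^*M$, $\Gamma$ denotes spaces of global cross sections, and $L$ is the Lie derivative. A normal bundle of $\mathcal F$ is a subbundle $H\subset TM$ with $TM=H\oplus F$; $p_F$ is the projection of $TM$ onto $F$ along $H$. Given $H$, multivector fields of bidegree $(a,b)$ are sections of $\wedge^aH\otimes\wedge^bF$ (their space is $\mathcal V^{a,b}(M)$), differential forms of bidegree $(a,b)$ are sections of $\wedge^a(\mathrm{ann}\,F)\otimes\wedge^b(\mathrm{ann}\,H)$, and $d=d'_{1,0}+d''_{0,1}+\partial_{2,-1}$ is the decomposition of the exterior differential into bihomogeneous components. $\mathcal V^{1,0}_{pr}(M)$ is the space of vector fields $X\in\mathcal V^{1,0}(M)=\Gamma H$ that are projectable onto the space of leaves, i.e. such that $[Y,X]\in\Gamma F$ for all $Y\in\Gamma F$. For a bivector field $P$, $\sharp_P:T^*M\to TM$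 is defined by $\beta(\sharp_P\alpha)=P(\alpha,\beta)$; $P$ is Poisson if the Schouten-Nijenhuis bracket $[P,P]$ vanishes. $P$ is ($\mathcal F$-)coupling if $\sharp_P(\mathrm{ann}\,F)$ is a normal bundle $H$ of $\mathcal F$; then, with respect to this $H$, $P=P'+P''$ with $P'$ of bidegree $(2,0)$ and $P''$ of bidegree $(0,2)$. A leaf-tangent Poisson structure is a Poisson bivector field belonging to $\Gamma\wedge^2F$. The correspondence is as follows. To a coupling $P$ one associates $H=\sharp_P(\mathrm{ann}\,F)$, the component $P''$, and the $2$-form $\sigma$ equivalent to $P'$ modulo $F$, i.e. the section of $\wedge^2(\mathrm{ann}\,F)$ with $\sigma(\sharp_{P'}\alpha,\sharp_{P'}\beta)=P'(\alpha,\beta)$ for $\alpha,\beta\in\mathrm{ann}\,F$. Non-degeneracy of $\sigma$ means non-degeneracy on $H$, so that $\flat_\sigma:H\to\mathrm{ann}\,F$, $\flat_\sigma X=i(X)\sigma$, is an isomorphism. Conversely, $P$ is reconstructed from the triple by $P(\xi,\eta)=\sigma(\flat_\sigma^{-1}\xi',\flat_\sigma^{-1}\eta')+P''(\xi'',\eta'')$, where $\xi=\xi'+\xi''$, $\eta=\eta'+\eta''$ with $\xi',\eta'\in\mathrm{ann}\,F$ and $\xi'',\eta''\in\mathrm{ann}\,H$.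
   Formalization: The last two conditions are required for projectable sections of H over every open subset U of M, not only for global X, Y in V_pr^{1,0}(M); with global fields only, the claim fails since a foliation may have no non-zero global projectable sections of H. *)

theory Defs
  imports "HOL-Analysis.Analysis"
begin

section \<open>Smooth maps on open subsets of normed spaces\<close>

primrec k_times_diff_on ::
  "nat \<Rightarrow> 'a::real_normed_vector set \<Rightarrow> ('a \<Rightarrow> 'b::real_normed_vector) \<Rightarrow> bool" where
  "k_times_diff_on 0 U f \<longleftrightarrow> continuous_on U f"
| "k_times_diff_on (Suc k) U f \<longleftrightarrow>
     (\<forall>x\<in>U. f differentiable (at x)) \<and>
     (\<forall>v. k_times_diff_on k U (\<lambda>x. frechet_derivative f (at x) v))"

(* only used for open U *)
definition smooth_on :: "'a::real_normed_vector set \<Rightarrow> ('a \<Rightarrow> 'b::real_normed_vector) \<Rightarrow> bool" where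
  "smooth_on U f \<longleftrightarrow> (\<forall>k. k_times_diff_on k U f)"


section \<open>Foliated manifolds\<close>

text \<open>
  The underlying space of the manifold is the type \<open>'m\<close>, and \<open>'e\<close> is the Euclidean model space.
  A chart is a pair of its domain and its coordinate map.
\<close>

type_synonym ('m, 'e) chart = "'m set \<times> ('m \<Rightarrow> 'e)"

definition chart_inv :: "('m, 'e) chart \<Rightarrow> 'e \<Rightarrow> 'm" where
  "chart_inv c = inv_into (fst c) (snd c)"

definition transition :: "('m, 'e) chart \<Rightarrow> ('m, 'e) chart \<Rightarrow> 'e \<Rightarrow> 'e" where
  "transition c c' = snd c' \<circ> chart_inv c"

definition smooth_atlas ::
  "('m::topological_space, 'e::euclidean_space) chart set \<Rightarrow> bool" where
  "smooth_atlas A \<longleftrightarrow>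
     (\<Union>c\<in>A. fst c) = UNIV \<and>
     (\<forall>c\<in>A. open (fst c) \<and> open (snd c ` fst c) \<and>
        homeomorphism (fst c) (snd c ` fst c) (snd c) (chart_inv c)) \<and>
     (\<forall>c\<in>A. \<forall>c'\<in>A. smooth_on (snd c ` (fst c \<inter> fst c')) (transition c c'))"

text \<open>
  A regular foliation is given by a smooth atlas of foliated charts: the plaques of a chart are
  the level sets modulo a fixed linear subspace \<open>S\<close> of the model space (of dimension equal to that
  of the leaves), and the coordinate changes are locally of the form
  \<open>(y, z) \<mapsto> (h\<^sub>1 y, h\<^sub>2 y z)\<close>, where \<open>y\<close> is the coordinate modulo \<open>S\<close>.
\<close>

definition foliated_atlas ::
  "('m::topological_space, 'e::euclidean_space) chart set \<Rightarrow> 'e set \<Rightarrow> bool" where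
  "foliated_atlas A S \<longleftrightarrow>
     smooth_atlas A \<and> subspace S \<and>
     (\<forall>c\<in>A. \<forall>c'\<in>A. \<forall>u \<in> snd c ` (fst c \<inter> fst c').
        \<exists>W. open W \<and> u \<in> W \<and> W \<subseteq> snd c ` (fst c \<inter> fst c') \<and>
          (\<forall>v\<in>W. \<forall>w\<in>W. v - w \<in> S \<longrightarrow> transition c c' v - transition c c' w \<in> S))"


section \<open>Tensor fields\<close>

text \<open>
  The tangent space at \<open>x\<close> is \<open>'e\<close>, tangent vectors at \<open>x\<close> being written in the coordinates of one
  preferred chart \<open>chart_at A x\<close> around \<open>x\<close>. Tensor fields are translated into the coordinates of
  another chart \<open>c\<close> by the differential \<open>dchart A c x\<close> of \<open>c\<close> at \<open>x\<close> and its inverse. A vector field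
  thus has type \<open>'m \<Rightarrow> 'e\<close>, and a 2-form has type \<open>'m \<Rightarrow> 'e \<Rightarrow> 'e \<Rightarrow> real\<close>; elements of the second
  exterior power of the tangent space are alternating bilinear forms on the dual space.
\<close>

type_synonym 'e dual = "'e \<Rightarrow>\<^sub>L real"

definition chart_at :: "('m, 'e) chart set \<Rightarrow> 'm \<Rightarrow> ('m, 'e) chart" where
  "chart_at A x = (SOME c. c \<in> A \<and> x \<in> fst c)"

definition coord_at :: "('m, 'e) chart set \<Rightarrow> 'm \<Rightarrow> 'e" where
  "coord_at A x = snd (chart_at A x) x"

definition dchart ::
  "('m, 'e::euclidean_space) chart set \<Rightarrow> ('m, 'e) chart \<Rightarrow> 'm \<Rightarrow> 'e \<Rightarrow> 'e" where
  "dchart A c x = frechet_derivative (transition (chart_at A x) c) (at (coord_at A x))"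

definition dchart_inv ::
  "('m, 'e::euclidean_space) chart set \<Rightarrow> ('m, 'e) chart \<Rightarrow> 'm \<Rightarrow> 'e \<Rightarrow> 'e" where
  "dchart_inv A c x = frechet_derivative (transition c (chart_at A x)) (at (snd c x))"

text \<open>Coordinate expressions in a chart \<open>c\<close>, as functions on the image of \<open>c\<close>.\<close>

definition vec_rep ::
  "('m, 'e::euclidean_space) chart set \<Rightarrow> ('m, 'e) chart \<Rightarrow> ('m \<Rightarrow> 'e) \<Rightarrow> 'e \<Rightarrow> 'e" where
  "vec_rep A c X u = dchart A c (chart_inv c u) (X (chart_inv c u))"

definition form_rep ::
  "('m, 'e::euclidean_space) chart set \<Rightarrow> ('m, 'e) chart \<Rightarrow> ('m \<Rightarrow> 'e \<Rightarrow> 'e \<Rightarrow> real)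
     \<Rightarrow> 'e \<Rightarrow> 'e \<Rightarrow> 'e \<Rightarrow> real" where
  "form_rep A c \<sigma> u v w =
     (let y = chart_inv c u in \<sigma> y (dchart_inv A c y v) (dchart_inv A c y w))"

definition bivec_rep ::
  "('m, 'e::euclidean_space) chart set \<Rightarrow> ('m, 'e) chart \<Rightarrow> ('m \<Rightarrow> 'e dual \<Rightarrow> 'e dual \<Rightarrow> real)
     \<Rightarrow> 'e \<Rightarrow> 'e dual \<Rightarrow> 'e dual \<Rightarrow> real" where
  "bivec_rep A c P u \<alpha> \<beta> =
     (let y = chart_inv c u
      in P y (\<alpha> o\<^sub>L Blinfun (dchart A c y)) (\<beta> o\<^sub>L Blinfun (dchart A c y)))"

definition alternating_bilinear :: "('v::real_vector \<Rightarrow> 'v \<Rightarrow> real) \<Rightarrow> bool" where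
  "alternating_bilinear B \<longleftrightarrow> bilinear B \<and> (\<forall>v. B v v = 0)"

definition smooth_field ::
  "('m::topological_space, 'e::euclidean_space) chart set \<Rightarrow> 'm set \<Rightarrow> ('m \<Rightarrow> 'e) \<Rightarrow> bool" where
  "smooth_field A U X \<longleftrightarrow> (\<forall>c\<in>A. smooth_on (snd c ` (fst c \<inter> U)) (vec_rep A c X))"

definition two_form ::
  "('m::topological_space, 'e::euclidean_space) chart set \<Rightarrow> ('m \<Rightarrow> 'e \<Rightarrow> 'e \<Rightarrow> real) \<Rightarrow> bool" where
  "two_form A \<sigma> \<longleftrightarrow>
     (\<forall>x. alternating_bilinear (\<sigma> x)) \<and>
     (\<forall>c\<in>A. \<forall>v w. smooth_on (snd c ` fst c) (\<lambda>u. form_rep A c \<sigma> u v w))"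

definition bivector_field ::
  "('m::topological_space, 'e::euclidean_space) chart set \<Rightarrow>
     ('m \<Rightarrow> 'e dual \<Rightarrow> 'e dual \<Rightarrow> real) \<Rightarrow> bool" where
  "bivector_field A P \<longleftrightarrow>
     (\<forall>x. alternating_bilinear (P x)) \<and>
     (\<forall>c\<in>A. \<forall>\<alpha> \<beta>. smooth_on (snd c ` fst c) (\<lambda>u. bivec_rep A c P u \<alpha> \<beta>))"

definition smooth_subbundle ::
  "('m::topological_space, 'e::euclidean_space) chart set \<Rightarrow> ('m \<Rightarrow> 'e set) \<Rightarrow> bool" where
  "smooth_subbundle A E \<longleftrightarrow>
     (\<forall>x. \<exists>U k (X :: nat \<Rightarrow> 'm \<Rightarrow> 'e). open U \<and> x \<in> U \<and>
        (\<forall>i<k. smooth_field A U (X i)) \<and>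
        (\<forall>y\<in>U. inj_on (\<lambda>i. X i y) {..<k} \<and> independent ((\<lambda>i. X i y) ` {..<k}) \<and>
               span ((\<lambda>i. X i y) ` {..<k}) = E y))"


section \<open>Differential operators\<close>

text \<open>
  The value at \<open>x\<close> of each operator is given by the usual coordinate formula in the chart
  \<open>chart_at A x\<close>, whose coordinates are also the ones used for tangent vectors at \<open>x\<close>.
\<close>

definition differential ::
  "('m, 'e::euclidean_space) chart set \<Rightarrow> ('m \<Rightarrow> real) \<Rightarrow> 'm \<Rightarrow> 'e dual" where
  "differential A f x =
     Blinfun (frechet_derivative (f \<circ> chart_inv (chart_at A x)) (at (coord_at A x)))"

definition dvec_rep ::
  "('m, 'e::euclidean_space) chart set \<Rightarrow> ('m \<Rightarrow> 'e) \<Rightarrow> 'm \<Rightarrow> 'e \<Rightarrow> 'e" where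
  "dvec_rep A X x = frechet_derivative (vec_rep A (chart_at A x) X) (at (coord_at A x))"

definition dform_rep ::
  "('m, 'e::euclidean_space) chart set \<Rightarrow> ('m \<Rightarrow> 'e \<Rightarrow> 'e \<Rightarrow> real) \<Rightarrow> 'm \<Rightarrow> 'e \<Rightarrow> 'e \<Rightarrow> 'e \<Rightarrow> real"
  where
  "dform_rep A \<sigma> x v w1 w2 =
     frechet_derivative (\<lambda>u. form_rep A (chart_at A x) \<sigma> u w1 w2) (at (coord_at A x)) v"

definition dbivec_rep ::
  "('m, 'e::euclidean_space) chart set \<Rightarrow> ('m \<Rightarrow> 'e dual \<Rightarrow> 'e dual \<Rightarrow> real)
     \<Rightarrow> 'm \<Rightarrow> 'e \<Rightarrow> 'e dual \<Rightarrow> 'e dual \<Rightarrow> real" where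
  "dbivec_rep A P x v \<alpha> \<beta> =
     frechet_derivative (\<lambda>u. bivec_rep A (chart_at A x) P u \<alpha> \<beta>) (at (coord_at A x)) v"

definition lie_bracket ::
  "('m, 'e::euclidean_space) chart set \<Rightarrow> ('m \<Rightarrow> 'e) \<Rightarrow> ('m \<Rightarrow> 'e) \<Rightarrow> 'm \<Rightarrow> 'e" where
  "lie_bracket A X Y x = dvec_rep A Y x (X x) - dvec_rep A X x (Y x)"

definition ext_deriv ::
  "('m, 'e::euclidean_space) chart set \<Rightarrow> ('m \<Rightarrow> 'e \<Rightarrow> 'e \<Rightarrow> real) \<Rightarrow> 'm \<Rightarrow> 'e \<Rightarrow> 'e \<Rightarrow> 'e \<Rightarrow> real"
  where
  "ext_deriv A \<sigma> x v1 v2 v3 =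
     dform_rep A \<sigma> x v1 v2 v3 - dform_rep A \<sigma> x v2 v1 v3 + dform_rep A \<sigma> x v3 v1 v2"

text \<open>
  \<open>(L\<^sub>X P)(\<alpha>, \<beta>) = X (P(\<alpha>, \<beta>)) - P(L\<^sub>X \<alpha>, \<beta>) - P(\<alpha>, L\<^sub>X \<beta>)\<close>, where \<open>L\<^sub>X \<alpha> = \<alpha> \<circ> DX\<close> for a 1-form
  \<open>\<alpha>\<close> with constant coefficients.
\<close>

definition lie_deriv_bivector ::
  "('m, 'e::euclidean_space) chart set \<Rightarrow> ('m \<Rightarrow> 'e) \<Rightarrow> ('m \<Rightarrow> 'e dual \<Rightarrow> 'e dual \<Rightarrow> real)
     \<Rightarrow> 'm \<Rightarrow> 'e dual \<Rightarrow> 'e dual \<Rightarrow> real" where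
  "lie_deriv_bivector A X P x \<alpha> \<beta> =
     dbivec_rep A P x (X x) \<alpha> \<beta>
     - P x (\<alpha> o\<^sub>L Blinfun (dvec_rep A X x)) \<beta>
     - P x \<alpha> (\<beta> o\<^sub>L Blinfun (dvec_rep A X x))"

definition sharp :: "('e::euclidean_space dual \<Rightarrow> 'e dual \<Rightarrow> real) \<Rightarrow> 'e dual \<Rightarrow> 'e" where
  "sharp B \<alpha> = (THE v. \<forall>\<beta>. blinfun_apply \<beta> v = B \<alpha> \<beta>)"

text \<open>
  The Schouten-Nijenhuis bracket of bivector fields. In coordinates,
  \<open>[P, Q]\<^sup>i\<^sup>j\<^sup>k\<close> is the cyclic sum over \<open>i, j, k\<close> of
  \<open>\<Sum>l. P\<^sup>i\<^sup>l \<partial>\<^sub>l Q\<^sup>j\<^sup>k + Q\<^sup>i\<^sup>l \<partial>\<^sub>l P\<^sup>j\<^sup>k\<close> (up to a global sign, on which authors differ).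
\<close>

definition schouten_bracket ::
  "('m, 'e::euclidean_space) chart set \<Rightarrow> ('m \<Rightarrow> 'e dual \<Rightarrow> 'e dual \<Rightarrow> real)
     \<Rightarrow> ('m \<Rightarrow> 'e dual \<Rightarrow> 'e dual \<Rightarrow> real) \<Rightarrow> 'm \<Rightarrow> 'e dual \<Rightarrow> 'e dual \<Rightarrow> 'e dual \<Rightarrow> real" where
  "schouten_bracket A P Q x \<alpha> \<beta> \<gamma> =
     (let T = (\<lambda>\<alpha> \<beta> \<gamma>. dbivec_rep A Q x (sharp (P x) \<alpha>) \<beta> \<gamma>
                     + dbivec_rep A P x (sharp (Q x) \<alpha>) \<beta> \<gamma>)
      in T \<alpha> \<beta> \<gamma> + T \<beta> \<gamma> \<alpha> + T \<gamma> \<alpha> \<beta>)"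

definition poisson ::
  "('m::topological_space, 'e::euclidean_space) chart set \<Rightarrow>
     ('m \<Rightarrow> 'e dual \<Rightarrow> 'e dual \<Rightarrow> real) \<Rightarrow> bool" where
  "poisson A P \<longleftrightarrow>
     bivector_field A P \<and> (\<forall>x \<alpha> \<beta> \<gamma>. schouten_bracket A P P x \<alpha> \<beta> \<gamma> = 0)"


section \<open>The bigrading defined by a normal bundle\<close>

definition tangent_bundle ::
  "('m, 'e::euclidean_space) chart set \<Rightarrow> 'e set \<Rightarrow> 'm \<Rightarrow> 'e set" where
  "tangent_bundle A S x = {v. \<forall>c\<in>A. x \<in> fst c \<longrightarrow> dchart A c x v \<in> S}"

definition ann :: "'e::euclidean_space set \<Rightarrow> 'e dual set" where
  "ann E = {\<alpha>. \<forall>v\<in>E. blinfun_apply \<alpha> v = 0}"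

definition complementary :: "'v::real_vector set \<Rightarrow> 'v set \<Rightarrow> bool" where
  "complementary D E \<longleftrightarrow> D \<inter> E = {0} \<and> {d + e |d e. d \<in> D \<and> e \<in> E} = UNIV"

text \<open>The component in \<open>D\<close> of a vector, for complementary subspaces \<open>D\<close> and \<open>E\<close>.\<close>

definition proj_along :: "'v::real_vector set \<Rightarrow> 'v set \<Rightarrow> 'v \<Rightarrow> 'v" where
  "proj_along D E v = (THE d. d \<in> D \<and> v - d \<in> E)"

definition normal_bundle ::
  "('m::topological_space, 'e::euclidean_space) chart set \<Rightarrow> 'e set \<Rightarrow> ('m \<Rightarrow> 'e set) \<Rightarrow> bool" where
  "normal_bundle A S H \<longleftrightarrow>
     smooth_subbundle A H \<and> (\<forall>x. complementary (H x) (tangent_bundle A S x))"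

text \<open>
  For \<open>\<sigma>\<close> of bidegree (2,0), \<open>d' \<sigma>\<close> is the component of bidegree (3,0) of the exterior derivative,
  i.e. its value on the \<open>H\<close>-components of the arguments.
\<close>

definition d_prime ::
  "('m, 'e::euclidean_space) chart set \<Rightarrow> 'e set \<Rightarrow> ('m \<Rightarrow> 'e set) \<Rightarrow> ('m \<Rightarrow> 'e \<Rightarrow> 'e \<Rightarrow> real)
     \<Rightarrow> 'm \<Rightarrow> 'e \<Rightarrow> 'e \<Rightarrow> 'e \<Rightarrow> real" where
  "d_prime A S H \<sigma> x v1 v2 v3 =
     (let p = proj_along (H x) (tangent_bundle A S x)
      in ext_deriv A \<sigma> x (p v1) (p v2) (p v3))"

text \<open>
  Sections over an open set \<open>U\<close> of the normal bundle \<open>H\<close> that are projectable onto the space of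
  leaves of \<open>U\<close>.
\<close>

definition projectable_fields ::
  "('m::topological_space, 'e::euclidean_space) chart set \<Rightarrow> 'e set \<Rightarrow> ('m \<Rightarrow> 'e set) \<Rightarrow> 'm set
     \<Rightarrow> ('m \<Rightarrow> 'e) set" where
  "projectable_fields A S H U =
     {X. smooth_field A U X \<and> (\<forall>x\<in>U. X x \<in> H x) \<and>
         (\<forall>Y. smooth_field A U Y \<and> (\<forall>x\<in>U. Y x \<in> tangent_bundle A S x) \<longrightarrow>
              (\<forall>x\<in>U. lie_bracket A Y X x \<in> tangent_bundle A S x))}"

text \<open>The components \<open>\<xi>'\<close> and \<open>\<xi>''\<close> of a covector at \<open>x\<close>.\<close>

definition covec_ann_F ::
  "('m, 'e::euclidean_space) chart set \<Rightarrow> 'e set \<Rightarrow> ('m \<Rightarrow> 'e set) \<Rightarrow> 'm \<Rightarrow> 'e dual \<Rightarrow> 'e dual" where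
  "covec_ann_F A S H x = proj_along (ann (tangent_bundle A S x)) (ann (H x))"

definition covec_ann_H ::
  "('m, 'e::euclidean_space) chart set \<Rightarrow> 'e set \<Rightarrow> ('m \<Rightarrow> 'e set) \<Rightarrow> 'm \<Rightarrow> 'e dual \<Rightarrow> 'e dual" where
  "covec_ann_H A S H x = proj_along (ann (H x)) (ann (tangent_bundle A S x))"

text \<open>The components of bidegree (2,0) and (0,2) of a bivector field.\<close>

definition bivec_component_20 ::
  "('m, 'e::euclidean_space) chart set \<Rightarrow> 'e set \<Rightarrow> ('m \<Rightarrow> 'e set)
     \<Rightarrow> ('m \<Rightarrow> 'e dual \<Rightarrow> 'e dual \<Rightarrow> real) \<Rightarrow> 'm \<Rightarrow> 'e dual \<Rightarrow> 'e dual \<Rightarrow> real" where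
  "bivec_component_20 A S H P x \<xi> \<eta> = P x (covec_ann_F A S H x \<xi>) (covec_ann_F A S H x \<eta>)"

definition bivec_component_02 ::
  "('m, 'e::euclidean_space) chart set \<Rightarrow> 'e set \<Rightarrow> ('m \<Rightarrow> 'e set)
     \<Rightarrow> ('m \<Rightarrow> 'e dual \<Rightarrow> 'e dual \<Rightarrow> real) \<Rightarrow> 'm \<Rightarrow> 'e dual \<Rightarrow> 'e dual \<Rightarrow> real" where
  "bivec_component_02 A S H P x \<xi> \<eta> = P x (covec_ann_H A S H x \<xi>) (covec_ann_H A S H x \<eta>)"

text \<open>
  An alternating bilinear form on the dual space is an element of the second exterior power of
  \<open>E\<close> iff it vanishes as soon as one argument annihilates \<open>E\<close>.
\<close>

definition leaf_tangent_poisson ::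
  "('m::topological_space, 'e::euclidean_space) chart set \<Rightarrow> 'e set \<Rightarrow>
     ('m \<Rightarrow> 'e dual \<Rightarrow> 'e dual \<Rightarrow> real) \<Rightarrow> bool" where
  "leaf_tangent_poisson A S P \<longleftrightarrow>
     poisson A P \<and> (\<forall>x. \<forall>\<alpha> \<in> ann (tangent_bundle A S x). \<forall>\<beta>. P x \<alpha> \<beta> = 0)"

definition in_wedge2_ann_F ::
  "('m, 'e::euclidean_space) chart set \<Rightarrow> 'e set \<Rightarrow> 'm \<Rightarrow> ('e \<Rightarrow> 'e \<Rightarrow> real) \<Rightarrow> bool" where
  "in_wedge2_ann_F A S x s \<longleftrightarrow>
     alternating_bilinear s \<and> (\<forall>v \<in> tangent_bundle A S x. \<forall>w. s v w = 0)"

definition nondegenerate_on :: "'e::euclidean_space set \<Rightarrow> ('e \<Rightarrow> 'e \<Rightarrow> real) \<Rightarrow> bool" where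
  "nondegenerate_on E s \<longleftrightarrow> (\<forall>v\<in>E. (\<forall>w\<in>E. s v w = 0) \<longrightarrow> v = 0)"

definition flat :: "('e::euclidean_space \<Rightarrow> 'e \<Rightarrow> real) \<Rightarrow> 'e \<Rightarrow> 'e dual" where
  "flat s v = Blinfun (s v)"


section \<open>Coupling Poisson structures and their associated triples\<close>

definition coupling_normal_bundle ::
  "('m, 'e::euclidean_space) chart set \<Rightarrow> 'e set \<Rightarrow> ('m \<Rightarrow> 'e dual \<Rightarrow> 'e dual \<Rightarrow> real)
     \<Rightarrow> 'm \<Rightarrow> 'e set" where
  "coupling_normal_bundle A S P x = sharp (P x) ` ann (tangent_bundle A S x)"

definition coupling_poisson ::
  "('m::topological_space, 'e::euclidean_space) chart set \<Rightarrow> 'e set \<Rightarrow>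
     ('m \<Rightarrow> 'e dual \<Rightarrow> 'e dual \<Rightarrow> real) set" where
  "coupling_poisson A S = {P. poisson A P \<and> normal_bundle A S (coupling_normal_bundle A S P)}"

definition coupling_form ::
  "('m, 'e::euclidean_space) chart set \<Rightarrow> 'e set \<Rightarrow> ('m \<Rightarrow> 'e dual \<Rightarrow> 'e dual \<Rightarrow> real)
     \<Rightarrow> 'm \<Rightarrow> 'e \<Rightarrow> 'e \<Rightarrow> real" where
  "coupling_form A S P x =
     (let P' = bivec_component_20 A S (coupling_normal_bundle A S P) P x
      in THE s. in_wedge2_ann_F A S x s \<and>
           (\<forall>\<alpha> \<in> ann (tangent_bundle A S x). \<forall>\<beta> \<in> ann (tangent_bundle A S x).
              s (sharp P' \<alpha>) (sharp P' \<beta>) = P' \<alpha> \<beta>))"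

type_synonym ('m, 'e) coupling_triple =
  "('m \<Rightarrow> 'e dual \<Rightarrow> 'e dual \<Rightarrow> real) \<times> ('m \<Rightarrow> 'e set) \<times> ('m \<Rightarrow> 'e \<Rightarrow> 'e \<Rightarrow> real)"

definition triple_of_bivector ::
  "('m, 'e::euclidean_space) chart set \<Rightarrow> 'e set \<Rightarrow> ('m \<Rightarrow> 'e dual \<Rightarrow> 'e dual \<Rightarrow> real)
     \<Rightarrow> ('m, 'e) coupling_triple" where
  "triple_of_bivector A S P =
     (let H = coupling_normal_bundle A S P
      in (bivec_component_02 A S H P, H, coupling_form A S P))"

definition bivector_of_triple ::
  "('m, 'e::euclidean_space) chart set \<Rightarrow> 'e set \<Rightarrow> ('m, 'e) coupling_triple
     \<Rightarrow> 'm \<Rightarrow> 'e dual \<Rightarrow> 'e dual \<Rightarrow> real" where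
  "bivector_of_triple A S = (\<lambda>(P'', H, \<sigma>) x \<xi> \<eta>.
     \<sigma> x (inv_into (H x) (flat (\<sigma> x)) (covec_ann_F A S H x \<xi>))
         (inv_into (H x) (flat (\<sigma> x)) (covec_ann_F A S H x \<eta>))
     + P'' x (covec_ann_H A S H x \<xi>) (covec_ann_H A S H x \<eta>))"

text \<open>
  The last two conditions are imposed on projectable fields over arbitrary open sets, because a
  foliation may have no non-zero global projectable sections of \<open>H\<close> (this happens, e.g., for the
  suspension of a representation of a surface group in SO(3), acting on the 2-sphere, with dense
  image), in which case the conditions on global fields are void.
\<close>

definition coupling_triples ::
  "('m::topological_space, 'e::euclidean_space) chart set \<Rightarrow> 'e set \<Rightarrow>
     ('m, 'e) coupling_triple set" where
  "coupling_triples A S = {(P'', H, \<sigma>).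
     leaf_tangent_poisson A S P'' \<and>
     normal_bundle A S H \<and>
     two_form A \<sigma> \<and> (\<forall>x. in_wedge2_ann_F A S x (\<sigma> x)) \<and> (\<forall>x. nondegenerate_on (H x) (\<sigma> x)) \<and>
     (\<forall>x v1 v2 v3. d_prime A S H \<sigma> x v1 v2 v3 = 0) \<and>
     (\<forall>U. open U \<longrightarrow>
        (\<forall>X \<in> projectable_fields A S H U. \<forall>Y \<in> projectable_fields A S H U. \<forall>x\<in>U.
           sharp (P'' x) (differential A (\<lambda>y. \<sigma> y (X y) (Y y)) x)
             = - proj_along (tangent_bundle A S x) (H x) (lie_bracket A X Y x))) \<and>
     (\<forall>U. open U \<longrightarrow>
        (\<forall>X \<in> projectable_fields A S H U. \<forall>x\<in>U. \<forall>\<alpha> \<beta>.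
           lie_deriv_bivector A X P'' x \<alpha> \<beta> = 0))}"

end

theory Submission
  imports Defs
begin

text \<open>The obstacle is that the two halves of the splitting behave differently in a chart.
  There \<open>F\<close> is the fixed subspace \<open>S\<close>, so a constant covector in
  \<open>ann S\<close> is a local section of ann F, while a constant covector that kills
  \<open>H\<close> at the base point need not kill it nearby. Each step with ann H has to control a
  first-order error: it drops out because the expression is tensorial, because projectability puts
  it in \<open>S\<close>, or because two factors vanish at the point.

  The structure equations quantify over projectable fields, the Jacobi identity over covectors at a
  point. They can be matched because each equation depends only on the values of the fields at the
  point, and because every vector of \<open>H\<close> extends to a projectable field over a chart
  domain.

  The sign in \<open>\<sigma>(\<sharp>a, \<cdot>) = -a\<close> comes from the convention
  \<open>\<beta>(\<sharp>\<alpha>) = P(\<alpha>, \<beta>)\<close>: for \<open>b\<close> in ann F,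
  \<open>\<sigma>(\<sharp>a, \<sharp>b) = P(a, b) = -P(b, a) = -a(\<sharp>b)\<close>.

  Tangent vectors at a point are written in a chart chosen for that point, with no continuity in the
  choice. Smoothness is therefore always a statement about coordinate expressions in one fixed
  chart.\<close>

text \<open>
  In a foliated chart the leaves are the plaques parallel to a fixed subspace \<open>S\<close>, and the projections
  to \<open>H\<close> of the constant vector fields are projectable. At a point, the trilinear expression
  \<open>J(\<alpha>, \<beta>, \<gamma>) = \<Sum> (\<sharp>\<alpha>)(P(\<beta>, \<gamma>))\<close> (cyclic sum, constant covectors), which is half of \<open>[P, P]\<close>, vanishes
  iff it does so on the components with respect to \<open>ann F \<oplus> ann H\<close>. Let \<open>a, b, c\<close> be in \<open>ann F\<close>
  and \<open>\<gamma>\<close> in \<open>ann H\<close>. From \<open>\<sigma>(\<sharp>a, \<cdot>) = -a\<close> one gets \<open>J(a, b, c) = -d\<sigma>(\<sharp>a, \<sharp>b, \<sharp>c)\<close>. Since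
  \<open>\<gamma>\<close> of a bracket of sections of \<open>H\<close> is tensorial, \<open>\<sharp>a\<close> and \<open>\<sharp>b\<close> may be replaced by projectable fields
  \<open>X, Y\<close> with the same values, and \<open>J(a, b, \<gamma>)\<close> becomes \<open>\<gamma>\<close> of the difference of the two sides of the
  curvature equation; along the leaves \<open>d(\<sigma>(X, Y)) = -d(P(a, b))\<close>, which explains the sign in that
  equation. In the same way \<open>J\<close> on \<open>ann F \<times> ann H \<times> ann H\<close> is \<open>L\<^sub>X P''\<close>, and on \<open>ann H\<close> it is
  half of \<open>[P'', P'']\<close>, because \<open>P'\<close> vanishes there to second order.

  All reconstructed objects are smooth because they solve linear equations with smooth invertible
  coefficients.
\<close>

section \<open>Calculus of smooth maps\<close>

lemma k_times_diff_on_cong: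
  assumes "open U" "\<And>x. x \<in> U \<Longrightarrow> f x = g x"
  shows "k_times_diff_on k U f \<longleftrightarrow> k_times_diff_on k U g"
  using assms(2)
proof (induction k arbitrary: f g)
  case 0
  then show ?case by (metis continuous_on_cong k_times_diff_on.simps(1))
next
  case (Suc k)
  have D: "(f has_derivative f') (at x) \<longleftrightarrow> (g has_derivative f') (at x)" if "x \<in> U" for x f'
    by (rule iffI; erule has_derivative_transform_within_open[OF _ assms(1) that])
      (simp_all add: Suc.prems)
  then have "frechet_derivative f (at x) = frechet_derivative g (at x)" if "x \<in> U" for x
    using that by (simp add: frechet_derivative_def)
  then have "k_times_diff_on k U (\<lambda>x. frechet_derivative f (at x) v) \<longleftrightarrow>
      k_times_diff_on k U (\<lambda>x. frechet_derivative g (at x) v)" for v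
    by (intro Suc.IH) simp
  then show ?case using D by (simp add: differentiable_def)
qed

lemma k_times_diff_on_subset:
  "k_times_diff_on k U f \<Longrightarrow> W \<subseteq> U \<Longrightarrow> k_times_diff_on k W f"
  by (induction k arbitrary: f) (auto intro: continuous_on_subset)

lemma k_times_diff_on_Un:
  "open U \<Longrightarrow> open W \<Longrightarrow> k_times_diff_on k U f \<Longrightarrow> k_times_diff_on k W f \<Longrightarrow>
    k_times_diff_on k (U \<union> W) f"
  by (induction k arbitrary: f) (auto intro: continuous_on_open_Un)

lemma k_times_diff_on_local:
  assumes "\<And>x. x \<in> U \<Longrightarrow> \<exists>W. open W \<and> x \<in> W \<and> W \<subseteq> U \<and> k_times_diff_on k W f"
  shows "k_times_diff_on k U f"
  using assms
proof (induction k arbitrary: f)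
  case 0
  have "isCont f x" if "x \<in> U" for x
  proof -
    obtain W where "open W" "x \<in> W" "k_times_diff_on 0 W f" using 0[OF \<open>x \<in> U\<close>] by blast
    then show ?thesis
      using continuous_on_eq_continuous_at[of W f] unfolding k_times_diff_on.simps by blast
  qed
  then show ?case by (simp add: continuous_at_imp_continuous_on)
next
  case (Suc k)
  have W: "\<exists>W. open W \<and> x \<in> W \<and> W \<subseteq> U \<and> (\<forall>y\<in>W. f differentiable (at y)) \<and>
      (\<forall>v. k_times_diff_on k W (\<lambda>x. frechet_derivative f (at x) v))" if "x \<in> U" for x
    using Suc.prems[OF that] unfolding k_times_diff_on.simps .
  have "k_times_diff_on k U (\<lambda>x. frechet_derivative f (at x) v)" for v
    by (rule Suc.IH, drule W) blast
  moreover have "\<forall>x\<in>U. f differentiable (at x)" using W by blast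
  ultimately show ?case unfolding k_times_diff_on.simps by blast
qed

lemma k_times_diff_on_SucD: "k_times_diff_on (Suc k) U f \<Longrightarrow> k_times_diff_on k U f"
  by (induction k arbitrary: f)
    (auto simp: differentiable_imp_continuous_within intro!: continuous_at_imp_continuous_on)

lemma k_times_diff_on_const: "k_times_diff_on k U (\<lambda>x. c)"
  by (induction k arbitrary: c) auto

text \<open>Lets the inductive steps use an explicit derivative formula in place of the term
  \<open>frechet_derivative\<close>.\<close>

lemma k_times_diff_on_SucI:
  assumes U: "open U" and D: "\<And>x. x \<in> U \<Longrightarrow> (f has_derivative f' x) (at x)"
    and f': "\<And>v. k_times_diff_on k U (\<lambda>x. f' x v)"
  shows "k_times_diff_on (Suc k) U f"
proof -
  have D2: "k_times_diff_on k U (\<lambda>x. frechet_derivative f (at x) v)" for v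
    using f'[of v] k_times_diff_on_cong[OF U, of "\<lambda>x. frechet_derivative f (at x) v" "\<lambda>x. f' x v" k]
      frechet_derivative_at[OF D] by auto
  then show ?thesis using D by (auto simp: differentiable_def)
qed

lemma k_times_diff_on_linear:
  assumes "open U" and T: "bounded_linear T"
  shows "k_times_diff_on k U f \<Longrightarrow> k_times_diff_on k U (\<lambda>x. T (f x))"
proof (induction k arbitrary: f)
  case 0
  then show ?case using T by (auto intro: bounded_linear.continuous_on)
next
  case (Suc k)
  have D: "((\<lambda>x. T (f x)) has_derivative (\<lambda>v. T (frechet_derivative f (at x) v))) (at x)"
    if "x \<in> U" for x
    using that Suc.prems
    by (intro bounded_linear.has_derivative[OF T]) (simp only: k_times_diff_on.simps frechet_derivative_works)
  have D2: "k_times_diff_on k U (\<lambda>x. T (frechet_derivative f (at x) v))" for v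
    using Suc.prems by (intro Suc.IH) (simp only: k_times_diff_on.simps)
  show ?case
    by (rule k_times_diff_on_SucI[OF assms(1) D D2])
qed

lemma k_times_diff_on_add:
  assumes "open U"
  shows "k_times_diff_on k U f \<Longrightarrow> k_times_diff_on k U g \<Longrightarrow> k_times_diff_on k U (\<lambda>x. f x + g x)"
proof (induction k arbitrary: f g)
  case 0
  then show ?case by (auto intro: continuous_on_add)
next
  case (Suc k)
  have D: "((\<lambda>x. f x + g x) has_derivative
      (\<lambda>v. frechet_derivative f (at x) v + frechet_derivative g (at x) v)) (at x)" if "x \<in> U" for x
    using that Suc.prems
    by (intro has_derivative_add) (simp_all only: k_times_diff_on.simps frechet_derivative_works)
  have D2: "k_times_diff_on k U (\<lambda>x. frechet_derivative f (at x) v + frechet_derivative g (at x) v)" for v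
    using Suc.prems by (intro Suc.IH) (simp_all only: k_times_diff_on.simps)
  show ?case
    by (rule k_times_diff_on_SucI[OF assms(1) D D2])
qed

lemma k_times_diff_on_bilinear:
  assumes "open U" and B: "bounded_bilinear B"
  shows "k_times_diff_on k U f \<Longrightarrow> k_times_diff_on k U g \<Longrightarrow> k_times_diff_on k U (\<lambda>x. B (f x) (g x))"
proof (induction k arbitrary: f g)
  case 0
  then show ?case using B by (auto intro: bounded_bilinear.continuous_on)
next
  case (Suc k)
  have D: "((\<lambda>x. B (f x) (g x)) has_derivative
      (\<lambda>v. B (f x) (frechet_derivative g (at x) v) + B (frechet_derivative f (at x) v) (g x))) (at x)"
    if "x \<in> U" for x
    using Suc.prems that
    by (intro bounded_bilinear.FDERIV[OF B]) (simp_all only: k_times_diff_on.simps frechet_derivative_works)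
  \<comment> \<open>The product rule mixes derivatives with undifferentiated factors, so the factors
    themselves are also needed at order \<open>k\<close>.\<close>
  have k: "k_times_diff_on k U f" "k_times_diff_on k U g"
    using Suc.prems by (simp_all only: k_times_diff_on_SucD)
  have "k_times_diff_on k U (\<lambda>x. frechet_derivative f (at x) v)"
    "k_times_diff_on k U (\<lambda>x. frechet_derivative g (at x) v)" for v
    using Suc.prems by (simp_all only: k_times_diff_on.simps)
  then have D2: "k_times_diff_on k U (\<lambda>x. B (f x) (frechet_derivative g (at x) v)
      + B (frechet_derivative f (at x) v) (g x))" for v
    using k by (rule_tac k_times_diff_on_add[OF assms(1) Suc.IH Suc.IH])
  show ?case
    by (rule k_times_diff_on_SucI[OF assms(1) D D2])
qed

lemma k_times_diff_on_sum:
  assumes "open U" "finite I" "\<And>i. i \<in> I \<Longrightarrow> k_times_diff_on k U (f i)"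
  shows "k_times_diff_on k U (\<lambda>x. \<Sum>i\<in>I. f i x)"
  using assms(2,3)
proof (induction I rule: finite_induct)
  case (insert i I)
  then show ?case
    using k_times_diff_on_add[OF assms(1), of k "f i" "\<lambda>x. \<Sum>i\<in>I. f i x"] by simp
qed (simp add: k_times_diff_on_const)

lemma smooth_on_cong:
  assumes "open U" "\<And>x. x \<in> U \<Longrightarrow> f x = g x"
  shows "smooth_on U f \<longleftrightarrow> smooth_on U g"
  unfolding smooth_on_def using k_times_diff_on_cong[of U f g, OF assms] by simp

lemma smooth_on_transform:
  assumes "open U" "smooth_on U g" "\<And>x. x \<in> U \<Longrightarrow> f x = g x"
  shows "smooth_on U f"
  using smooth_on_cong[of U f g, OF assms(1,3)] assms(2) by simp

lemma smooth_on_local: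
  assumes "\<And>x. x \<in> U \<Longrightarrow> \<exists>W. open W \<and> x \<in> W \<and> W \<subseteq> U \<and> smooth_on W f"
  shows "smooth_on U f"
  unfolding smooth_on_def
proof
  fix k show "k_times_diff_on k U f"
    by (rule k_times_diff_on_local, drule assms) (unfold smooth_on_def, blast)
qed

lemma smooth_on_subset: "smooth_on U f \<Longrightarrow> W \<subseteq> U \<Longrightarrow> smooth_on W f"
  unfolding smooth_on_def using k_times_diff_on_subset by blast

lemma smooth_on_Un: "open U \<Longrightarrow> open W \<Longrightarrow> smooth_on U f \<Longrightarrow> smooth_on W f \<Longrightarrow> smooth_on (U \<union> W) f"
  unfolding smooth_on_def using k_times_diff_on_Un by blast

lemma smooth_on_const: "smooth_on U (\<lambda>x. c)"
  unfolding smooth_on_def using k_times_diff_on_const by blast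

lemma smooth_on_add:
  "open U \<Longrightarrow> smooth_on U f \<Longrightarrow> smooth_on U g \<Longrightarrow> smooth_on U (\<lambda>x. f x + g x)"
  unfolding smooth_on_def using k_times_diff_on_add by blast

lemma smooth_on_linear:
  "open U \<Longrightarrow> bounded_linear T \<Longrightarrow> smooth_on U f \<Longrightarrow> smooth_on U (\<lambda>x. T (f x))"
  unfolding smooth_on_def using k_times_diff_on_linear by blast

lemma smooth_on_bilinear:
  "open U \<Longrightarrow> bounded_bilinear B \<Longrightarrow> smooth_on U f \<Longrightarrow> smooth_on U g \<Longrightarrow>
    smooth_on U (\<lambda>x. B (f x) (g x))"
  unfolding smooth_on_def using k_times_diff_on_bilinear by blast

lemma smooth_on_diff:
  "open U \<Longrightarrow> smooth_on U f \<Longrightarrow> smooth_on U g \<Longrightarrow> smooth_on U (\<lambda>x. f x - g x)"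
  using smooth_on_add[of U f "\<lambda>x. - g x"]
    smooth_on_linear[OF _ bounded_linear_minus[OF bounded_linear_ident], of U g]
  by simp

lemma smooth_on_sum:
  "open U \<Longrightarrow> finite I \<Longrightarrow> (\<And>i. i \<in> I \<Longrightarrow> smooth_on U (f i)) \<Longrightarrow> smooth_on U (\<lambda>x. \<Sum>i\<in>I. f i x)"
  unfolding smooth_on_def using k_times_diff_on_sum by blast

lemma smooth_on_differentiable: "smooth_on U f \<Longrightarrow> x \<in> U \<Longrightarrow> f differentiable (at x)"
  unfolding smooth_on_def by (metis k_times_diff_on.simps(2))

lemma smooth_on_frechet_derivative: "smooth_on U f \<Longrightarrow> smooth_on U (\<lambda>x. frechet_derivative f (at x) v)"
  unfolding smooth_on_def by (metis k_times_diff_on.simps(2))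

section \<open>Families of linear maps, and linear equations with smooth invertible
  coefficients\<close>

lemma linear_eq_sum_Basis:
  fixes f :: "'a::euclidean_space \<Rightarrow> 'b::real_vector"
  assumes "linear f"
  shows "f v = (\<Sum>b\<in>Basis. (v \<bullet> b) *\<^sub>R f b)"
  using linear_sum[OF assms, of "\<lambda>b. (v \<bullet> b) *\<^sub>R b" Basis] linear_cmul[OF assms]
  by (simp add: euclidean_representation)

text \<open>Expanding \<open>g u\<close> in \<open>Basis\<close> separates the two occurrences of
  \<open>u\<close> and leaves a finite sum of products. Smoothness of the family is thus only needed
  for each fixed vector.\<close>

lemma smooth_on_linear_family:
  fixes L :: "'a::real_normed_vector \<Rightarrow> 'b::euclidean_space \<Rightarrow> 'c::real_normed_vector"
  assumes "open U" "\<And>u. u \<in> U \<Longrightarrow> linear (L u)" "\<And>v. smooth_on U (\<lambda>u. L u v)" "smooth_on U g"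
  shows "smooth_on U (\<lambda>u. L u (g u))"
proof -
  have "smooth_on U (\<lambda>u. \<Sum>b\<in>Basis. (g u \<bullet> b) *\<^sub>R L u b)"
    using assms by (intro smooth_on_sum smooth_on_bilinear[OF _ bounded_bilinear_scaleR]
        smooth_on_linear[OF _ bounded_linear_inner_left]) auto
  then show ?thesis
    using smooth_on_cong[of U "\<lambda>u. L u (g u)" "\<lambda>u. \<Sum>b\<in>Basis. (g u \<bullet> b) *\<^sub>R L u b", OF assms(1)]
      linear_eq_sum_Basis[OF assms(2)] by blast
qed

text \<open>
  Since \<open>L u (g u - g u\<^sub>0) = f u - L u (g u\<^sub>0)\<close>, differentiability of \<open>g\<close> reduces to the case in
  which the right-hand side vanishes at \<open>u\<^sub>0\<close>; then only continuity of \<open>L\<close> matters.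
\<close>

lemma has_derivative_linear_solution_zero:
  fixes L :: "'a::real_normed_vector \<Rightarrow> 'b::euclidean_space \<Rightarrow> 'c::euclidean_space"
  assumes U: "open U" "x \<in> U" and lin: "\<And>u. u \<in> U \<Longrightarrow> linear (L u)"
    and cont: "\<And>v. continuous (at x) (\<lambda>u. L u v)"
    and inj: "inj (L x)" and r: "(r has_derivative r') (at x)" and r0: "r x = 0" and d0: "d x = 0"
    and eq: "\<And>u. u \<in> U \<Longrightarrow> L u (d u) = r u"
  shows "((\<lambda>u. L x (d u)) has_derivative r') (at x)"
proof -
  obtain m where m: "m > 0" "\<And>v. m * norm v \<le> norm (L x v)"
    using linear_inj_bounded_below_pos[of "L x"] lin[OF U(2)] inj by (metis mult.commute)
  interpret r': bounded_linear r' using r by (rule has_derivative_bounded_linear)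
  obtain K where K: "K > 0" "\<And>v. norm (r' v) \<le> norm v * K" using r'.pos_bounded by blast
  \<comment> \<open>\<open>N u\<close> stands in for the operator norm of \<open>L u - L x\<close>;
    it is a finite sum over columns, so continuity for each fixed vector makes it tend to 0.\<close>
  define N where "N u = (\<Sum>b\<in>Basis. norm (L u b - L x b))" for u
  have "((\<lambda>u. norm (L u b - L x b)) \<longlongrightarrow> 0) (at x)" for b
    using cont[of b] by (auto simp: continuous_at LIM_zero_iff tendsto_norm_zero_iff)
  then have N: "(N \<longlongrightarrow> 0) (at x)"
    unfolding N_def by (auto intro!: tendsto_null_sum)
  have Nx: "N x = 0" by (simp add: N_def)
  have NL: "norm (L u v - L x v) \<le> N u * norm v" if "u \<in> U" for u v
  proof -
    have "L u v - L x v = (\<Sum>b\<in>Basis. (v \<bullet> b) *\<^sub>R (L u b - L x b))"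
      using linear_eq_sum_Basis[OF lin[OF that], of v] linear_eq_sum_Basis[OF lin[OF U(2)], of v]
      by (simp add: sum_subtractf scaleR_diff_right)
    also have "norm \<dots> \<le> (\<Sum>b\<in>Basis. norm (L u b - L x b) * norm v)"
      by (rule sum_norm_le) (simp add: Basis_le_norm mult.commute[of "norm (L _ _ - L _ _)"] mult_right_mono)
    finally show ?thesis by (simp add: N_def sum_distrib_right)
  qed
  show ?thesis
    unfolding has_derivative_at_alt
  proof (intro conjI allI impI)
    show "bounded_linear r'" by (rule r'.bounded_linear_axioms)
    fix e :: real assume e: "e > 0"
    \<comment> \<open>The bound 1 on \<open>\<eta>\<close> gives
      \<open>norm (r y) \<le> (K + 1) * norm (y - x)\<close>. The bound \<open>m / 2\<close> on
      \<open>\<delta>\<close> absorbs the error into the left side and yields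
      \<open>m * norm (d y) \<le> 2 * (K + 1) * norm (y - x)\<close>. The remaining bounds then make
      each of the two final errors at most \<open>e / 2 * norm (y - x)\<close>.\<close>
    define \<eta> where "\<eta> = min 1 (e / 2)"
    define \<delta> where "\<delta> = min (m / 2) (e * m / (4 * (K + 1)))"
    have \<delta>: "\<delta> \<le> m / 2" "\<delta> \<le> e * m / (4 * (K + 1))" by (simp_all only: \<delta>_def min.cobounded1 min.cobounded2)
    have \<eta>: "\<eta> \<le> 1" "\<eta> \<le> e / 2" by (simp_all only: \<eta>_def min.cobounded1 min.cobounded2)
    have pos: "\<eta> > 0" "\<delta> > 0" using e m K by (auto simp: \<eta>_def \<delta>_def)
    obtain d1 where d1: "d1 > 0" "\<And>y. norm (y - x) < d1 \<Longrightarrow> norm (r y - r' (y - x)) \<le> \<eta> * norm (y - x)"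
      using r pos r0 unfolding has_derivative_at_alt by auto
    obtain d2 where d2: "d2 > 0" "\<And>y. norm (y - x) < d2 \<Longrightarrow> N y < \<delta>"
      using N pos Nx unfolding LIM_def
      by (metis abs_less_iff diff_zero dist_norm real_norm_def zero_less_norm_iff right_minus_eq)
    obtain d3 where d3: "d3 > 0" "\<And>y. norm (y - x) < d3 \<Longrightarrow> y \<in> U"
      using U by (metis open_dist dist_norm)
    show "\<exists>d'>0. \<forall>y. norm (y - x) < d' \<longrightarrow> norm (L x (d y) - L x (d x) - r' (y - x)) \<le> e * norm (y - x)"
    proof (intro exI[of _ "min d1 (min d2 d3)"] conjI allI impI)
      fix y assume y: "norm (y - x) < min d1 (min d2 d3)"
      then have yU: "y \<in> U" and Ny: "N y \<le> \<delta>" and ry: "norm (r y - r' (y - x)) \<le> \<eta> * norm (y - x)"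
        using d1 d2 d3 by (auto simp: less_imp_le)
      have Lr: "norm (L x (d y) - r y) \<le> \<delta> * norm (d y)"
        using NL[OF yU, of "d y"] eq[OF yU] mult_right_mono[OF Ny norm_ge_zero, of "d y"]
        by (simp add: norm_minus_commute)
      have "norm (r y) \<le> norm (r' (y - x)) + norm (r y - r' (y - x))"
        by (rule norm_triangle_sub)
      also have "\<dots> \<le> (K + 1) * norm (y - x)"
        using K(2)[of "y - x"] ry mult_right_mono[OF \<eta>(1) norm_ge_zero, of "y - x"]
        by (simp add: algebra_simps)
      finally have nr: "norm (r y) \<le> (K + 1) * norm (y - x)" .
      have "m * norm (d y) \<le> norm (r y) + norm (L x (d y) - r y)"
        using m(2)[of "d y"] norm_triangle_sub[of "L x (d y)" "r y"] by linarith
      also have "\<dots> \<le> norm (r y) + m / 2 * norm (d y)"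
        using Lr mult_right_mono[OF \<delta>(1) norm_ge_zero, of "d y"] by linarith
      finally have nd: "m * norm (d y) \<le> 2 * ((K + 1) * norm (y - x))"
        using nr by (simp add: field_simps)
      have "\<delta> * norm (d y) \<le> (e / (4 * (K + 1))) * (m * norm (d y))"
        using mult_right_mono[OF \<delta>(2) norm_ge_zero, of "d y"] by simp
      also have "\<dots> \<le> (e / (4 * (K + 1))) * (2 * ((K + 1) * norm (y - x)))"
        using nd e K by (intro mult_left_mono) auto
      also have "\<dots> = e / 2 * norm (y - x)" using K by (simp add: field_simps)
      finally have "norm (L x (d y) - r y) \<le> e / 2 * norm (y - x)" using Lr by linarith
      moreover have "\<eta> * norm (y - x) \<le> e / 2 * norm (y - x)"
        by (rule mult_right_mono[OF \<eta>(2) norm_ge_zero])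
      ultimately have "norm ((L x (d y) - r y) + (r y - r' (y - x))) \<le> e * norm (y - x)"
        using ry norm_triangle_ineq[of "L x (d y) - r y" "r y - r' (y - x)"] by linarith
      then show "norm (L x (d y) - L x (d x) - r' (y - x)) \<le> e * norm (y - x)"
        by (simp add: d0 linear_0[OF lin[OF U(2)]])
    qed (simp add: d1 d2 d3)
  qed
qed

text \<open>The formula is what the product rule for \<open>L u (g u) = f u\<close> gives when
  solved for the derivative of \<open>g\<close>; the content is that this derivative exists.\<close>

lemma has_derivative_linear_solution:
  fixes L :: "'a::real_normed_vector \<Rightarrow> 'b::euclidean_space \<Rightarrow> 'b"
  assumes U: "open U" "x \<in> U" and lin: "\<And>u. u \<in> U \<Longrightarrow> linear (L u)"
    and diff: "\<And>v. (\<lambda>u. L u v) differentiable (at x)"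
    and inj: "inj (L x)" and f: "f differentiable (at x)"
    and eq: "\<And>u. u \<in> U \<Longrightarrow> L u (g u) = f u"
  shows "(g has_derivative (\<lambda>v. inv (L x) (frechet_derivative f (at x) v
           - frechet_derivative (\<lambda>u. L u (g x)) (at x) v))) (at x)"
proof -
  have lininv: "linear (inv (L x))"
    by (rule inj_linear_imp_inv_linear[OF lin[OF U(2)] inj])
  have "((\<lambda>u. L x (g u - g x)) has_derivative (\<lambda>v. frechet_derivative f (at x) v
           - frechet_derivative (\<lambda>u. L u (g x)) (at x) v)) (at x)"
  proof (rule has_derivative_linear_solution_zero[where L = L and U = U and d = "\<lambda>u. g u - g x"
        and r = "\<lambda>u. f u - L u (g x)", OF U lin _ inj])
    show "((\<lambda>u. f u - L u (g x)) has_derivative (\<lambda>v. frechet_derivative f (at x) v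
           - frechet_derivative (\<lambda>u. L u (g x)) (at x) v)) (at x)"
      by (rule has_derivative_diff[OF frechet_derivative_works[THEN iffD1, OF f]
            frechet_derivative_works[THEN iffD1, OF diff]])
    show "L u (g u - g x) = f u - L u (g x)" if "u \<in> U" for u
      by (simp add: linear_diff[OF lin[OF that]] eq[OF that])
  qed (simp_all add: eq[OF U(2)] differentiable_imp_continuous_within[OF diff])
  then have "((\<lambda>u. inv (L x) (L x (g u - g x))) has_derivative
     (\<lambda>v. inv (L x) (frechet_derivative f (at x) v - frechet_derivative (\<lambda>u. L u (g x)) (at x) v))) (at x)"
    by (rule bounded_linear.has_derivative[OF lininv[unfolded linear_conv_bounded_linear]])
  then have "((\<lambda>u. g u - g x) has_derivative
     (\<lambda>v. inv (L x) (frechet_derivative f (at x) v - frechet_derivative (\<lambda>u. L u (g x)) (at x) v))) (at x)"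
    by (simp only: inv_f_f[OF inj])
  from has_derivative_add[OF this has_derivative_const[of "g x"]] show ?thesis
    by (simp only: diff_add_cancel add_0_right)
qed

text \<open>A bootstrap on the inverse: the derivative of \<open>inv (L u) w\<close> is built from
  values of \<open>inv (L u)\<close> and derivatives of \<open>L\<close>, so order \<open>k\<close>
  for all \<open>w\<close> gives order \<open>k + 1\<close>. A general right-hand side follows,
  since \<open>g u = inv (L u) (f u)\<close>.\<close>

lemma smooth_on_linear_solution:
  fixes L :: "'a::real_normed_vector \<Rightarrow> 'b::euclidean_space \<Rightarrow> 'b"
  assumes U: "open U" and lin: "\<And>u. u \<in> U \<Longrightarrow> linear (L u)"
    and smooth: "\<And>v. smooth_on U (\<lambda>u. L u v)" and inj: "\<And>u. u \<in> U \<Longrightarrow> inj (L u)"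
    and f: "smooth_on U f" and eq: "\<And>u. u \<in> U \<Longrightarrow> L u (g u) = f u"
  shows "smooth_on U g"
proof -
  have lininv: "linear (inv (L u))" if "u \<in> U" for u
    by (rule inj_linear_imp_inv_linear[OF lin[OF that] inj[OF that]])
  have Linv: "L u (inv (L u) w) = w" if "u \<in> U" for u w
    using linear_injective_imp_surjective[OF lin[OF that] inj[OF that]] by (simp add: surj_f_inv_f)
  have D: "(g has_derivative (\<lambda>v. inv (L x) (frechet_derivative f (at x) v
           - frechet_derivative (\<lambda>u. L u (g x)) (at x) v))) (at x)"
    if "x \<in> U" "smooth_on U f" "\<And>u. u \<in> U \<Longrightarrow> L u (g u) = f u" for x f g
    using has_derivative_linear_solution[where L = L and f = f and g = g, OF U that(1) lin _ inj[OF that(1)] _ that(3)]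
      smooth_on_differentiable[OF smooth that(1)] smooth_on_differentiable[OF that(2,1)] by blast
  have inv_k: "k_times_diff_on k U (\<lambda>u. inv (L u) w)" for k w
  proof (induction k arbitrary: w)
    case 0
    then show ?case
      using D[OF _ smooth_on_const[of U w], of _ "\<lambda>u. inv (L u) w"] Linv
      by (auto intro!: continuous_at_imp_continuous_on has_derivative_continuous)
  next
    case (Suc k)
    have Dw: "((\<lambda>u. inv (L u) w) has_derivative (\<lambda>v. inv (L x) (0
           - frechet_derivative (\<lambda>u. L u (inv (L x) w)) (at x) v))) (at x)" if "x \<in> U" for x
      using D[OF that smooth_on_const[of U w], of "\<lambda>u. inv (L u) w"] Linv by simp
    have D_sum: "frechet_derivative (\<lambda>u. L u z) (at x) v = (\<Sum>b\<in>Basis. (z \<bullet> b) *\<^sub>R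
        frechet_derivative (\<lambda>u. L u b) (at x) v)" if "x \<in> U" for x v z
    proof -
      have "((\<lambda>u. \<Sum>b\<in>Basis. (z \<bullet> b) *\<^sub>R L u b) has_derivative (\<lambda>v. \<Sum>b\<in>Basis. (z \<bullet> b) *\<^sub>R
          frechet_derivative (\<lambda>u. L u b) (at x) v)) (at x)"
        using smooth_on_differentiable[OF smooth that]
        by (intro has_derivative_sum has_derivative_scaleR_right) (simp add: frechet_derivative_works[symmetric])
      then have "((\<lambda>u. L u z) has_derivative (\<lambda>v. \<Sum>b\<in>Basis. (z \<bullet> b) *\<^sub>R
          frechet_derivative (\<lambda>u. L u b) (at x) v)) (at x)"
        by (rule has_derivative_transform_within_open[OF _ U that])
          (simp add: linear_eq_sum_Basis[OF lin, of _ z])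
      then show ?thesis by (simp add: frechet_derivative_at[symmetric])
    qed
    \<comment> \<open>Both the argument of \<open>inv (L x)\<close> and the vector to which the
      derivative of \<open>L\<close> is applied vary with \<open>x\<close>. Expanding both in
      \<open>Basis\<close> leaves products of functions covered by the induction hypothesis and by
      smoothness of \<open>L\<close>.\<close>
    have Dw': "((\<lambda>u. inv (L u) w) has_derivative (\<lambda>v. \<Sum>c\<in>Basis. ((- (\<Sum>b\<in>Basis. (inv (L x) w \<bullet> b) *\<^sub>R
            frechet_derivative (\<lambda>u. L u b) (at x) v)) \<bullet> c) *\<^sub>R inv (L x) c)) (at x)" if "x \<in> U" for x
    proof (rule has_derivative_eq_rhs[OF Dw[OF that]], rule ext)
      fix v
      show "inv (L x) (0 - frechet_derivative (\<lambda>u. L u (inv (L x) w)) (at x) v) =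
          (\<Sum>c\<in>Basis. ((- (\<Sum>b\<in>Basis. (inv (L x) w \<bullet> b) *\<^sub>R
            frechet_derivative (\<lambda>u. L u b) (at x) v)) \<bullet> c) *\<^sub>R inv (L x) c)"
        unfolding D_sum[OF that, of "inv (L x) w" v] diff_0 by (rule linear_eq_sum_Basis[OF lininv[OF that]])
    qed
    have DL: "k_times_diff_on k U (\<lambda>x. frechet_derivative (\<lambda>u. L u b) (at x) v)" for b v
      using smooth_on_frechet_derivative[OF smooth[of b], of v] by (simp add: smooth_on_def)
    have "k_times_diff_on k U (\<lambda>x. \<Sum>c\<in>Basis. ((- (\<Sum>b\<in>Basis. (inv (L x) w \<bullet> b) *\<^sub>R
            frechet_derivative (\<lambda>u. L u b) (at x) v)) \<bullet> c) *\<^sub>R inv (L x) c)" for v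
      by (intro k_times_diff_on_sum k_times_diff_on_bilinear[OF _ bounded_bilinear_scaleR]
           k_times_diff_on_linear[OF _ bounded_linear_inner_left] U finite_Basis Suc.IH DL
           k_times_diff_on_linear[OF _ bounded_linear_minus[OF bounded_linear_ident]])
    from k_times_diff_on_SucI[OF U Dw' this] show ?case .
  qed
  have "smooth_on U (\<lambda>u. inv (L u) (f u))"
    by (rule smooth_on_linear_family[OF U lininv _ f]) (simp_all add: smooth_on_def inv_k)
  moreover have "inv (L u) (f u) = g u" if "u \<in> U" for u
    by (simp add: eq[OF that, symmetric] inv_f_f[OF inj[OF that]])
  ultimately show ?thesis by (simp cong: smooth_on_cong[OF U])
qed

section \<open>A smooth function on the line that vanishes exactly on the non-positive half\<close>

text \<open>The exponent \<open>n\<close> makes the family closed under differentiation up to linear combinations.\<close>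

definition flat_exp :: "nat \<Rightarrow> real \<Rightarrow> real" where
  "flat_exp n t = (if t > 0 then exp (- 1 / t) / t ^ n else 0)"

text \<open>On the right of 0 the substitution \<open>s = 1 / t\<close> reduces this to
  \<open>s ^ n / exp s\<close> at infinity.\<close>

lemma flat_exp_tendsto_0: "((\<lambda>t. flat_exp n t) \<longlongrightarrow> 0) (at 0)"
proof -
  have "((\<lambda>s::real. s ^ n / exp s) \<longlongrightarrow> 0) at_top" by (rule tendsto_power_div_exp_0)
  then have "((\<lambda>t::real. inverse t ^ n / exp (inverse t)) \<longlongrightarrow> 0) (at_right 0)"
    using filterlim_compose filterlim_inverse_at_top_right by blast
  then have R: "(flat_exp n \<longlongrightarrow> 0) (at_right 0)"
    by (rule Lim_transform_eventually)
      (auto simp: eventually_at_right_field flat_exp_def exp_minus field_simps intro!: exI[of _ 1])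
  have L: "(flat_exp n \<longlongrightarrow> 0) (at_left 0)"
    by (rule tendsto_eventually) (auto simp: eventually_at_left_field flat_exp_def intro!: exI[of _ "-1"])
  show ?thesis using L R by (simp add: filterlim_at_split)
qed

lemma flat_exp_has_derivative:
  "(flat_exp n has_real_derivative flat_exp (n + 2) t - real n * flat_exp (n + 1) t) (at t)"
proof -
  consider "t > 0" | "t < 0" | "t = 0" by linarith
  then show ?thesis
  proof cases
    case 1
    have "((\<lambda>t. t ^ n) has_real_derivative real n * (t ^ n / t)) (at t)"
      using 1 DERIV_pow[of n t UNIV] by (cases n) auto
    moreover have "((\<lambda>t. exp (- 1 / t)) has_real_derivative exp (- 1 / t) / t\<^sup>2) (at t)"
      using 1 by (auto intro!: derivative_eq_intros simp: power2_eq_square)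
    ultimately have "((\<lambda>t. exp (- 1 / t) / t ^ n) has_real_derivative
        (exp (- 1 / t) / t\<^sup>2 * t ^ n - exp (- 1 / t) * (real n * (t ^ n / t))) / (t ^ n * t ^ n)) (at t)"
      using 1 by (intro DERIV_divide) auto
    also have "(exp (- 1 / t) / t\<^sup>2 * t ^ n - exp (- 1 / t) * (real n * (t ^ n / t))) / (t ^ n * t ^ n) =
        flat_exp (n + 2) t - real n * flat_exp (n + 1) t"
      using 1 by (simp add: flat_exp_def divide_simps) (simp add: algebra_simps power2_eq_square)
    finally have "((\<lambda>t. exp (- 1 / t) / t ^ n) has_real_derivative
        flat_exp (n + 2) t - real n * flat_exp (n + 1) t) (at t)" .
    then show ?thesis
      by (rule has_field_derivative_transform_within_open[where S = "{0<..}"])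
        (use 1 in \<open>auto simp: flat_exp_def\<close>)
  next
    case 2
    have "((\<lambda>t. 0) has_real_derivative flat_exp (n + 2) t - real n * flat_exp (n + 1) t) (at t)"
      using 2 by (simp add: flat_exp_def)
    then show ?thesis
      by (rule has_field_derivative_transform_within_open[where S = "{..<0}"])
        (use 2 in \<open>auto simp: flat_exp_def\<close>)
  next
    case 3
    \<comment> \<open>The difference quotient of \<open>flat_exp n\<close> at 0 is
      \<open>flat_exp (Suc n)\<close>, so the limit is already known.\<close>
    have "((\<lambda>h. (flat_exp n (0 + h) - flat_exp n 0) / h) \<longlongrightarrow> 0) (at 0)"
      by (rule Lim_transform_eventually[OF flat_exp_tendsto_0[of "Suc n"]])
        (auto simp: flat_exp_def eventually_at field_simps intro!: exI[of _ 1])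
    then show ?thesis using 3 by (simp add: DERIV_def flat_exp_def)
  qed
qed

lemma smooth_on_flat_exp:
  assumes U: "open U" and g: "smooth_on U g"
  shows "smooth_on U (\<lambda>u. flat_exp n (g u))"
  unfolding smooth_on_def
proof
  fix k
  have D: "((\<lambda>u. flat_exp n (g u)) has_derivative
      (\<lambda>v. (flat_exp (n + 2) (g x) + (- real n) * flat_exp (n + 1) (g x)) * frechet_derivative g (at x) v)) (at x)"
    if "x \<in> U" for x n
    using flat_exp_has_derivative smooth_on_differentiable[OF g that]
    by (intro has_derivative_compose[of g "frechet_derivative g (at x)" x UNIV "flat_exp n", simplified])
      (auto simp: frechet_derivative_works[symmetric] has_field_derivative_def)
  show "k_times_diff_on k U (\<lambda>u. flat_exp n (g u))"
  proof (induction k arbitrary: n)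
    case 0
    then show ?case using D by (auto intro!: continuous_at_imp_continuous_on has_derivative_continuous)
  next
    case (Suc k)
    have D2: "k_times_diff_on k U (\<lambda>x. (flat_exp (n + 2) (g x) + (- real n) * flat_exp (n + 1) (g x))
           * frechet_derivative g (at x) v)" for v
      using g smooth_on_frechet_derivative[OF g, of v]
      by (intro k_times_diff_on_bilinear[OF U bounded_bilinear_mult] k_times_diff_on_add[OF U] Suc.IH
           k_times_diff_on_const) (auto simp: smooth_on_def)
    show ?case by (rule k_times_diff_on_SucI[OF U D D2])
  qed
qed

section \<open>Linear algebra of coupling bivectors\<close>

lemma linear_blinfun_apply: "linear (blinfun_apply a)"
  by (simp add: blinfun.bounded_linear_right bounded_linear.linear)

lemma blinfun_apply_Blinfun: "linear f \<Longrightarrow> blinfun_apply (Blinfun f) = f"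
  for f :: "'a::euclidean_space \<Rightarrow> 'b::real_normed_vector"
  by (simp add: bounded_linear_Blinfun_apply linear_conv_bounded_linear)

lemma blinfun_separates:
  fixes v w :: "'e::euclidean_space"
  assumes "\<And>a :: 'e dual. blinfun_apply a v = blinfun_apply a w"
  shows "v = w"
proof (rule euclidean_eqI)
  fix b
  show "v \<bullet> b = w \<bullet> b"
    using assms[of "blinfun_inner_left b"] by (simp add: inner_commute)
qed

lemma alternating_bilinear_antisym:
  fixes B :: "'v::real_vector \<Rightarrow> 'v \<Rightarrow> real"
  assumes "alternating_bilinear B"
  shows "B v w = - B w v"
proof -
  have B: "bilinear B" "\<And>v. B v v = 0" using assms by (auto simp: alternating_bilinear_def)
  have "0 = B (v + w) (v + w)" using B by simp
  also have "\<dots> = B v w + B w v"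
    unfolding bilinear_ladd[OF B(1)] bilinear_radd[OF B(1)] by (simp add: B(2))
  finally show ?thesis by linarith
qed

lemma alternating_bilinear_linear:
  assumes "alternating_bilinear B"
  shows "linear (B v)" "linear (\<lambda>v. B v w)"
  using assms by (auto simp: alternating_bilinear_def bilinear_def)

lemma alternating_pullback:
  assumes "alternating_bilinear B" "linear f"
  shows "alternating_bilinear (\<lambda>v w. B (f v) (f w))"
  unfolding alternating_bilinear_def bilinear_def
  using linear_compose[OF assms(2) alternating_bilinear_linear(1)[OF assms(1)], unfolded o_def]
    linear_compose[OF assms(2) alternating_bilinear_linear(2)[OF assms(1)], unfolded o_def] assms(1)
  by (auto simp: alternating_bilinear_def)

lemma alternating_add:
  assumes "alternating_bilinear B" "alternating_bilinear C"
  shows "alternating_bilinear (\<lambda>v w. B v w + C v w)"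
  unfolding alternating_bilinear_def bilinear_def
  using alternating_bilinear_linear[OF assms(1)] alternating_bilinear_linear[OF assms(2)] assms
  by (auto intro!: linear_compose_add simp: alternating_bilinear_def)

lemma dual_eq_sum_Basis:
  fixes \<beta> :: "'e::euclidean_space dual"
  shows "\<beta> = (\<Sum>b\<in>Basis. blinfun_apply \<beta> b *\<^sub>R blinfun_inner_left b)"
  by (rule blinfun_euclidean_eqI)
    (simp add: blinfun.sum_left blinfun.scaleR_left blinfun_inner_left.rep_eq inner_Basis if_distrib cong: if_cong)

text \<open>Reflexivity of a finite-dimensional space; it makes the definite description in
  \<open>sharp\<close> meaningful.\<close>

lemma linear_functional_on_dual:
  fixes f :: "'e::euclidean_space dual \<Rightarrow> real"
  assumes "linear f"
  shows "\<exists>!v. \<forall>\<beta>. blinfun_apply \<beta> v = f \<beta>"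
proof (rule ex_ex1I)
  define v where "v = (\<Sum>b\<in>Basis. f (blinfun_inner_left b) *\<^sub>R b)"
  have "blinfun_apply \<beta> v = f \<beta>" for \<beta>
  proof -
    have "f \<beta> = f (\<Sum>b\<in>Basis. blinfun_apply \<beta> b *\<^sub>R blinfun_inner_left b)"
      by (rule arg_cong[OF dual_eq_sum_Basis])
    also have "\<dots> = (\<Sum>b\<in>Basis. blinfun_apply \<beta> b * f (blinfun_inner_left b))"
      by (simp add: linear_sum[OF assms] linear_cmul[OF assms])
    finally show ?thesis
      by (simp add: v_def blinfun.sum_right blinfun.scaleR_right mult.commute)
  qed
  then show "\<exists>v. \<forall>\<beta>. blinfun_apply \<beta> v = f \<beta>" by blast
qed (metis blinfun_separates)

lemma apply_sharp:
  assumes "alternating_bilinear p"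
  shows "blinfun_apply \<beta> (sharp p \<alpha>) = p \<alpha> \<beta>"
  using theI'[OF linear_functional_on_dual[OF alternating_bilinear_linear(1)[OF assms, of \<alpha>]]]
  unfolding sharp_def by blast

lemma sharp_eqI: "alternating_bilinear p \<Longrightarrow> (\<And>\<beta>. blinfun_apply \<beta> v = p \<alpha> \<beta>) \<Longrightarrow> sharp p \<alpha> = v"
  by (rule blinfun_separates) (simp add: apply_sharp)

lemma sharp_eq_sum:
  "alternating_bilinear p \<Longrightarrow> sharp p \<alpha> = (\<Sum>b\<in>Basis. p \<alpha> (blinfun_inner_left b) *\<^sub>R b)"
  by (subst euclidean_representation[symmetric])
    (simp add: apply_sharp[symmetric] blinfun_inner_left.rep_eq inner_commute)

lemma linear_sharp:
  assumes "alternating_bilinear p"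
  shows "linear (sharp p)"
proof (rule linearI)
  fix a b r
  have lin: "linear (\<lambda>a. p a c)" for c by (rule alternating_bilinear_linear[OF assms])
  show "sharp p (a + b) = sharp p a + sharp p b"
    by (rule sharp_eqI[OF assms]) (simp add: blinfun.add_right apply_sharp[OF assms] linear_add[OF lin])
  show "sharp p (r *\<^sub>R a) = r *\<^sub>R sharp p a"
    by (rule sharp_eqI[OF assms]) (simp add: blinfun.scaleR_right apply_sharp[OF assms] linear_cmul[OF lin])
qed

lemma subspace_ann: "subspace (ann E)"
  by (simp add: subspace_def ann_def blinfun.add_left blinfun.scaleR_left)

lemma proj_along_unique:
  assumes "subspace D" "subspace E" "complementary D E" "d \<in> D" "v - d \<in> E"
  shows "proj_along D E v = d"
  unfolding proj_along_def
proof (rule the_equality)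
  fix d' assume d': "d' \<in> D \<and> v - d' \<in> E"
  have "d' - d \<in> D" using d' assms by (simp add: subspace_diff)
  moreover have "(v - d) - (v - d') \<in> E" using d' assms by (simp only: subspace_diff)
  then have "d' - d \<in> E" by simp
  ultimately have "d' - d \<in> {0}" using assms(3) unfolding complementary_def by blast
  then show "d' = d" by simp
qed (use assms in simp)

lemma proj_along:
  assumes "subspace D" "subspace E" "complementary D E"
  shows "proj_along D E v \<in> D" "v - proj_along D E v \<in> E"
proof -
  obtain d e where "v = d + e" "d \<in> D" "e \<in> E"
    using assms(3) unfolding complementary_def by blast
  moreover from this have "proj_along D E v = d"
    using proj_along_unique[OF assms, of d v] by simp
  ultimately show "proj_along D E v \<in> D" "v - proj_along D E v \<in> E" by auto
qed

lemma linear_proj_along: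
  assumes "subspace D" "subspace E" "complementary D E"
  shows "linear (proj_along D E)"
proof (rule linearI)
  fix v w r
  note P = proj_along[OF assms]
  have "(v - proj_along D E v) + (w - proj_along D E w) \<in> E"
    by (rule subspace_add[OF assms(2)]) (rule P)+
  then show "proj_along D E (v + w) = proj_along D E v + proj_along D E w"
    by (intro proj_along_unique[OF assms] subspace_add[OF assms(1)] P) (simp add: algebra_simps)
  have "r *\<^sub>R (v - proj_along D E v) \<in> E"
    by (rule subspace_scale[OF assms(2)]) (rule P)
  then show "proj_along D E (r *\<^sub>R v) = r *\<^sub>R proj_along D E v"
    by (intro proj_along_unique[OF assms] subspace_scale[OF assms(1)] P) (simp add: scaleR_diff_right)
qed

lemma complementary_sym:
  assumes "complementary D E"
  shows "complementary E D"
proof -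
  have "{d + e |d e. d \<in> E \<and> e \<in> D} = {d + e |d e. d \<in> D \<and> e \<in> E}"
    by (metis (no_types, opaque_lifting) add.commute)
  then show ?thesis using assms by (simp add: complementary_def Int_commute)
qed

text \<open>
  The algebraic relations at one point between a coupling bivector \<open>p\<close>, the projection \<open>\<pi>\<close> onto
  its normal space along \<open>F\<close>, its leaf component \<open>p2\<close> and its form \<open>s\<close>. Both directions of the
  correspondence lead to these relations, so that the differential conditions need to be compared
  only once.
\<close>

definition coupled ::
  "'e::euclidean_space set \<Rightarrow> ('e \<Rightarrow> 'e) \<Rightarrow> ('e dual \<Rightarrow> 'e dual \<Rightarrow> real) \<Rightarrow> ('e dual \<Rightarrow> 'e dual \<Rightarrow> real)
    \<Rightarrow> ('e \<Rightarrow> 'e \<Rightarrow> real) \<Rightarrow> bool" where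
  "coupled F \<pi> p p2 s \<longleftrightarrow>
     subspace F \<and> linear \<pi> \<and> (\<forall>v\<in>F. \<pi> v = 0) \<and> (\<forall>v. v - \<pi> v \<in> F) \<and>
     alternating_bilinear p \<and> alternating_bilinear p2 \<and> alternating_bilinear s \<and>
     (\<forall>v\<in>F. \<forall>w. s v w = 0) \<and>
     (\<forall>a\<in>ann F. \<forall>\<beta>. p a \<beta> = p a (\<beta> o\<^sub>L Blinfun \<pi>)) \<and>
     (\<forall>\<alpha> \<beta>. p2 \<alpha> \<beta> = p (\<alpha> - (\<alpha> o\<^sub>L Blinfun \<pi>)) (\<beta> - (\<beta> o\<^sub>L Blinfun \<pi>))) \<and>
     (\<forall>a\<in>ann F. \<forall>w. s (sharp p a) w = - blinfun_apply a w)"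

section \<open>The splitting of the dual space, and coupled data obtained from a bivector or from a
  triple\<close>

context
  fixes H F :: "'e::euclidean_space set" and \<pi> :: "'e \<Rightarrow> 'e"
  assumes H: "subspace H" and F: "subspace F" and HF: "complementary H F"
    and \<pi>_def: "\<pi> = proj_along H F"
begin

lemma pi_linear: "linear \<pi>"
  unfolding \<pi>_def by (rule linear_proj_along[OF H F HF])

lemma pi_F: "v \<in> F \<Longrightarrow> \<pi> v = 0"
  unfolding \<pi>_def by (intro proj_along_unique[OF H F HF]) (simp_all add: subspace_0 H)

lemma pi_H: "v \<in> H \<Longrightarrow> \<pi> v = v"
  unfolding \<pi>_def by (intro proj_along_unique[OF H F HF]) (simp_all add: subspace_0 F)

lemma pi_mem: "\<pi> v \<in> H" "v - \<pi> v \<in> F"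
  unfolding \<pi>_def by (rule proj_along[OF H F HF])+

lemma compose_pi: "blinfun_apply (\<alpha> o\<^sub>L Blinfun \<pi>) v = blinfun_apply \<alpha> (\<pi> v)"
  by (simp add: bounded_linear_Blinfun_apply pi_linear linear_conv_bounded_linear[symmetric])

lemma compose_pi_ann: "\<alpha> o\<^sub>L Blinfun \<pi> \<in> ann F" "\<alpha> - (\<alpha> o\<^sub>L Blinfun \<pi>) \<in> ann H"
  by (simp_all add: ann_def compose_pi pi_F pi_H blinfun.diff_left del: blinfun_apply_blinfun_compose)

lemma compose_pi_eq:
  "\<alpha> \<in> ann F \<Longrightarrow> \<alpha> o\<^sub>L Blinfun \<pi> = \<alpha>" "\<alpha> \<in> ann H \<Longrightarrow> \<alpha> o\<^sub>L Blinfun \<pi> = 0"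
proof -
  show "\<alpha> o\<^sub>L Blinfun \<pi> = \<alpha>" if "\<alpha> \<in> ann F"
  proof (rule blinfun_eqI)
    fix v
    have "blinfun_apply \<alpha> (v - \<pi> v) = 0" using that pi_mem(2) by (simp only: ann_def mem_Collect_eq)
    then show "blinfun_apply (\<alpha> o\<^sub>L Blinfun \<pi>) v = blinfun_apply \<alpha> v"
      by (simp add: compose_pi blinfun.diff_right del: blinfun_apply_blinfun_compose)
  qed
  show "\<alpha> o\<^sub>L Blinfun \<pi> = 0" if "\<alpha> \<in> ann H"
    using that pi_mem(1) by (intro blinfun_eqI) (simp add: compose_pi ann_def del: blinfun_apply_blinfun_compose)
qed

lemma complementary_ann: "complementary (ann F) (ann H)"
  unfolding complementary_def
proof
  have "\<alpha> = 0" if "\<alpha> \<in> ann F" "\<alpha> \<in> ann H" for \<alpha>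
    using compose_pi_eq that by metis
  then show "ann F \<inter> ann H = {0}" using subspace_0[OF subspace_ann] by blast
  have "\<alpha> = (\<alpha> o\<^sub>L Blinfun \<pi>) + (\<alpha> - (\<alpha> o\<^sub>L Blinfun \<pi>))" for \<alpha> :: "'e dual"
    by simp
  then show "{d + e |d e. d \<in> ann F \<and> e \<in> ann H} = UNIV"
    using compose_pi_ann by blast
qed

text \<open>The transpose of the projection of the tangent space splits the dual. This turns
  \<open>\<xi>'\<close> and \<open>\<xi>''\<close>, which are given by definite descriptions, into
  compositions that can be computed with and differentiated.\<close>

lemma proj_along_ann:
  "proj_along (ann F) (ann H) \<alpha> = \<alpha> o\<^sub>L Blinfun \<pi>"
  "proj_along (ann H) (ann F) \<alpha> = \<alpha> - (\<alpha> o\<^sub>L Blinfun \<pi>)"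
proof -
  show "proj_along (ann F) (ann H) \<alpha> = \<alpha> o\<^sub>L Blinfun \<pi>"
    by (rule proj_along_unique[OF subspace_ann subspace_ann complementary_ann compose_pi_ann])
  show "proj_along (ann H) (ann F) \<alpha> = \<alpha> - (\<alpha> o\<^sub>L Blinfun \<pi>)"
    by (rule proj_along_unique[OF subspace_ann subspace_ann complementary_sym[OF complementary_ann] compose_pi_ann(2)])
      (simp add: compose_pi_ann(1))
qed

text \<open>The map \<open>v \<mapsto> B(v, \<cdot>)\<close> with \<open>B(v, w) = s(\<pi>v, \<pi>w) + \<langle>v - \<pi>v, w - \<pi>w\<rangle>\<close> is injective, hence onto.\<close>

lemma flat_bij:
  assumes s: "alternating_bilinear s" "\<And>v w. v \<in> F \<Longrightarrow> s v w = 0" and nd: "nondegenerate_on H s"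
  shows "bij_betw (flat s) H (ann F)"
proof -
  have lin: "linear (s v)" "linear (\<lambda>v. s v w)" for v w by (rule alternating_bilinear_linear[OF s(1)])+
  have s0: "s v w = 0" if "w \<in> F" for v w
    using alternating_bilinear_antisym[OF s(1), of v w] s(2)[OF that] by simp
  have fl: "blinfun_apply (flat s v) = s v" for v by (simp add: flat_def blinfun_apply_Blinfun[OF lin(1)])
  have \<rho>: "linear (\<lambda>v. v - \<pi> v)" by (intro linear_compose_sub linear_id[unfolded id_def] pi_linear)
  \<comment> \<open>\<open>L v\<close> represents \<open>B(v, \<cdot>)\<close> through the inner
    product, so that injective implies onto becomes a statement about an endomorphism.\<close>
  define L where "L v = (\<Sum>b\<in>Basis. (s v b + (v - \<pi> v) \<bullet> (b - \<pi> b)) *\<^sub>R b)" for v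
  have L: "L v \<bullet> w = s v w + (v - \<pi> v) \<bullet> (w - \<pi> w)" for v w
  proof -
    have "linear (\<lambda>w. s v w + (v - \<pi> v) \<bullet> (w - \<pi> w))"
      by (intro linear_compose_add lin linear_compose[OF \<rho>, unfolded o_def] bounded_linear.linear bounded_linear_inner_right)
    from linear_eq_sum_Basis[OF this, of w] show ?thesis
      by (simp only: L_def inner_sum_left inner_scaleR_left real_scaleR_def inner_commute[of w] mult.commute)
  qed
  have linL: "linear L"
  proof (rule linearI)
    show "L (v + w) = L v + L w" for v w
      by (simp add: L_def linear_add[OF lin(2)] linear_add[OF pi_linear] inner_add_left inner_diff_left
          algebra_simps sum.distrib[symmetric])
    show "L (r *\<^sub>R v) = r *\<^sub>R L v" for r v
      by (simp add: L_def linear_cmul[OF lin(2)] linear_cmul[OF pi_linear] scaleR_sum_right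
          inner_diff_left algebra_simps)
  qed
  have "inj L"
  proof (rule linear_injective_0[OF linL, THEN iffD2], intro allI impI)
    fix v assume v: "L v = 0"
    then have "0 = L v \<bullet> (v - \<pi> v)" by simp
    also have "\<dots> = (v - \<pi> v) \<bullet> (v - \<pi> v)"
      unfolding L using s0[OF pi_mem(2)] pi_F[OF pi_mem(2)] by simp
    finally have "v - \<pi> v = 0" by simp
    then have "v \<in> H" using pi_mem(1)[of v] by simp
    moreover have "s v w = 0" for w using L[of v w] v \<open>v - \<pi> v = 0\<close> by simp
    ultimately show "v = 0" using nd by (simp add: nondegenerate_on_def)
  qed
  then have surj: "surj L" by (rule linear_inj_imp_surj[OF linL])
  show ?thesis
    unfolding bij_betw_def
  proof
    show "inj_on (flat s) H"
    proof (rule inj_onI)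
      fix v w assume vw: "v \<in> H" "w \<in> H" "flat s v = flat s w"
      have "s (v - w) z = 0" for z
        using vw(3) fl[of v] fl[of w] by (simp add: linear_diff[OF lin(2)])
      then have "v - w = 0" using nd subspace_diff[OF H vw(1,2)] unfolding nondegenerate_on_def by blast
      then show "v = w" by simp
    qed
    show "flat s ` H = ann F"
    proof
      show "flat s ` H \<subseteq> ann F" using s0 by (auto simp: ann_def fl)
      show "ann F \<subseteq> flat s ` H"
      proof
        fix a assume a: "a \<in> ann F"
        define z where "z = (\<Sum>b\<in>Basis. blinfun_apply a b *\<^sub>R b)"
        have z: "z \<bullet> w = blinfun_apply a w" for w
          using linear_eq_sum_Basis[OF linear_blinfun_apply, of a w]
          by (simp only: z_def inner_sum_left inner_scaleR_left real_scaleR_def inner_commute[of w] mult.commute)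
        obtain v where v: "L v = z" using surj by (metis surjE)
        \<comment> \<open>The solution \<open>v\<close> may a priori have a component in
          \<open>F\<close>. Testing the equation on that component leaves only its squared length,
          while \<open>a\<close> vanishes there, so \<open>v\<close> lies in
          \<open>H\<close>.\<close>
        have "0 = blinfun_apply a (v - \<pi> v)" using a pi_mem(2) by (simp only: ann_def mem_Collect_eq)
        also have "\<dots> = (v - \<pi> v) \<bullet> (v - \<pi> v)"
          unfolding z[symmetric] v[symmetric] L using s0[OF pi_mem(2)] pi_F[OF pi_mem(2)] by simp
        finally have *: "v - \<pi> v = 0" by simp
        then have "v \<in> H" using pi_mem(1)[of v] by simp
        moreover have "flat s v = a"
          by (rule blinfun_eqI) (use L[of v] * v z in \<open>simp add: fl\<close>)
        ultimately show "a \<in> flat s ` H" by blast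
      qed
    qed
  qed
qed

lemma linear_compose_pi: "linear (\<lambda>\<alpha> :: 'e dual. \<alpha> o\<^sub>L Blinfun \<pi>)"
  by (intro bounded_linear.linear bounded_bilinear.bounded_linear_left[OF bounded_bilinear_blinfun_compose])

lemma compose_pi_twice:
  fixes \<alpha> :: "'e dual"
  shows
  "(\<alpha> o\<^sub>L Blinfun \<pi>) o\<^sub>L Blinfun \<pi> = \<alpha> o\<^sub>L Blinfun \<pi>"
  "(\<alpha> - (\<alpha> o\<^sub>L Blinfun \<pi>)) o\<^sub>L Blinfun \<pi> = 0"
  using compose_pi_eq(1)[OF compose_pi_ann(1), of \<alpha>] compose_pi_eq(2)[OF compose_pi_ann(2), of \<alpha>] by simp_all

text \<open>On ann F the map \<open>sharp p\<close> is a bijection onto \<open>H\<close>. The form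
  is \<open>p\<close> carried over by its inverse \<open>\<kappa>\<close>, which is extended to all
  vectors by first applying \<open>\<pi>\<close>.\<close>

lemma bivector_coupled:
  assumes p: "alternating_bilinear p" and Hp: "H = sharp p ` ann F"
  shows "\<exists>s. coupled F \<pi> p (\<lambda>\<alpha> \<beta>. p (\<alpha> - (\<alpha> o\<^sub>L Blinfun \<pi>)) (\<beta> - (\<beta> o\<^sub>L Blinfun \<pi>))) s"
proof -
  have lin: "linear (p v)" "linear (\<lambda>v. p v w)" for v w by (rule alternating_bilinear_linear[OF p])+
  have sh: "linear (sharp p)" by (rule linear_sharp[OF p])
  have inj: "inj_on (sharp p) (ann F)"
  proof (rule inj_onI)
    fix a b assume ab: "a \<in> ann F" "b \<in> ann F" "sharp p a = sharp p b"
    have ann: "a - b \<in> ann F" by (rule subspace_diff[OF subspace_ann ab(1,2)])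
    have 0: "sharp p (a - b) = 0" by (simp add: linear_diff[OF sh] ab(3))
    \<comment> \<open>By antisymmetry a covector in the kernel of \<open>sharp p\<close> annihilates
      the whole image of \<open>sharp p\<close>, in particular \<open>H\<close>; together with ann F
      this leaves only 0.\<close>
    have *: "blinfun_apply (a - b) (sharp p c) = 0" for c
      using apply_sharp[OF p, of "a - b" c] apply_sharp[OF p, of c "a - b"]
        alternating_bilinear_antisym[OF p, of c "a - b"] by (simp add: 0)
    have "\<forall>v\<in>H. blinfun_apply (a - b) v = 0" unfolding Hp by (rule ballI, erule imageE) (simp only: *)
    then have "a - b \<in> ann H" by (simp only: ann_def mem_Collect_eq)
    then have "a - b \<in> ann F \<inter> ann H" using ann by blast
    also have "\<dots> = {0}" using complementary_ann by (simp add: complementary_def)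
    finally show "a = b" by simp
  qed
  define \<kappa> where "\<kappa> v = inv_into (ann F) (sharp p) (\<pi> v)" for v
  have "\<pi> v \<in> sharp p ` ann F" for v using pi_mem(1)[of v] unfolding Hp .
  then have \<kappa>: "\<kappa> v \<in> ann F" "sharp p (\<kappa> v) = \<pi> v" for v
    unfolding \<kappa>_def by (simp_all only: inv_into_into f_inv_into_f)
  have \<kappa>I: "\<kappa> v = a" if "a \<in> ann F" "sharp p a = \<pi> v" for a v
    unfolding \<kappa>_def that(2)[symmetric] by (rule inv_into_f_f[OF inj that(1)])
  have "linear \<kappa>"
  proof (rule linearI)
    fix v w r
    show "\<kappa> (v + w) = \<kappa> v + \<kappa> w"
      by (rule \<kappa>I) (simp_all add: subspace_add[OF subspace_ann] \<kappa> linear_add[OF sh] linear_add[OF pi_linear])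
    show "\<kappa> (r *\<^sub>R v) = r *\<^sub>R \<kappa> v"
      by (rule \<kappa>I) (simp_all add: subspace_scale[OF subspace_ann] \<kappa> linear_cmul[OF sh] linear_cmul[OF pi_linear])
  qed
  note s_alt = alternating_pullback[OF p this]
  have mem: "\<pi> (sharp p a) = sharp p a" if "a \<in> ann F" for a
    by (rule pi_H) (simp only: Hp imageI[OF that])
  have \<kappa>0: "\<kappa> v = 0" if "v \<in> F" for v
    by (rule \<kappa>I) (simp_all add: pi_F[OF that] linear_0[OF sh] subspace_0[OF subspace_ann])
  have 1: "p a \<beta> = p a (\<beta> o\<^sub>L Blinfun \<pi>)" if "a \<in> ann F" for a \<beta>
  proof -
    have "p a \<beta> = blinfun_apply \<beta> (sharp p a)" by (simp only: apply_sharp[OF p])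
    also have "\<dots> = blinfun_apply (\<beta> o\<^sub>L Blinfun \<pi>) (sharp p a)" by (simp only: compose_pi mem[OF that])
    also have "\<dots> = p a (\<beta> o\<^sub>L Blinfun \<pi>)" by (rule apply_sharp[OF p])
    finally show ?thesis .
  qed
  have 2: "p (\<kappa> (sharp p a)) (\<kappa> w) = - blinfun_apply a w" if a: "a \<in> ann F" for a w
  proof -
    have "\<kappa> (sharp p a) = a" by (rule \<kappa>I[OF a]) (simp add: mem[OF a])
    then have "p (\<kappa> (sharp p a)) (\<kappa> w) = - blinfun_apply a (sharp p (\<kappa> w))"
      using alternating_bilinear_antisym[OF p, of a "\<kappa> w"] by (simp add: apply_sharp[OF p])
    also have "\<dots> = - blinfun_apply a w"
      using compose_pi_eq(1)[OF a] compose_pi[of a w] by (simp only: \<kappa>)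
    finally show ?thesis .
  qed
  have 3: "alternating_bilinear (\<lambda>\<alpha> \<beta>. p (\<alpha> - (\<alpha> o\<^sub>L Blinfun \<pi>)) (\<beta> - (\<beta> o\<^sub>L Blinfun \<pi>)))"
    by (rule alternating_pullback[OF p]) (intro linear_compose_sub linear_ident linear_compose_pi)
  have 4: "p (\<kappa> v) (\<kappa> w) = 0" if "v \<in> F" for v w
    by (simp only: \<kappa>0[OF that] linear_0[OF lin(2)])
  show ?thesis
    unfolding coupled_def
    by (rule exI[of _ "\<lambda>v w. p (\<kappa> v) (\<kappa> w)"])
      (intro conjI allI ballI refl F pi_linear pi_F pi_mem(2) p s_alt 1 2 3 4)
qed

text \<open>The bivector is the reconstruction formula of \<open>bivector_of_triple\<close> at one
  point. The splitting makes the relations hold once \<open>sharp\<close> is known on ann F.\<close>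

lemma triple_coupled:
  assumes p2: "alternating_bilinear p2" and p2F: "\<And>\<alpha> \<beta>. \<alpha> \<in> ann F \<Longrightarrow> p2 \<alpha> \<beta> = 0"
    and s: "alternating_bilinear s" and sF: "\<And>v w. v \<in> F \<Longrightarrow> s v w = 0" and nd: "nondegenerate_on H s"
  shows "coupled F \<pi> (\<lambda>\<xi> \<eta>. s (inv_into H (flat s) (\<xi> o\<^sub>L Blinfun \<pi>)) (inv_into H (flat s) (\<eta> o\<^sub>L Blinfun \<pi>))
     + p2 (\<xi> - (\<xi> o\<^sub>L Blinfun \<pi>)) (\<eta> - (\<eta> o\<^sub>L Blinfun \<pi>))) p2 s"
    (is "coupled F \<pi> ?p p2 s")
proof -
  have bij: "inj_on (flat s) H" "flat s ` H = ann F"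
    using flat_bij[OF s sF nd] by (auto simp: bij_betw_def)
  have lins: "linear (s v)" "linear (\<lambda>v. s v w)" for v w by (rule alternating_bilinear_linear[OF s])+
  have linp2: "linear (p2 v)" "linear (\<lambda>v. p2 v w)" for v w by (rule alternating_bilinear_linear[OF p2])+
  have p2F': "p2 \<alpha> \<beta> = 0" if "\<beta> \<in> ann F" for \<alpha> \<beta>
    using alternating_bilinear_antisym[OF p2, of \<alpha> \<beta>] p2F[OF that] by simp
  have fl: "blinfun_apply (flat s v) = s v" for v by (simp add: flat_def blinfun_apply_Blinfun[OF lins(1)])
  have flat_lin: "flat s (v + w) = flat s v + flat s w" "flat s (r *\<^sub>R v) = r *\<^sub>R flat s v" for v w r
    by (rule blinfun_eqI, simp add: fl linear_add[OF lins(2)] linear_cmul[OF lins(2)] blinfun.add_left blinfun.scaleR_left)+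
  define \<nu> where "\<nu> \<xi> = inv_into H (flat s) (\<xi> o\<^sub>L Blinfun \<pi>)" for \<xi>
  have \<nu>: "\<nu> \<xi> \<in> H" "flat s (\<nu> \<xi>) = \<xi> o\<^sub>L Blinfun \<pi>" for \<xi>
    using compose_pi_ann(1)[of \<xi>] unfolding \<nu>_def bij(2)[symmetric] by (auto intro: inv_into_into f_inv_into_f)
  have \<nu>I: "\<nu> \<xi> = v" if "v \<in> H" "flat s v = \<xi> o\<^sub>L Blinfun \<pi>" for v \<xi>
    unfolding \<nu>_def that(2)[symmetric] by (rule inv_into_f_f[OF bij(1) that(1)])
  have s\<nu>: "s (\<nu> \<xi>) w = blinfun_apply \<xi> (\<pi> w)" for \<xi> w
    using fl[of "\<nu> \<xi>"] \<nu>(2)[of \<xi>] compose_pi[of \<xi> w] by simp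
  have "linear \<nu>"
  proof (rule linearI)
    fix v w r
    show "\<nu> (v + w) = \<nu> v + \<nu> w"
      by (rule \<nu>I) (simp_all add: subspace_add[OF H] \<nu> flat_lin linear_add[OF linear_compose_pi])
    show "\<nu> (r *\<^sub>R v) = r *\<^sub>R \<nu> v"
      by (rule \<nu>I) (simp_all add: subspace_scale[OF H] \<nu> flat_lin linear_cmul[OF linear_compose_pi])
  qed
  then have p_alt: "alternating_bilinear ?p"
    unfolding \<nu>_def[symmetric]
    by (intro alternating_add alternating_pullback[OF s] alternating_pullback[OF p2]
         linear_compose_sub linear_ident linear_compose_pi)
  have \<nu>F: "\<nu> (\<alpha> - (\<alpha> o\<^sub>L Blinfun \<pi>)) = 0" for \<alpha>
    using linear_0[OF \<open>linear \<nu>\<close>] compose_pi_twice(2)[of \<alpha>] by (simp add: \<nu>_def)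
  \<comment> \<open>On ann F, \<open>sharp\<close> is minus the inverse of \<open>flat s\<close>:
    the sign appears when the arguments of \<open>s\<close> are exchanged to let
    \<open>\<nu> \<beta>\<close> act as a covector.\<close>
  have sharp: "sharp ?p a = - \<nu> a" if a: "a \<in> ann F" for a
  proof (rule sharp_eqI[OF p_alt])
    fix \<beta>
    have "?p a \<beta> = s (\<nu> a) (\<nu> \<beta>)"
      by (simp add: \<nu>_def compose_pi_eq(1)[OF a] linear_0[OF linp2(2)])
    also have "\<dots> = - blinfun_apply \<beta> (\<pi> (\<nu> a))"
      using alternating_bilinear_antisym[OF s, of "\<nu> a" "\<nu> \<beta>"] by (simp add: s\<nu>)
    finally show "blinfun_apply \<beta> (- \<nu> a) = ?p a \<beta>"
      by (simp add: pi_H[OF \<nu>(1)] blinfun.minus_right)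
  qed
  have 1: "?p a \<beta> = ?p a (\<beta> o\<^sub>L Blinfun \<pi>)" if a: "a \<in> ann F" for a \<beta>
    by (simp only: compose_pi_twice(1) compose_pi_eq(1)[OF a] diff_self linear_0[OF linp2(2)])
  have 2: "p2 \<alpha> \<beta> = ?p (\<alpha> - (\<alpha> o\<^sub>L Blinfun \<pi>)) (\<beta> - (\<beta> o\<^sub>L Blinfun \<pi>))" for \<alpha> \<beta>
    unfolding \<nu>_def[symmetric] \<nu>F
    by (simp add: compose_pi_twice(2) linear_0[OF lins(2)] linear_diff[OF linp2(1)] linear_diff[OF linp2(2)]
        p2F[OF compose_pi_ann(1)] p2F'[OF compose_pi_ann(1)])
  have 3: "s (sharp ?p a) w = - blinfun_apply a w" if a: "a \<in> ann F" for a w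
    unfolding sharp[OF a] using compose_pi[of a w]
    by (simp only: linear_neg[OF lins(2)] s\<nu> compose_pi_eq(1)[OF a])
  show ?thesis
    unfolding coupled_def
    by (intro conjI allI ballI F pi_linear pi_F pi_mem(2) p_alt p2 s sF 1 2 3)
qed

end

text \<open>The component of \<open>v\<close> orthogonal to \<open>F\<close> is itself, through the
  inner product, a covector in \<open>ann F\<close>, so it must vanish. Membership in
  \<open>F\<close> or \<open>H\<close> is tested against covectors in this way throughout.\<close>

lemma ann_ann_subspace:
  fixes F :: "'e::euclidean_space set"
  assumes F: "subspace F" and v: "\<And>a. a \<in> ann F \<Longrightarrow> blinfun_apply a v = 0"
  shows "v \<in> F"
proof -
  obtain y z where yz: "y \<in> span F" "\<And>w. w \<in> span F \<Longrightarrow> orthogonal z w" "v = y + z"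
    using orthogonal_subspace_decomp_exists by blast
  then have "blinfun_inner_left z \<in> ann F"
    by (simp add: ann_def span_base orthogonal_def inner_commute)
  from v[OF this] have "z \<bullet> v = 0" by (simp add: inner_commute)
  moreover have "z \<bullet> y = 0" using yz(1,2) by (simp add: orthogonal_def)
  ultimately have "z = 0" using yz(3) by (simp add: inner_add_right)
  then show ?thesis using yz(1,3) F by (simp add: span_eq_iff[THEN iffD2])
qed

section \<open>Consequences of the coupling relations at a point\<close>

context
  fixes F :: "'e::euclidean_space set" and \<pi> :: "'e \<Rightarrow> 'e" and p p2 :: "'e dual \<Rightarrow> 'e dual \<Rightarrow> real"
    and s :: "'e \<Rightarrow> 'e \<Rightarrow> real"
  assumes c: "coupled F \<pi> p p2 s"
begin

lemma coupledD:
  "subspace F" "linear \<pi>" "v \<in> F \<Longrightarrow> \<pi> v = 0" "v - \<pi> v \<in> F"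
  "alternating_bilinear p" "alternating_bilinear p2" "alternating_bilinear s"
  "v \<in> F \<Longrightarrow> s v w = 0"
  "a \<in> ann F \<Longrightarrow> p a \<beta> = p a (\<beta> o\<^sub>L Blinfun \<pi>)"
  "p2 \<alpha> \<beta> = p (\<alpha> - (\<alpha> o\<^sub>L Blinfun \<pi>)) (\<beta> - (\<beta> o\<^sub>L Blinfun \<pi>))"
  "a \<in> ann F \<Longrightarrow> s (sharp p a) w = - blinfun_apply a w"
  using c unfolding coupled_def by blast+

lemma coupled_form_F: "w \<in> F \<Longrightarrow> s v w = 0"
  using alternating_bilinear_antisym[OF coupledD(7), of v w] coupledD(8) by simp

lemma coupled_pi_idem: "\<pi> (\<pi> v) = \<pi> v"
  using coupledD(3)[OF coupledD(4), of v] by (simp add: linear_diff[OF coupledD(2)])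

lemma coupled_compose: "blinfun_apply (\<alpha> o\<^sub>L Blinfun \<pi>) v = blinfun_apply \<alpha> (\<pi> v)"
  by (simp add: bounded_linear_Blinfun_apply coupledD(2) linear_conv_bounded_linear[symmetric])

text \<open>For \<open>a\<close> in ann F, \<open>p a\<close> sees a covector only through its
  restriction to the range of \<open>\<pi>\<close>, so \<open>sharp p a\<close> must lie in that
  range.\<close>

lemma coupled_pi_sharp:
  assumes "a \<in> ann F"
  shows "\<pi> (sharp p a) = sharp p a"
proof (rule blinfun_separates)
  fix \<beta>
  have "blinfun_apply \<beta> (\<pi> (sharp p a)) = p a (\<beta> o\<^sub>L Blinfun \<pi>)"
    using apply_sharp[OF coupledD(5), of "\<beta> o\<^sub>L Blinfun \<pi>" a] by (simp only: coupled_compose)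
  also have "\<dots> = blinfun_apply \<beta> (sharp p a)"
    by (simp only: coupledD(9)[OF assms, of \<beta>, symmetric] apply_sharp[OF coupledD(5)])
  finally show "blinfun_apply \<beta> (\<pi> (sharp p a)) = blinfun_apply \<beta> (sharp p a)" .
qed

lemma coupled_pi_mem_sharp: "\<exists>a\<in>ann F. sharp p a = \<pi> v"
proof
  have lin: "linear (s v)" "linear (\<lambda>v. s v w)" for v w by (rule alternating_bilinear_linear[OF coupledD(7)])+
  \<comment> \<open>The witness is forced by \<open>s (sharp p a) = - a\<close>. With it,
    \<open>sharp p a - v\<close> lies in the kernel of \<open>s\<close>; pairing the kernel with
    vectors \<open>sharp p b\<close> shows that every \<open>b\<close> in ann F vanishes on it, so
    the kernel is contained in \<open>F\<close>.\<close>
  define a where "a = - Blinfun (s v)"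
  have a: "blinfun_apply a w = - s v w" for w
    by (simp add: a_def blinfun.minus_left blinfun_apply_Blinfun[OF lin(1)])
  show ann: "a \<in> ann F" by (simp add: ann_def a coupled_form_F)
  have s0: "s (sharp p a - v) w = 0" for w
    by (simp add: linear_diff[OF lin(2)] coupledD(11)[OF ann] a)
  have "blinfun_apply b (sharp p a - v) = 0" if "b \<in> ann F" for b
    using coupledD(11)[OF that, of "sharp p a - v"] s0[of "sharp p b"]
      alternating_bilinear_antisym[OF coupledD(7), of "sharp p b" "sharp p a - v"] by simp
  then have "sharp p a - v \<in> F" by (rule ann_ann_subspace[OF coupledD(1)])
  from coupledD(3)[OF this] show "sharp p a = \<pi> v"
    by (simp add: linear_diff[OF coupledD(2)] coupled_pi_sharp[OF ann])
qed

lemma coupled_range_pi: "range \<pi> = sharp p ` ann F"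
proof
  show "range \<pi> \<subseteq> sharp p ` ann F"
  proof
    fix w assume "w \<in> range \<pi>"
    then obtain v where "w = \<pi> v" by blast
    then show "w \<in> sharp p ` ann F" using coupled_pi_mem_sharp[of v] by (metis imageI)
  qed
  show "sharp p ` ann F \<subseteq> range \<pi>"
  proof
    fix w assume "w \<in> sharp p ` ann F"
    then obtain a where "a \<in> ann F" "w = sharp p a" by blast
    then have "w = \<pi> w" by (simp only: coupled_pi_sharp)
    then show "w \<in> range \<pi>" by (rule range_eqI)
  qed
qed

lemma coupled_form_sharp:
  assumes "a \<in> ann F" "b \<in> ann F"
  shows "s (sharp p a) (sharp p b) = p a b"
  unfolding coupledD(11)[OF assms(1)] apply_sharp[OF coupledD(5)]
  using alternating_bilinear_antisym[OF coupledD(5), of a b] by simp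

lemma coupled_form_pi: "s v w = s (\<pi> v) (\<pi> w)"
proof -
  have lin: "linear (s v)" "linear (\<lambda>v. s v w)" for v w by (rule alternating_bilinear_linear[OF coupledD(7)])+
  have "s (v - \<pi> v) w = 0" by (rule coupledD(8)[OF coupledD(4)])
  moreover have "s (\<pi> v) (w - \<pi> w) = 0" by (rule coupled_form_F[OF coupledD(4)])
  ultimately show ?thesis by (simp add: linear_diff[OF lin(1)] linear_diff[OF lin(2)])
qed

text \<open>A form that kills \<open>F\<close> is determined on the range of \<open>\<pi>\<close>,
  and that range is exhausted by the vectors \<open>sharp p a\<close>. This is the uniqueness behind
  the definite description in \<open>coupling_form\<close>.\<close>

lemma coupled_form_unique:
  assumes "alternating_bilinear s'" "\<And>v w. v \<in> F \<Longrightarrow> s' v w = 0"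
    "\<And>a b. a \<in> ann F \<Longrightarrow> b \<in> ann F \<Longrightarrow> s' (sharp p a) (sharp p b) = p a b"
  shows "s' = s"
proof (intro ext)
  fix v w
  have lin: "linear (s' v)" "linear (\<lambda>v. s' v w)" for v w by (rule alternating_bilinear_linear[OF assms(1)])+
  have "s' (v - \<pi> v) w = 0" by (rule assms(2)[OF coupledD(4)])
  moreover have "s' (\<pi> v) (w - \<pi> w) = 0"
    using alternating_bilinear_antisym[OF assms(1), of "\<pi> v" "w - \<pi> w"] assms(2)[OF coupledD(4)] by simp
  ultimately have "s' v w = s' (\<pi> v) (\<pi> w)" by (simp add: linear_diff[OF lin(1)] linear_diff[OF lin(2)])
  moreover obtain a b where "a \<in> ann F" "b \<in> ann F" "sharp p a = \<pi> v" "sharp p b = \<pi> w"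
    using coupled_pi_mem_sharp by metis
  ultimately show "s' v w = s v w"
    using assms(3) coupled_form_sharp coupled_form_pi by metis
qed

lemma coupled_nondegenerate: "nondegenerate_on (range \<pi>) s"
  unfolding nondegenerate_on_def
proof (intro ballI impI)
  fix v assume v: "v \<in> range \<pi>" "\<forall>w\<in>range \<pi>. s v w = 0"
  then obtain a where a: "a \<in> ann F" "v = sharp p a" by (auto simp: coupled_range_pi)
  have "blinfun_apply a w = 0" for w
    using coupledD(11)[OF a(1), of w] coupled_form_pi[of v w] v coupled_pi_sharp[OF a(1)]
    by (simp add: a(2))
  then have "a = 0" by (intro blinfun_eqI) simp
  then show "v = 0" by (simp add: a(2) linear_0[OF linear_sharp[OF coupledD(5)]])
qed

lemma coupled_pi_eq: "proj_along (range \<pi>) F = \<pi>" "complementary (range \<pi>) F"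
proof -
  show comp: "complementary (range \<pi>) F"
    unfolding complementary_def
  proof
    have "\<pi> v = 0" if "\<pi> v \<in> F" for v using coupledD(3)[OF that] by (simp add: coupled_pi_idem)
    then show "range \<pi> \<inter> F = {0}"
      using subspace_0[OF coupledD(1)] linear_0[OF coupledD(2)] by (auto intro!: image_eqI[of 0 \<pi> 0])
    have "v = \<pi> v + (v - \<pi> v)" for v by simp
    then show "{d + e |d e. d \<in> range \<pi> \<and> e \<in> F} = UNIV" using coupledD(4) by blast
  qed
  show "proj_along (range \<pi>) F = \<pi>"
    by (intro ext proj_along_unique[OF linear_subspace_image[OF coupledD(2) subspace_UNIV] coupledD(1) comp])
      (simp_all add: coupledD(4))
qed

lemma coupled_compose_ann:
  "\<alpha> o\<^sub>L Blinfun \<pi> \<in> ann F"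
  by (simp add: ann_def coupled_compose coupledD(3) del: blinfun_apply_blinfun_compose)

lemma coupled_compose_eq: "a \<in> ann F \<Longrightarrow> a o\<^sub>L Blinfun \<pi> = a"
  by (rule compose_pi_eq(1)[OF linear_subspace_image[OF coupledD(2) subspace_UNIV] coupledD(1)
        coupled_pi_eq(2) coupled_pi_eq(1)[symmetric]])

lemma coupled_p2_ann: "a \<in> ann F \<Longrightarrow> p2 a \<beta> = 0"
  by (simp add: coupledD(10) coupled_compose_eq linear_0[OF alternating_bilinear_linear(2)[OF coupledD(5)]])

text \<open>There is no component of bidegree (1,1): a covector in ann F pairs under
  \<open>p\<close> only with the ann F component of the other argument.\<close>

lemma coupled_decompose: "p \<xi> \<eta> = p (\<xi> o\<^sub>L Blinfun \<pi>) (\<eta> o\<^sub>L Blinfun \<pi>) + p2 \<xi> \<eta>"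
proof -
  have lin: "linear (p v)" "linear (\<lambda>v. p v w)" for v w by (rule alternating_bilinear_linear[OF coupledD(5)])+
  have 1: "p (\<alpha> o\<^sub>L Blinfun \<pi>) \<beta> = p (\<alpha> o\<^sub>L Blinfun \<pi>) (\<beta> o\<^sub>L Blinfun \<pi>)" for \<alpha> \<beta>
    by (rule coupledD(9)[OF coupled_compose_ann])
  have 2: "p \<beta> (\<alpha> o\<^sub>L Blinfun \<pi>) = p (\<beta> o\<^sub>L Blinfun \<pi>) (\<alpha> o\<^sub>L Blinfun \<pi>)" for \<alpha> \<beta>
    using 1[of \<alpha> \<beta>] alternating_bilinear_antisym[OF coupledD(5)] by (metis neg_equal_iff_equal)
  show ?thesis
    by (simp add: coupledD(10) linear_diff[OF lin(1)] linear_diff[OF lin(2)] 1[of \<xi> \<eta>] 2[of \<xi> \<eta>])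
qed

text \<open>The inverse of \<open>flat s\<close> on ann F is minus \<open>sharp p\<close>, and the
  two signs cancel in the bilinear expression.\<close>

lemma coupled_reconstruct:
  "p \<xi> \<eta> = s (inv_into (range \<pi>) (flat s) (\<xi> o\<^sub>L Blinfun \<pi>)) (inv_into (range \<pi>) (flat s) (\<eta> o\<^sub>L Blinfun \<pi>))
     + p2 (\<xi> - (\<xi> o\<^sub>L Blinfun \<pi>)) (\<eta> - (\<eta> o\<^sub>L Blinfun \<pi>))"
proof -
  have lin: "linear (s v)" "linear (\<lambda>v. s v w)" for v w by (rule alternating_bilinear_linear[OF coupledD(7)])+
  have linp2: "linear (p2 v)" "linear (\<lambda>v. p2 v w)" for v w by (rule alternating_bilinear_linear[OF coupledD(6)])+
  note H = linear_subspace_image[OF coupledD(2) subspace_UNIV]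
  note bij = flat_bij[OF H coupledD(1) coupled_pi_eq(2) coupled_pi_eq(1)[symmetric] coupledD(7,8) coupled_nondegenerate]
  have inv: "inv_into (range \<pi>) (flat s) a = - sharp p a" if a: "a \<in> ann F" for a
  proof (rule inv_into_f_eq)
    show "inj_on (flat s) (range \<pi>)" using bij by (simp add: bij_betw_def)
    have "- sharp p a = \<pi> (- sharp p a)" by (simp add: linear_neg[OF coupledD(2)] coupled_pi_sharp[OF a])
    then show "- sharp p a \<in> range \<pi>" by (rule range_eqI)
    show "flat s (- sharp p a) = a"
      by (rule blinfun_eqI)
        (simp add: flat_def blinfun_apply_Blinfun[OF lin(1)] linear_neg[OF lin(2)] coupledD(11)[OF a])
  qed
  have p2F: "p2 \<alpha> (\<beta> o\<^sub>L Blinfun \<pi>) = 0" for \<alpha> \<beta>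
    using alternating_bilinear_antisym[OF coupledD(6), of \<alpha> "\<beta> o\<^sub>L Blinfun \<pi>"]
      coupled_p2_ann[OF coupled_compose_ann, of \<beta> \<alpha>] by simp
  show ?thesis
    using coupled_form_sharp[OF coupled_compose_ann coupled_compose_ann, of \<xi> \<eta>]
    by (simp add: inv[OF coupled_compose_ann] linear_neg[OF lin(1)] linear_neg[OF lin(2)] linear_diff[OF linp2(1)]
        linear_diff[OF linp2(2)] p2F coupled_p2_ann[OF coupled_compose_ann] coupled_decompose[of \<xi> \<eta>])
qed

text \<open>The relations are natural under linear isomorphisms. With a chart differential as
  \<open>D\<close> they pass from the tangent spaces to the coordinate space, where the same
  \<open>S\<close> serves at all points.\<close>

lemma coupled_transport:
  fixes D E :: "'e \<Rightarrow> 'e"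
  assumes D: "linear D" "linear E" "\<And>v. E (D v) = v" "\<And>v. D (E v) = v" and S: "subspace S" "\<And>v. v \<in> F \<longleftrightarrow> D v \<in> S"
  shows "coupled S (\<lambda>v. D (\<pi> (E v))) (\<lambda>\<alpha> \<beta>. p (\<alpha> o\<^sub>L Blinfun D) (\<beta> o\<^sub>L Blinfun D))
    (\<lambda>\<alpha> \<beta>. p2 (\<alpha> o\<^sub>L Blinfun D) (\<beta> o\<^sub>L Blinfun D)) (\<lambda>v w. s (E v) (E w))"
proof -
  let ?p = "\<lambda>\<alpha> \<beta>. p (\<alpha> o\<^sub>L Blinfun D) (\<beta> o\<^sub>L Blinfun D)"
  let ?\<pi> = "\<lambda>v. D (\<pi> (E v))"
  have lD: "linear (\<lambda>\<alpha>. (\<alpha> :: 'e dual) o\<^sub>L Blinfun D)"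
    by (intro bounded_linear.linear bounded_bilinear.bounded_linear_left[OF bounded_bilinear_blinfun_compose])
  have ap: "blinfun_apply (\<alpha> o\<^sub>L Blinfun D) v = blinfun_apply \<alpha> (D v)" for \<alpha> :: "'e dual" and v
    by (simp add: bounded_linear_Blinfun_apply D(1) linear_conv_bounded_linear[symmetric])
  have lpi: "linear ?\<pi>"
    using linear_compose[OF linear_compose[OF D(2) coupledD(2)] D(1)] by (simp add: o_def)
  have ap\<pi>: "blinfun_apply (\<alpha> o\<^sub>L Blinfun ?\<pi>) v = blinfun_apply \<alpha> (D (\<pi> (E v)))" for \<alpha> :: "'e dual" and v
    by (simp add: bounded_linear_Blinfun_apply lpi linear_conv_bounded_linear[symmetric])
  have comm: "(\<alpha> o\<^sub>L Blinfun ?\<pi>) o\<^sub>L Blinfun D = (\<alpha> o\<^sub>L Blinfun D) o\<^sub>L Blinfun \<pi>" for \<alpha> :: "'e dual"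
    by (rule blinfun_eqI) (simp only: ap ap\<pi> coupled_compose D(3))
  have E: "E v \<in> F \<longleftrightarrow> v \<in> S" for v using S(2)[of "E v"] D(4) by simp
  have ann: "a o\<^sub>L Blinfun D \<in> ann F" if "a \<in> ann S" for a
    using that S(2) unfolding ann_def mem_Collect_eq ap by blast
  have alt: "alternating_bilinear ?p" by (rule alternating_pullback[OF coupledD(5) lD])
  have sh: "sharp ?p \<alpha> = D (sharp p (\<alpha> o\<^sub>L Blinfun D))" for \<alpha>
    by (rule sharp_eqI[OF alt]) (simp only: ap[symmetric] apply_sharp[OF coupledD(5)])
  have mem: "v - ?\<pi> v \<in> S" for v
  proof -
    have "v - ?\<pi> v = D (E v - \<pi> (E v))" by (simp add: linear_diff[OF D(1)] D(4))
    then show ?thesis using S(2) coupledD(4) by metis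
  qed
  have p2: "p2 (\<alpha> o\<^sub>L Blinfun D) (\<beta> o\<^sub>L Blinfun D) = ?p (\<alpha> - (\<alpha> o\<^sub>L Blinfun ?\<pi>)) (\<beta> - (\<beta> o\<^sub>L Blinfun ?\<pi>))" for \<alpha> \<beta>
    by (simp only: coupledD(10) linear_diff[OF lD] comm)
  show ?thesis
    unfolding coupled_def
  proof (intro conjI allI ballI)
    show "?\<pi> v = 0" if "v \<in> S" for v
      using coupledD(3)[of "E v"] that by (simp add: E linear_0[OF D(1)])
    show "s (E v) (E w) = 0" if "v \<in> S" for v w
      using coupledD(8)[of "E v"] that by (simp add: E)
    show "?p a \<beta> = ?p a (\<beta> o\<^sub>L Blinfun ?\<pi>)" if "a \<in> ann S" for a \<beta>
      by (simp only: comm coupledD(9)[OF ann[OF that], of "\<beta> o\<^sub>L Blinfun D"])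
    show "s (E (sharp ?p a)) (E w) = - blinfun_apply a w" if "a \<in> ann S" for a w
      by (simp only: sh D(3) coupledD(11)[OF ann[OF that]] ap D(4))
  qed (rule S(1) lpi mem alt alternating_pullback[OF coupledD(6) lD] alternating_pullback[OF coupledD(7) D(2)] p2)+
qed

end

text \<open>Makes the dependence on the base point explicit: the covectors on the right are
  constant, and only \<open>\<pi>\<close> and \<open>p\<close> vary. It is used both to
  differentiate the (2,0) component and to prove it smooth.\<close>

lemma coupled_dual_expand:
  assumes "coupled S \<pi> p p2 s"
  shows "p (\<alpha> o\<^sub>L Blinfun \<pi>) (\<beta> o\<^sub>L Blinfun \<pi>) =
    (\<Sum>b\<in>Basis. \<Sum>c\<in>Basis. blinfun_apply \<alpha> (\<pi> b) * (blinfun_apply \<beta> (\<pi> c) * p (blinfun_inner_left b) (blinfun_inner_left c)))"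
proof -
  have lin: "linear (p \<alpha>)" "linear (\<lambda>\<alpha>. p \<alpha> \<beta>)" for \<alpha> \<beta>
    by (rule alternating_bilinear_linear[OF coupledD(5)[OF assms]])+
  have exp: "\<alpha> o\<^sub>L Blinfun \<pi> = (\<Sum>b\<in>Basis. blinfun_apply \<alpha> (\<pi> b) *\<^sub>R blinfun_inner_left b)" for \<alpha> :: "'a dual"
    using dual_eq_sum_Basis[of "\<alpha> o\<^sub>L Blinfun \<pi>"] by (simp only: coupled_compose[OF assms])
  show ?thesis
    unfolding exp linear_sum[OF lin(2)] linear_cmul[OF lin(2)] linear_sum[OF lin(1)] linear_cmul[OF lin(1)]
    by (simp add: sum_distrib_left mult.left_commute) (rule sum.swap)
qed

section \<open>The Jacobi identity at a point\<close>

text \<open>The product rule, with the family \<open>L\<close> differentiable only for each fixed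
  vector; the expansion in \<open>Basis\<close> supplies the joint statement.\<close>

lemma has_derivative_linear_family:
  fixes L :: "'a::real_normed_vector \<Rightarrow> 'b::euclidean_space \<Rightarrow> 'c::real_normed_vector"
  assumes U: "open U" "x \<in> U" and lin: "\<And>u. u \<in> U \<Longrightarrow> linear (L u)"
    and diff: "\<And>v. (\<lambda>u. L u v) differentiable (at x)" and f: "(f has_derivative f') (at x)"
  shows "((\<lambda>u. L u (f u)) has_derivative
    (\<lambda>v. frechet_derivative (\<lambda>u. L u (f x)) (at x) v + L x (f' v))) (at x)"
proof -
  have D: "((\<lambda>u. L u b) has_derivative frechet_derivative (\<lambda>u. L u b) (at x)) (at x)" for b
    by (rule frechet_derivative_works[THEN iffD1, OF diff])
  have fb: "((\<lambda>u. f u \<bullet> b) has_derivative (\<lambda>v. f' v \<bullet> b)) (at x)" for b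
    by (rule bounded_linear.has_derivative[OF bounded_linear_inner_left f])
  have 1: "((\<lambda>u. \<Sum>b\<in>Basis. (f x \<bullet> b) *\<^sub>R L u b) has_derivative
      (\<lambda>v. \<Sum>b\<in>Basis. (f x \<bullet> b) *\<^sub>R frechet_derivative (\<lambda>u. L u b) (at x) v)) (at x)"
    by (rule has_derivative_sum, rule has_derivative_scaleR_right, rule D)
  have "((\<lambda>u. L u (f x)) has_derivative
      (\<lambda>v. \<Sum>b\<in>Basis. (f x \<bullet> b) *\<^sub>R frechet_derivative (\<lambda>u. L u b) (at x) v)) (at x)"
    by (rule has_derivative_transform_within_open[OF 1 U]) (rule linear_eq_sum_Basis[OF lin, symmetric])
  from fun_cong[OF frechet_derivative_at[OF this], symmetric]
  have 2: "frechet_derivative (\<lambda>u. L u (f x)) (at x) v =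
      (\<Sum>b\<in>Basis. (f x \<bullet> b) *\<^sub>R frechet_derivative (\<lambda>u. L u b) (at x) v)" for v .
  have "((\<lambda>u. \<Sum>b\<in>Basis. (f u \<bullet> b) *\<^sub>R L u b) has_derivative
      (\<lambda>v. \<Sum>b\<in>Basis. (f x \<bullet> b) *\<^sub>R frechet_derivative (\<lambda>u. L u b) (at x) v + (f' v \<bullet> b) *\<^sub>R L x b)) (at x)"
    by (rule has_derivative_sum, rule has_derivative_scaleR[OF fb D])
  then have "((\<lambda>u. L u (f u)) has_derivative
      (\<lambda>v. \<Sum>b\<in>Basis. (f x \<bullet> b) *\<^sub>R frechet_derivative (\<lambda>u. L u b) (at x) v + (f' v \<bullet> b) *\<^sub>R L x b)) (at x)"
    by (rule has_derivative_transform_within_open[OF _ U]) (rule linear_eq_sum_Basis[OF lin, symmetric])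
  moreover have "(\<Sum>b\<in>Basis. (f x \<bullet> b) *\<^sub>R frechet_derivative (\<lambda>u. L u b) (at x) v + (f' v \<bullet> b) *\<^sub>R L x b)
      = frechet_derivative (\<lambda>u. L u (f x)) (at x) v + L x (f' v)" for v
    unfolding 2 sum.distrib linear_eq_sum_Basis[OF lin[OF U(2)], of "f' v", symmetric] ..
  ultimately show ?thesis by (simp only:)
qed

lemma has_derivative_bilinear_family:
  fixes B :: "'a::real_normed_vector \<Rightarrow> 'b::euclidean_space \<Rightarrow> 'c::euclidean_space \<Rightarrow> real"
  assumes U: "open U" "x \<in> U" and B: "\<And>u. u \<in> U \<Longrightarrow> bilinear (B u)"
    and diff: "\<And>v w. (\<lambda>u. B u v w) differentiable (at x)"
    and f: "(f has_derivative f') (at x)" and g: "(g has_derivative g') (at x)"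
  shows "((\<lambda>u. B u (f u) (g u)) has_derivative
    (\<lambda>v. frechet_derivative (\<lambda>u. B u (f x) (g x)) (at x) v + B x (f' v) (g x) + B x (f x) (g' v))) (at x)"
proof -
  have lin: "linear (\<lambda>v. B u v w)" "linear (B u v)" if "u \<in> U" for u v w
    using B[OF that] by (simp_all add: bilinear_def)
  have 1: "((\<lambda>u. B u (f u) w) has_derivative
    (\<lambda>v. frechet_derivative (\<lambda>u. B u (f x) w) (at x) v + B x (f' v) w)) (at x)" for w
    by (rule has_derivative_linear_family[where L = "\<lambda>u v. B u v w", OF U lin(1) diff f])
  then have "(\<lambda>u. B u (f u) w) differentiable (at x)" for w
    by (rule differentiableI)
  from has_derivative_linear_family[where L = "\<lambda>u. B u (f u)", OF U lin(2) this g]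
  show ?thesis
    by (simp only: frechet_derivative_at[OF 1, symmetric])
qed

text \<open>Splitting the three arguments gives eight terms; a cyclic rotation brings each of them
  to one of four types, according to how many arguments lie in \<open>B\<close>.\<close>

lemma cyclic_trilinear_zero:
  fixes J :: "'v::real_vector \<Rightarrow> 'v \<Rightarrow> 'v \<Rightarrow> real"
  assumes cyc: "\<And>\<alpha> \<beta> \<gamma>. J \<alpha> \<beta> \<gamma> = J \<beta> \<gamma> \<alpha>"
    and add: "\<And>\<alpha> \<alpha>' \<beta> \<gamma>. J (\<alpha> + \<alpha>') \<beta> \<gamma> = J \<alpha> \<beta> \<gamma> + J \<alpha>' \<beta> \<gamma>"
    and dec: "\<And>\<alpha>. \<exists>a\<in>A. \<exists>b\<in>B. \<alpha> = a + b"
    and zero: "\<And>a b c. a \<in> A \<Longrightarrow> b \<in> A \<Longrightarrow> c \<in> A \<Longrightarrow> J a b c = 0"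
      "\<And>a b c. a \<in> A \<Longrightarrow> b \<in> A \<Longrightarrow> c \<in> B \<Longrightarrow> J a b c = 0"
      "\<And>a b c. a \<in> A \<Longrightarrow> b \<in> B \<Longrightarrow> c \<in> B \<Longrightarrow> J a b c = 0"
      "\<And>a b c. a \<in> B \<Longrightarrow> b \<in> B \<Longrightarrow> c \<in> B \<Longrightarrow> J a b c = 0"
  shows "J \<alpha> \<beta> \<gamma> = 0"
proof -
  have add2: "J \<alpha> (\<beta> + \<beta>') \<gamma> = J \<alpha> \<beta> \<gamma> + J \<alpha> \<beta>' \<gamma>" for \<alpha> \<beta> \<beta>' \<gamma>
    using add[of \<beta> \<beta>' \<gamma> \<alpha>] cyc[of \<alpha> "\<beta> + \<beta>'" \<gamma>] cyc[of \<alpha> \<beta> \<gamma>] cyc[of \<alpha> \<beta>' \<gamma>] by simp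
  have add3: "J \<alpha> \<beta> (\<gamma> + \<gamma>') = J \<alpha> \<beta> \<gamma> + J \<alpha> \<beta> \<gamma>'" for \<alpha> \<beta> \<gamma> \<gamma>'
    using add[of \<gamma> \<gamma>' \<alpha> \<beta>] cyc[of "\<gamma> + \<gamma>'" \<alpha> \<beta>] cyc[of \<gamma> \<alpha> \<beta>] cyc[of \<gamma>' \<alpha> \<beta>] by simp
  obtain a1 a2 b1 b2 c1 c2 where *: "a1 \<in> A" "a2 \<in> B" "b1 \<in> A" "b2 \<in> B" "c1 \<in> A" "c2 \<in> B"
    "\<alpha> = a1 + a2" "\<beta> = b1 + b2" "\<gamma> = c1 + c2" using dec by metis
  have "J a1 b2 c1 = J c1 a1 b2" "J a2 b1 c1 = J b1 c1 a2" "J a2 b1 c2 = J b1 c2 a2" "J a2 b2 c1 = J c1 a2 b2"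
    by (rule cyc[symmetric] cyc)+
  then show ?thesis
    unfolding * add add2 add3
    using zero(1)[OF *(1,3,5)] zero(2)[OF *(1,3,6)] zero(2)[OF *(5,1,4)] zero(2)[OF *(3,5,2)]
      zero(3)[OF *(1,4,6)] zero(3)[OF *(3,6,2)] zero(3)[OF *(5,2,4)] zero(4)[OF *(2,4,6)]
    by linarith
qed

definition jacobiator ::
  "('e::euclidean_space \<Rightarrow> 'e dual \<Rightarrow> 'e dual \<Rightarrow> real) \<Rightarrow> 'e \<Rightarrow> 'e dual \<Rightarrow> 'e dual \<Rightarrow> 'e dual \<Rightarrow> real" where
  "jacobiator p x \<alpha> \<beta> \<gamma> =
     frechet_derivative (\<lambda>u. p u \<beta> \<gamma>) (at x) (sharp (p x) \<alpha>)
     + frechet_derivative (\<lambda>u. p u \<gamma> \<alpha>) (at x) (sharp (p x) \<beta>)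
     + frechet_derivative (\<lambda>u. p u \<alpha> \<beta>) (at x) (sharp (p x) \<gamma>)"

context
  fixes p :: "'e::euclidean_space \<Rightarrow> 'e dual \<Rightarrow> 'e dual \<Rightarrow> real" and V :: "'e set" and x :: 'e
  assumes V: "open V" "x \<in> V" and alt: "\<And>u. u \<in> V \<Longrightarrow> alternating_bilinear (p u)"
    and diff: "\<And>\<alpha> \<beta>. (\<lambda>u. p u \<alpha> \<beta>) differentiable (at x)"
begin

lemma bivec_derivative: "((\<lambda>u. p u \<alpha> \<beta>) has_derivative frechet_derivative (\<lambda>u. p u \<alpha> \<beta>) (at x)) (at x)"
  by (rule frechet_derivative_works[THEN iffD1, OF diff])

lemma bivec_derivative_eqI:
  assumes "(f has_derivative f') (at x)" "\<And>u. u \<in> V \<Longrightarrow> f u = p u \<alpha> \<beta>"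
  shows "frechet_derivative (\<lambda>u. p u \<alpha> \<beta>) (at x) v = f' v"
  using frechet_derivative_at[OF has_derivative_transform_within_open[OF assms(1) V assms(2)]] by simp

lemma bivec_derivative_add:
  "frechet_derivative (\<lambda>u. p u (\<alpha> + \<alpha>') \<beta>) (at x) v =
    frechet_derivative (\<lambda>u. p u \<alpha> \<beta>) (at x) v + frechet_derivative (\<lambda>u. p u \<alpha>' \<beta>) (at x) v"
  by (rule bivec_derivative_eqI[OF has_derivative_add[OF bivec_derivative bivec_derivative]])
    (simp add: linear_add[OF alternating_bilinear_linear(2)[OF alt]])

lemma bivec_derivative_antisym:
  "frechet_derivative (\<lambda>u. p u \<alpha> \<beta>) (at x) v = - frechet_derivative (\<lambda>u. p u \<beta> \<alpha>) (at x) v"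
  by (rule bivec_derivative_eqI[OF has_derivative_minus[OF bivec_derivative]])
    (rule alternating_bilinear_antisym[OF alt, symmetric])

lemma jacobiator_cyclic: "jacobiator p x \<alpha> \<beta> \<gamma> = jacobiator p x \<beta> \<gamma> \<alpha>"
  by (simp add: jacobiator_def)

lemma jacobiator_add: "jacobiator p x (\<alpha> + \<alpha>') \<beta> \<gamma> = jacobiator p x \<alpha> \<beta> \<gamma> + jacobiator p x \<alpha>' \<beta> \<gamma>"
  using bivec_derivative_antisym[of \<gamma> "\<alpha> + \<alpha>'"] bivec_derivative_antisym[of \<gamma> \<alpha>] bivec_derivative_antisym[of \<gamma> \<alpha>']
  by (simp add: jacobiator_def bivec_derivative_add linear_add[OF linear_sharp[OF alt[OF V(2)]]]
      linear_add[OF linear_frechet_derivative[OF diff]])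

text \<open>Pairing with a constant covector commutes with differentiation. Derivatives of fields
  \<open>sharp (p u) \<alpha>\<close>, and hence their brackets, thus become derivatives of
  coefficients of \<open>p\<close>.\<close>

lemma sharp_derivative:
  "\<exists>f'. ((\<lambda>u. sharp (p u) \<alpha>) has_derivative f') (at x) \<and>
    (\<forall>v \<beta>. blinfun_apply \<beta> (f' v) = frechet_derivative (\<lambda>u. p u \<alpha> \<beta>) (at x) v)"
proof -
  have D: "((\<lambda>u. sharp (p u) \<alpha>) has_derivative
      (\<lambda>v. \<Sum>b\<in>Basis. frechet_derivative (\<lambda>u. p u \<alpha> (blinfun_inner_left b)) (at x) v *\<^sub>R b)) (at x)"
    (is "(_ has_derivative ?f') _")
    by (rule has_derivative_transform_within_open[OF _ V sharp_eq_sum[OF alt, symmetric]])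
      (rule has_derivative_sum, rule has_derivative_scaleR_left, rule bivec_derivative)
  have "blinfun_apply \<beta> (?f' v) = frechet_derivative (\<lambda>u. p u \<alpha> \<beta>) (at x) v" for v \<beta>
    by (rule bivec_derivative_eqI[OF bounded_linear.has_derivative[OF blinfun.bounded_linear_right D], symmetric])
      (rule apply_sharp[OF alt])
  with D show ?thesis by blast
qed

end

text \<open>Projectability enters only through its consequence \<open>X' S \<subseteq> S\<close> at the single point \<open>x\<close>.\<close>

definition projectable_germ ::
  "'e::euclidean_space set \<Rightarrow> 'e set \<Rightarrow> ('e \<Rightarrow> 'e \<Rightarrow> 'e) \<Rightarrow> 'e \<Rightarrow> ('e \<Rightarrow> 'e) \<Rightarrow> ('e \<Rightarrow> 'e) \<Rightarrow> bool" where
  "projectable_germ V S \<pi> x X X' \<longleftrightarrow> (X has_derivative X') (at x) \<and>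
     (\<exists>W. open W \<and> x \<in> W \<and> W \<subseteq> V \<and> (\<forall>u\<in>W. \<pi> u (X u) = X u)) \<and> (\<forall>v\<in>S. X' v \<in> S)"

section \<open>The bigraded components of the Jacobi identity\<close>

context
  fixes V S :: "'e::euclidean_space set" and x :: 'e
    and \<pi> :: "'e \<Rightarrow> 'e \<Rightarrow> 'e" and p p2 :: "'e \<Rightarrow> 'e dual \<Rightarrow> 'e dual \<Rightarrow> real" and s :: "'e \<Rightarrow> 'e \<Rightarrow> 'e \<Rightarrow> real"
  assumes V: "open V" "x \<in> V" and c: "\<And>u. u \<in> V \<Longrightarrow> coupled S (\<pi> u) (p u) (p2 u) (s u)"
    and dpi: "\<And>e. (\<lambda>u. \<pi> u e) differentiable (at x)"
    and dp: "\<And>\<alpha> \<beta>. (\<lambda>u. p u \<alpha> \<beta>) differentiable (at x)"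
    and dp2: "\<And>\<alpha> \<beta>. (\<lambda>u. p2 u \<alpha> \<beta>) differentiable (at x)"
    and ds: "\<And>v w. (\<lambda>u. s u v w) differentiable (at x)"
begin

lemmas cx = c[OF V(2)]
lemmas altp = coupledD(5)[OF c] and altp2 = coupledD(6)[OF c] and alts = coupledD(7)[OF c]
lemmas sharp_der = sharp_derivative[OF V altp dp]
lemmas antisym_dp = bivec_derivative_antisym[OF V altp dp]

lemma sharp_pi_eq: "a \<in> ann S \<Longrightarrow> u \<in> V \<Longrightarrow> \<pi> u (sharp (p u) a) = sharp (p u) a"
  by (rule coupled_pi_sharp[OF c])

text \<open>Differentiating \<open>\<pi> u (X u) = X u\<close> gives one term that involves only the
  value \<open>X x\<close> and one in the range of \<open>\<pi> x\<close>, which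
  \<open>\<gamma>\<close> kills. Sections of \<open>H\<close> with the same value at
  \<open>x\<close> are therefore interchangeable under \<open>\<gamma>\<close>.\<close>

lemma section_derivative:
  assumes X: "(X has_derivative X') (at x)" and W: "open W" "x \<in> W" "W \<subseteq> V" "\<And>u. u \<in> W \<Longrightarrow> \<pi> u (X u) = X u"
    and \<gamma>: "\<gamma> \<in> ann (range (\<pi> x))"
  shows "blinfun_apply \<gamma> (X' v) = blinfun_apply \<gamma> (frechet_derivative (\<lambda>u. \<pi> u (X x)) (at x) v)"
proof -
  have "((\<lambda>u. \<pi> u (X u)) has_derivative
    (\<lambda>v. frechet_derivative (\<lambda>u. \<pi> u (X x)) (at x) v + \<pi> x (X' v))) (at x)"
    by (rule has_derivative_linear_family[OF V coupledD(2)[OF c] dpi X])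
  then have "(X has_derivative (\<lambda>v. frechet_derivative (\<lambda>u. \<pi> u (X x)) (at x) v + \<pi> x (X' v))) (at x)"
    by (rule has_derivative_transform_within_open[OF _ W(1,2,4)])
  from has_derivative_unique[OF X this]
  have "X' v = frechet_derivative (\<lambda>u. \<pi> u (X x)) (at x) v + \<pi> x (X' v)" by (rule fun_cong)
  then have "blinfun_apply \<gamma> (X' v) = blinfun_apply \<gamma> (frechet_derivative (\<lambda>u. \<pi> u (X x)) (at x) v) + blinfun_apply \<gamma> (\<pi> x (X' v))"
    by (metis blinfun.add_right)
  moreover have "blinfun_apply \<gamma> (\<pi> x (X' v)) = 0" using \<gamma> by (simp add: ann_def)
  ultimately show ?thesis by simp
qed

text \<open>Obtained by differentiating \<open>s u (sharp (p u) b) w = - b w\<close> with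
  \<open>w\<close> held fixed: the right side is constant, and the term in which
  \<open>sharp (p u) b\<close> moves is evaluated by applying the same identity to
  \<open>c\<close>.\<close>

lemma form_derivative_sharp:
  assumes "b \<in> ann S" "c \<in> ann S"
  shows "frechet_derivative (\<lambda>u. s u (sharp (p x) b) (sharp (p x) c)) (at x) v =
    - frechet_derivative (\<lambda>u. p u b c) (at x) v"
proof -
  obtain f' where f': "((\<lambda>u. sharp (p u) b) has_derivative f') (at x)"
    "\<And>v \<beta>. blinfun_apply \<beta> (f' v) = frechet_derivative (\<lambda>u. p u b \<beta>) (at x) v" using sharp_der by blast
  let ?w = "sharp (p x) c"
  have lin: "linear (\<lambda>v. s u v ?w)" if "u \<in> V" for u by (rule alternating_bilinear_linear(2)[OF alts[OF that]])
  have "((\<lambda>u. s u (sharp (p u) b) ?w) has_derivative (\<lambda>v.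
      frechet_derivative (\<lambda>u. s u (sharp (p x) b) ?w) (at x) v + s x (f' v) ?w)) (at x)"
    by (rule has_derivative_linear_family[where L = "\<lambda>u v. s u v ?w", OF V lin ds f'(1)])
  moreover have "((\<lambda>u. s u (sharp (p u) b) ?w) has_derivative (\<lambda>v. 0)) (at x)"
    by (rule has_derivative_transform_within_open[OF has_derivative_const V]) (rule coupledD(11)[OF c assms(1), symmetric])
  ultimately have "frechet_derivative (\<lambda>u. s u (sharp (p x) b) ?w) (at x) v + s x (f' v) ?w = 0"
    by (rule has_derivative_unique[THEN fun_cong])
  moreover have "s x (f' v) ?w = frechet_derivative (\<lambda>u. p u b c) (at x) v"
    using coupledD(11)[OF cx assms(2), of "f' v"] alternating_bilinear_antisym[OF alts[OF V(2)], of "f' v" ?w]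
    by (simp add: f'(2))
  ultimately show ?thesis by linarith
qed

lemma jacobiator_ann_F:
  assumes "a \<in> ann S" "b \<in> ann S" "c \<in> ann S"
  shows "jacobiator p x a b c =
    - (frechet_derivative (\<lambda>u. s u (sharp (p x) b) (sharp (p x) c)) (at x) (sharp (p x) a)
     - frechet_derivative (\<lambda>u. s u (sharp (p x) a) (sharp (p x) c)) (at x) (sharp (p x) b)
     + frechet_derivative (\<lambda>u. s u (sharp (p x) a) (sharp (p x) b)) (at x) (sharp (p x) c))"
  using antisym_dp[of c a "sharp (p x) b"]
  by (simp add: form_derivative_sharp assms jacobiator_def)

lemma sharp_ann_H:
  assumes "\<gamma> \<in> ann (range (\<pi> x))"
  shows "sharp (p2 x) \<gamma> = sharp (p x) \<gamma>"
proof (rule sharp_eqI[OF altp2[OF V(2)]])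
  fix \<beta>
  have \<gamma>: "\<gamma> o\<^sub>L Blinfun (\<pi> x) = 0"
    by (rule blinfun_eqI) (use assms in \<open>simp add: ann_def coupled_compose[OF cx] del: blinfun_apply_blinfun_compose\<close>)
  have "p x \<gamma> \<beta> = p2 x \<gamma> \<beta>"
    using coupled_decompose[OF cx, of \<gamma> \<beta>]
    by (simp add: \<gamma> linear_0[OF alternating_bilinear_linear(2)[OF altp[OF V(2)]]])
  then show "blinfun_apply \<beta> (sharp (p x) \<gamma>) = p2 x \<gamma> \<beta>"
    by (simp only: apply_sharp[OF altp[OF V(2)]])
qed

lemma sharp2_mem: "sharp (p2 x) \<alpha> \<in> S"
proof (rule ann_ann_subspace[OF coupledD(1)[OF cx]])
  fix a assume "a \<in> ann S"
  then show "blinfun_apply a (sharp (p2 x) \<alpha>) = 0"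
    using coupled_p2_ann[OF cx, of a \<alpha>] alternating_bilinear_antisym[OF altp2[OF V(2)], of a \<alpha>]
    by (simp add: apply_sharp[OF altp2[OF V(2)]])
qed

text \<open>The difference of the two derivatives is that of \<open>p(\<beta> \<circ> \<pi>, \<gamma> \<circ> \<pi>)\<close>, which vanishes to second order.\<close>

lemma derivative_ann_H:
  assumes \<beta>: "\<beta> \<in> ann (range (\<pi> x))" and \<gamma>: "\<gamma> \<in> ann (range (\<pi> x))"
  shows "frechet_derivative (\<lambda>u. p u \<beta> \<gamma>) (at x) v = frechet_derivative (\<lambda>u. p2 u \<beta> \<gamma>) (at x) v"
proof -
  define h where "h b c u = blinfun_apply \<beta> (\<pi> u b) * (blinfun_apply \<gamma> (\<pi> u c) * p u (blinfun_inner_left b) (blinfun_inner_left c))"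
    for b c u
  have D: "((\<lambda>u. blinfun_apply \<alpha> (\<pi> u b)) has_derivative (\<lambda>v. blinfun_apply \<alpha> (frechet_derivative (\<lambda>u. \<pi> u b) (at x) v))) (at x)"
    for \<alpha> :: "'e dual" and b
    by (rule bounded_linear.has_derivative[OF blinfun.bounded_linear_right frechet_derivative_works[THEN iffD1, OF dpi]])
  have zero: "blinfun_apply \<beta> (\<pi> x b) = 0" "blinfun_apply \<gamma> (\<pi> x b) = 0" for b
    using \<beta> \<gamma> by (auto simp: ann_def)
  have h: "(h b c has_derivative (\<lambda>v. 0)) (at x)" for b c
    using has_derivative_mult[OF D[of \<beta> b] has_derivative_mult[OF D[of \<gamma> c]
        frechet_derivative_works[THEN iffD1, OF dp[of "blinfun_inner_left b" "blinfun_inner_left c"]]]]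
    unfolding h_def by (simp only: zero mult_zero_left mult_zero_right add_0_left)
  have "((\<lambda>u. \<Sum>b\<in>Basis. \<Sum>c\<in>Basis. h b c u) has_derivative
      (\<lambda>v. \<Sum>b\<in>(Basis::'e set). \<Sum>c\<in>(Basis::'e set). 0)) (at x)"
    by (rule has_derivative_sum, rule has_derivative_sum, rule h)
  from has_derivative_add[OF this frechet_derivative_works[THEN iffD1, OF dp2[of \<beta> \<gamma>]]]
  have H: "((\<lambda>u. (\<Sum>b\<in>Basis. \<Sum>c\<in>Basis. h b c u) + p2 u \<beta> \<gamma>) has_derivative
      frechet_derivative (\<lambda>u. p2 u \<beta> \<gamma>) (at x)) (at x)"
    by (simp only: sum.neutral_const add_0_left)
  have eq: "(\<Sum>b\<in>Basis. \<Sum>c\<in>Basis. h b c u) + p2 u \<beta> \<gamma> = p u \<beta> \<gamma>" if u: "u \<in> V" for u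
  proof -
    from coupled_dual_expand[OF c[OF u], of \<beta> \<gamma>]
    show ?thesis using coupled_decompose[OF c[OF u], of \<beta> \<gamma>] by (simp add: h_def)
  qed
  show ?thesis by (rule bivec_derivative_eqI[OF V altp dp H eq])
qed

lemma leaf_derivative_zero:
  assumes "a \<in> ann S"
  shows "frechet_derivative (\<lambda>u. p2 u a \<beta>) (at x) v = 0" "frechet_derivative (\<lambda>u. p2 u \<beta> a) (at x) v = 0"
proof -
  show *: "frechet_derivative (\<lambda>u. p2 u a \<beta>) (at x) v = 0" for \<beta>
    by (rule bivec_derivative_eqI[OF V altp2 dp2 has_derivative_const[of 0]])
      (simp_all add: coupled_p2_ann[OF c assms])
  then show "frechet_derivative (\<lambda>u. p2 u \<beta> a) (at x) v = 0"
    using bivec_derivative_antisym[OF V altp2 dp2, of \<beta> a v] by simp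
qed

text \<open>Since \<open>S\<close> is the same at all points of the chart, \<open>p2\<close> with
  argument \<open>a\<close> vanishes identically near \<open>x\<close>, not just at
  \<open>x\<close>. Hence the derivatives vanish as well as \<open>sharp\<close>.\<close>

lemma jacobiator_leaf_zero:
  assumes "a \<in> ann S"
  shows "jacobiator p2 x a \<beta> \<gamma> = 0"
proof -
  have "sharp (p2 x) a = 0"
    by (rule sharp_eqI[OF altp2[OF V(2)]]) (simp add: coupled_p2_ann[OF cx assms])
  then show ?thesis
    by (simp add: jacobiator_def leaf_derivative_zero[OF assms] linear_0[OF linear_frechet_derivative[OF dp2]])
qed

lemma jacobiator_ann_H:
  assumes "\<alpha> \<in> ann (range (\<pi> x))" "\<beta> \<in> ann (range (\<pi> x))" "\<gamma> \<in> ann (range (\<pi> x))"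
  shows "jacobiator p x \<alpha> \<beta> \<gamma> = jacobiator p2 x \<alpha> \<beta> \<gamma>"
  by (simp add: jacobiator_def sharp_ann_H assms derivative_ann_H)

lemma ann_decompose: "\<exists>a\<in>ann S. \<exists>b\<in>ann (range (\<pi> x)). \<alpha> = a + b"
proof (intro bexI)
  show "\<alpha> = (\<alpha> o\<^sub>L Blinfun (\<pi> x)) + (\<alpha> - (\<alpha> o\<^sub>L Blinfun (\<pi> x)))" by simp
  show "\<alpha> - (\<alpha> o\<^sub>L Blinfun (\<pi> x)) \<in> ann (range (\<pi> x))"
    by (simp add: ann_def blinfun.diff_left coupled_compose[OF cx] coupled_pi_idem[OF cx] del: blinfun_apply_blinfun_compose)
qed (rule coupled_compose_ann[OF cx])

lemma jacobiator_leaf_iff: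
  "(\<forall>\<alpha> \<beta> \<gamma>. jacobiator p2 x \<alpha> \<beta> \<gamma> = 0) \<longleftrightarrow>
   (\<forall>\<alpha>\<in>ann (range (\<pi> x)). \<forall>\<beta>\<in>ann (range (\<pi> x)). \<forall>\<gamma>\<in>ann (range (\<pi> x)). jacobiator p x \<alpha> \<beta> \<gamma> = 0)"
proof
  assume *: "\<forall>\<alpha>\<in>ann (range (\<pi> x)). \<forall>\<beta>\<in>ann (range (\<pi> x)). \<forall>\<gamma>\<in>ann (range (\<pi> x)). jacobiator p x \<alpha> \<beta> \<gamma> = 0"
  have "jacobiator p2 x \<alpha> \<beta> \<gamma> = 0" for \<alpha> \<beta> \<gamma>
    by (rule cyclic_trilinear_zero[where J = "jacobiator p2 x", OF jacobiator_cyclic[OF V altp2 dp2]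
          jacobiator_add[OF V altp2 dp2] ann_decompose jacobiator_leaf_zero jacobiator_leaf_zero jacobiator_leaf_zero])
      (use * jacobiator_ann_H in auto)
  then show "\<forall>\<alpha> \<beta> \<gamma>. jacobiator p2 x \<alpha> \<beta> \<gamma> = 0" by blast
qed (simp add: jacobiator_ann_H)

text \<open>A vector of \<open>S\<close> on which all of ann H vanishes lies in \<open>H\<close> as
  well, so it is 0.\<close>

lemma leaf_separates:
  assumes "v \<in> S" "w \<in> S" "\<And>\<gamma>. \<gamma> \<in> ann (range (\<pi> x)) \<Longrightarrow> blinfun_apply \<gamma> v = blinfun_apply \<gamma> w"
  shows "v = w"
proof -
  have "v - w \<in> range (\<pi> x)"
    by (rule ann_ann_subspace[OF linear_subspace_image[OF coupledD(2)[OF cx] subspace_UNIV]])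
      (simp add: blinfun.diff_right assms(3))
  then have "\<pi> x (v - w) = v - w" using coupled_pi_idem[OF cx] by fastforce
  moreover have "\<pi> x (v - w) = 0"
    by (rule coupledD(3)[OF cx]) (rule subspace_diff[OF coupledD(1)[OF cx] assms(1,2)])
  ultimately show ?thesis by simp
qed

text \<open>Both sides of the curvature equation lie in \<open>S\<close>, so it suffices to pair
  them with covectors \<open>\<gamma>\<close> in ann H. The three terms of the Jacobi expression
  then split into one for the left side and two for the bracket.\<close>

lemma curvature_eq_iff:
  assumes X: "projectable_germ V S \<pi> x X X'" and Y: "projectable_germ V S \<pi> x Y Y'"
    and a: "a \<in> ann S" "X x = sharp (p x) a" and b: "b \<in> ann S" "Y x = sharp (p x) b"
  shows "sharp (p2 x) (Blinfun (frechet_derivative (\<lambda>u. s u (X u) (Y u)) (at x))) =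
      - proj_along S (range (\<pi> x)) (Y' (X x) - X' (Y x)) \<longleftrightarrow>
    (\<forall>\<gamma>\<in>ann (range (\<pi> x)). jacobiator p x a b \<gamma> = 0)"
proof -
  let ?f = "\<lambda>u. s u (X u) (Y u)"
  let ?l = "sharp (p2 x) (Blinfun (frechet_derivative ?f (at x)))"
  let ?w = "Y' (X x) - X' (Y x)"
  let ?r = "proj_along S (range (\<pi> x)) ?w"
  have bil: "bilinear (s u)" if "u \<in> V" for u using alts[OF that] by (simp add: alternating_bilinear_def)
  note H = linear_subspace_image[OF coupledD(2)[OF cx] subspace_UNIV]
  note PR = proj_along[OF coupledD(1)[OF cx] H complementary_sym[OF coupled_pi_eq(2)[OF cx]], of ?w]
  obtain WX where WX: "(X has_derivative X') (at x)" "open WX" "x \<in> WX" "WX \<subseteq> V" "\<And>u. u \<in> WX \<Longrightarrow> \<pi> u (X u) = X u" "\<And>v. v \<in> S \<Longrightarrow> X' v \<in> S"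
    using X unfolding projectable_germ_def by blast
  obtain WY where WY: "(Y has_derivative Y') (at x)" "open WY" "x \<in> WY" "WY \<subseteq> V" "\<And>u. u \<in> WY \<Longrightarrow> \<pi> u (Y u) = Y u" "\<And>v. v \<in> S \<Longrightarrow> Y' v \<in> S"
    using Y unfolding projectable_germ_def by blast
  obtain fa where fa: "((\<lambda>u. sharp (p u) a) has_derivative fa) (at x)"
    "\<And>v \<beta>. blinfun_apply \<beta> (fa v) = frechet_derivative (\<lambda>u. p u a \<beta>) (at x) v" using sharp_der by blast
  obtain fb where fb: "((\<lambda>u. sharp (p u) b) has_derivative fb) (at x)"
    "\<And>v \<beta>. blinfun_apply \<beta> (fb v) = frechet_derivative (\<lambda>u. p u b \<beta>) (at x) v" using sharp_der by blast
  have D: "(?f has_derivative (\<lambda>v. frechet_derivative (\<lambda>u. s u (X x) (Y x)) (at x) v + s x (X' v) (Y x) + s x (X x) (Y' v))) (at x)"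
    by (rule has_derivative_bilinear_family[OF V bil ds WX(1) WY(1)])
  \<comment> \<open>Projectability enters here: along \<open>S\<close> the fields change only by
    vectors of \<open>S\<close>, which \<open>s\<close> kills, so only the derivative of
    \<open>s\<close> itself remains. The sign produced here cancels against the one from
    antisymmetry of \<open>p2\<close> in the next fact.\<close>
  have df: "frechet_derivative ?f (at x) t = - frechet_derivative (\<lambda>u. p u a b) (at x) t" if t: "t \<in> S" for t
    unfolding frechet_derivative_at[OF D, symmetric]
    using coupledD(8)[OF cx WX(6)[OF t], of "Y x"] coupled_form_F[OF cx WY(6)[OF t], of "X x"]
    by (simp add: a(2) b(2) form_derivative_sharp[OF a(1) b(1)])
  have l: "blinfun_apply \<gamma> ?l = frechet_derivative (\<lambda>u. p u a b) (at x) (sharp (p x) \<gamma>)"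
    if \<gamma>: "\<gamma> \<in> ann (range (\<pi> x))" for \<gamma>
  proof -
    have "blinfun_apply \<gamma> ?l = - blinfun_apply (Blinfun (frechet_derivative ?f (at x))) (sharp (p2 x) \<gamma>)"
      unfolding apply_sharp[OF altp2[OF V(2)]] by (rule alternating_bilinear_antisym[OF altp2[OF V(2)]])
    also have "\<dots> = - frechet_derivative ?f (at x) (sharp (p2 x) \<gamma>)"
      by (simp add: blinfun_apply_Blinfun[OF linear_frechet_derivative[OF differentiableI[OF D]]])
    finally show ?thesis using df[OF sharp2_mem, of \<gamma>] by (simp add: sharp_ann_H[OF \<gamma>])
  qed
  have r: "blinfun_apply \<gamma> ?r = frechet_derivative (\<lambda>u. p u b \<gamma>) (at x) (sharp (p x) a)
      - frechet_derivative (\<lambda>u. p u a \<gamma>) (at x) (sharp (p x) b)" if \<gamma>: "\<gamma> \<in> ann (range (\<pi> x))" for \<gamma>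
  proof -
    have "blinfun_apply \<gamma> (?w - ?r) = 0" using \<gamma> PR(2) by (simp only: ann_def mem_Collect_eq)
    then have "blinfun_apply \<gamma> ?r = blinfun_apply \<gamma> (Y' (X x)) - blinfun_apply \<gamma> (X' (Y x))"
      by (simp add: blinfun.diff_right)
    \<comment> \<open>\<open>Y\<close> and the field \<open>sharp (p u) b\<close> are sections of
      \<open>H\<close> with the same value at \<open>x\<close>, so \<open>\<gamma>\<close> does not
      distinguish their derivatives.\<close>
    also have "blinfun_apply \<gamma> (Y' (X x)) = blinfun_apply \<gamma> (fb (X x))"
      using section_derivative[OF WY(1-5) \<gamma>, of "X x"]
        section_derivative[OF fb(1) V subset_refl sharp_pi_eq[OF b(1)] \<gamma>, of "X x"] by (simp only: b(2))
    also have "blinfun_apply \<gamma> (X' (Y x)) = blinfun_apply \<gamma> (fa (Y x))"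
      using section_derivative[OF WX(1-5) \<gamma>, of "Y x"]
        section_derivative[OF fa(1) V subset_refl sharp_pi_eq[OF a(1)] \<gamma>, of "Y x"] by (simp only: a(2))
    finally show ?thesis by (simp only: fa(2) fb(2) a(2) b(2))
  qed
  have J: "jacobiator p x a b \<gamma> = blinfun_apply \<gamma> ?l + blinfun_apply \<gamma> ?r" if \<gamma>: "\<gamma> \<in> ann (range (\<pi> x))" for \<gamma>
    using antisym_dp[of \<gamma> a "sharp (p x) b"] by (simp add: jacobiator_def l[OF \<gamma>] r[OF \<gamma>])
  have "?l = - ?r \<longleftrightarrow> (\<forall>\<gamma>\<in>ann (range (\<pi> x)). blinfun_apply \<gamma> ?l = blinfun_apply \<gamma> (- ?r))"
  proof
    assume "\<forall>\<gamma>\<in>ann (range (\<pi> x)). blinfun_apply \<gamma> ?l = blinfun_apply \<gamma> (- ?r)"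
    then show "?l = - ?r"
      by (intro leaf_separates sharp2_mem subspace_neg[OF coupledD(1)[OF cx]] PR(1)) (rule bspec)
  qed simp
  also have "\<dots> \<longleftrightarrow> (\<forall>\<gamma>\<in>ann (range (\<pi> x)). jacobiator p x a b \<gamma> = 0)"
    by (intro ball_cong refl) (simp add: J blinfun.minus_right eq_neg_iff_add_eq_0)
  finally show ?thesis .
qed

text \<open>The Lie derivative is an antisymmetric form on covectors that vanishes as soon as one
  argument is in ann F, so only arguments in ann H matter; there it equals the Jacobi expression
  with \<open>a\<close> in the first place.\<close>

lemma lie_leaf_iff:
  assumes X: "projectable_germ V S \<pi> x X X'" and a: "a \<in> ann S" "X x = sharp (p x) a"
  shows "(\<forall>\<alpha> \<beta>. frechet_derivative (\<lambda>u. p2 u \<alpha> \<beta>) (at x) (X x)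
      - p2 x (\<alpha> o\<^sub>L Blinfun X') \<beta> - p2 x \<alpha> (\<beta> o\<^sub>L Blinfun X') = 0) \<longleftrightarrow>
    (\<forall>\<beta>\<in>ann (range (\<pi> x)). \<forall>\<gamma>\<in>ann (range (\<pi> x)). jacobiator p x a \<beta> \<gamma> = 0)"
proof -
  obtain W where W: "(X has_derivative X') (at x)" "open W" "x \<in> W" "W \<subseteq> V" "\<And>u. u \<in> W \<Longrightarrow> \<pi> u (X u) = X u" "\<And>v. v \<in> S \<Longrightarrow> X' v \<in> S"
    using X unfolding projectable_germ_def by blast
  obtain fa where fa: "((\<lambda>u. sharp (p u) a) has_derivative fa) (at x)"
    "\<And>v \<beta>. blinfun_apply \<beta> (fa v) = frechet_derivative (\<lambda>u. p u a \<beta>) (at x) v" using sharp_der by blast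
  have X'app: "blinfun_apply (\<alpha> o\<^sub>L Blinfun X') v = blinfun_apply \<alpha> (X' v)" for \<alpha> :: "'e dual" and v
    by (simp add: bounded_linear_Blinfun_apply[OF has_derivative_bounded_linear[OF W(1)]])
  define lie where "lie \<alpha> \<beta> = frechet_derivative (\<lambda>u. p2 u \<alpha> \<beta>) (at x) (X x)
      - p2 x (\<alpha> o\<^sub>L Blinfun X') \<beta> - p2 x \<alpha> (\<beta> o\<^sub>L Blinfun X')" for \<alpha> \<beta>
  have lie: "lie \<alpha> \<beta> = frechet_derivative (\<lambda>u. p2 u \<alpha> \<beta>) (at x) (X x)
      + blinfun_apply \<alpha> (X' (sharp (p2 x) \<beta>)) - blinfun_apply \<beta> (X' (sharp (p2 x) \<alpha>))" for \<alpha> \<beta>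
    using alternating_bilinear_antisym[OF altp2[OF V(2)], of "\<alpha> o\<^sub>L Blinfun X'" \<beta>]
      apply_sharp[OF altp2[OF V(2)], of "\<alpha> o\<^sub>L Blinfun X'" \<beta>] apply_sharp[OF altp2[OF V(2)], of "\<beta> o\<^sub>L Blinfun X'" \<alpha>]
    by (simp add: lie_def X'app del: blinfun_apply_blinfun_compose)
  have antisym: "lie \<alpha> \<beta> = - lie \<beta> \<alpha>" for \<alpha> \<beta>
    using bivec_derivative_antisym[OF V altp2 dp2, of \<alpha> \<beta> "X x"] by (simp add: lie)
  have add: "lie (\<alpha> + \<alpha>') \<beta> = lie \<alpha> \<beta> + lie \<alpha>' \<beta>" for \<alpha> \<alpha>' \<beta>
    by (simp add: lie bivec_derivative_add[OF V altp2 dp2] linear_add[OF linear_sharp[OF altp2[OF V(2)]]]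
        blinfun.add_left blinfun.add_right linear_add[OF bounded_linear.linear[OF has_derivative_bounded_linear[OF W(1)]]])
  \<comment> \<open>This says that \<open>L\<^sub>X P''\<close> is again leaf-tangent. It needs
    \<open>X' S \<subseteq> S\<close>, since \<open>sharp (p2 x) \<beta>\<close> is in
    \<open>S\<close> and \<open>b\<close> must vanish on its image.\<close>
  have zero: "lie b \<beta> = 0" if b: "b \<in> ann S" for b \<beta>
  proof -
    have "sharp (p2 x) b = 0"
      by (rule sharp_eqI[OF altp2[OF V(2)]]) (simp add: coupled_p2_ann[OF cx b])
    moreover have "blinfun_apply b (X' (sharp (p2 x) \<beta>)) = 0"
      using b W(6)[OF sharp2_mem] by (simp add: ann_def)
    ultimately show ?thesis
      using linear_0[OF bounded_linear.linear[OF has_derivative_bounded_linear[OF W(1)]]]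
      by (simp add: lie leaf_derivative_zero[OF b])
  qed
  have J: "jacobiator p x a \<beta> \<gamma> = lie \<beta> \<gamma>" if \<beta>: "\<beta> \<in> ann (range (\<pi> x))" and \<gamma>: "\<gamma> \<in> ann (range (\<pi> x))" for \<beta> \<gamma>
  proof -
    have sec: "blinfun_apply \<alpha> (X' v) = frechet_derivative (\<lambda>u. p u a \<alpha>) (at x) v" if \<alpha>: "\<alpha> \<in> ann (range (\<pi> x))" for \<alpha> v
      using section_derivative[OF W(1-5) \<alpha>, of v]
        section_derivative[OF fa(1) V subset_refl sharp_pi_eq[OF a(1)] \<alpha>, of v] by (simp only: a(2) fa(2))
    show ?thesis
      using antisym_dp[of \<gamma> a "sharp (p x) \<beta>"]
      by (simp add: jacobiator_def lie sec[OF \<beta>] sec[OF \<gamma>] sharp_ann_H[OF \<beta>] sharp_ann_H[OF \<gamma>] a(2)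
          derivative_ann_H[OF \<beta> \<gamma>])
  qed
  have "(\<forall>\<alpha> \<beta>. lie \<alpha> \<beta> = 0) \<longleftrightarrow> (\<forall>\<beta>\<in>ann (range (\<pi> x)). \<forall>\<gamma>\<in>ann (range (\<pi> x)). lie \<beta> \<gamma> = 0)"
  proof (intro iffI allI)
    fix \<alpha> \<beta> assume *: "\<forall>\<beta>\<in>ann (range (\<pi> x)). \<forall>\<gamma>\<in>ann (range (\<pi> x)). lie \<beta> \<gamma> = 0"
    obtain a1 a2 where 1: "a1 \<in> ann S" "a2 \<in> ann (range (\<pi> x))" "\<alpha> = a1 + a2" using ann_decompose by metis
    obtain b1 b2 where 2: "b1 \<in> ann S" "b2 \<in> ann (range (\<pi> x))" "\<beta> = b1 + b2" using ann_decompose by metis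
    have "lie \<alpha> \<beta> = lie a2 \<beta>" by (simp add: 1(3) add zero[OF 1(1)])
    also have "\<dots> = - lie (b1 + b2) a2" using antisym[of a2 \<beta>] 2(3) by simp
    also have "\<dots> = - lie b2 a2" by (simp add: add zero[OF 2(1)])
    also have "\<dots> = 0" using * 1(2) 2(2) by simp
    finally show "lie \<alpha> \<beta> = 0" .
  qed simp
  also have "\<dots> \<longleftrightarrow> (\<forall>\<beta>\<in>ann (range (\<pi> x)). \<forall>\<gamma>\<in>ann (range (\<pi> x)). jacobiator p x a \<beta> \<gamma> = 0)"
    by (intro ball_cong refl) (simp add: J)
  finally show ?thesis unfolding lie_def .
qed

lemma jacobiator_zero_iff:
  "(\<forall>\<alpha> \<beta> \<gamma>. jacobiator p x \<alpha> \<beta> \<gamma> = 0) \<longleftrightarrow>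
   (\<forall>a\<in>ann S. \<forall>b\<in>ann S. \<forall>c\<in>ann S. jacobiator p x a b c = 0) \<and>
   (\<forall>a\<in>ann S. \<forall>b\<in>ann S. \<forall>\<gamma>\<in>ann (range (\<pi> x)). jacobiator p x a b \<gamma> = 0) \<and>
   (\<forall>a\<in>ann S. \<forall>\<beta>\<in>ann (range (\<pi> x)). \<forall>\<gamma>\<in>ann (range (\<pi> x)). jacobiator p x a \<beta> \<gamma> = 0) \<and>
   (\<forall>\<alpha> \<beta> \<gamma>. jacobiator p2 x \<alpha> \<beta> \<gamma> = 0)"
  unfolding jacobiator_leaf_iff
proof (intro iffI allI)
  fix \<alpha> \<beta> \<gamma>
  assume *: "(\<forall>a\<in>ann S. \<forall>b\<in>ann S. \<forall>c\<in>ann S. jacobiator p x a b c = 0) \<and>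
   (\<forall>a\<in>ann S. \<forall>b\<in>ann S. \<forall>\<gamma>\<in>ann (range (\<pi> x)). jacobiator p x a b \<gamma> = 0) \<and>
   (\<forall>a\<in>ann S. \<forall>\<beta>\<in>ann (range (\<pi> x)). \<forall>\<gamma>\<in>ann (range (\<pi> x)). jacobiator p x a \<beta> \<gamma> = 0) \<and>
   (\<forall>\<alpha>\<in>ann (range (\<pi> x)). \<forall>\<beta>\<in>ann (range (\<pi> x)). \<forall>\<gamma>\<in>ann (range (\<pi> x)). jacobiator p x \<alpha> \<beta> \<gamma> = 0)"
  show "jacobiator p x \<alpha> \<beta> \<gamma> = 0"
    by (rule cyclic_trilinear_zero[where J = "jacobiator p x", OF jacobiator_cyclic[OF V altp dp]
          jacobiator_add[OF V altp dp] ann_decompose]) (use * in auto)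
qed auto

end

section \<open>Smoothness of the coupling data\<close>

lemma inj_linear_solution:
  fixes L :: "'e::euclidean_space \<Rightarrow> 'e"
  assumes "linear L" "\<And>e. L e = 0 \<Longrightarrow> e = 0"
  shows "inj L" "L (inv L w) = w"
proof -
  show inj: "inj L" using linear_injective_0[OF assms(1)] assms(2) by blast
  show "L (inv L w) = w" using linear_inj_imp_surj[OF assms(1) inj] by (rule surj_f_inv_f)
qed

text \<open>If \<open>L\<close> is invertible and each \<open>L e\<close> comes with its splitting,
  whose \<open>E\<close> part is \<open>R e\<close>, then solving \<open>L e = w\<close> splits
  \<open>w\<close>. This expresses a varying projection through an inverse matrix.\<close>

lemma proj_along_solution:
  fixes L R :: "'e::euclidean_space \<Rightarrow> 'e"
  assumes "subspace D" "subspace E" "complementary D E"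
    "linear L" "\<And>e. L e = 0 \<Longrightarrow> e = 0" "\<And>e. L e - R e \<in> D" "\<And>e. R e \<in> E"
  shows "proj_along D E w = w - R (inv L w)"
  using assms(6)[of "inv L w"] assms(7)[of "inv L w"]
  by (intro proj_along_unique[OF assms(1-3)]) (simp_all add: inj_linear_solution(2)[OF assms(4,5)])

lemma smooth_on_inv:
  fixes L :: "'a::real_normed_vector \<Rightarrow> 'e::euclidean_space \<Rightarrow> 'e"
  assumes U: "open U" and lin: "\<And>u. u \<in> U \<Longrightarrow> linear (L u)" and smooth: "\<And>v. smooth_on U (\<lambda>u. L u v)"
    and zero: "\<And>u e. u \<in> U \<Longrightarrow> L u e = 0 \<Longrightarrow> e = 0" and f: "smooth_on U f"
  shows "smooth_on U (\<lambda>u. inv (L u) (f u))"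
  by (rule smooth_on_linear_solution[OF U lin smooth inj_linear_solution(1)[OF lin zero] f
      inj_linear_solution(2)[OF lin zero]])

lemma orthogonal_complement_subspace:
  fixes S :: "'e::euclidean_space set"
  assumes S: "subspace S"
  defines "C \<equiv> {z. \<forall>w\<in>S. z \<bullet> w = 0}"
  shows "subspace C" "complementary C S"
proof -
  show "subspace C" by (simp add: C_def subspace_def inner_add_left)
  show "complementary C S"
    unfolding complementary_def
  proof
    show "C \<inter> S = {0}" using subspace_0[OF S] by (auto simp: C_def)
    have "\<exists>d\<in>C. \<exists>e\<in>S. v = d + e" for v
    proof -
      obtain y z where yz: "y \<in> span S" "\<And>w. w \<in> span S \<Longrightarrow> orthogonal z w" "v = y + z"
        using orthogonal_subspace_decomp_exists by blast
      have "z \<in> C" using yz(2) by (auto simp: C_def orthogonal_def span_base)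
      moreover have "y \<in> S" using yz(1) S by (metis span_eq_iff)
      ultimately show ?thesis using yz(3) by (metis add.commute)
    qed
    then show "{d + e |d e. d \<in> C \<and> e \<in> S} = UNIV" by blast
  qed
qed

context
  fixes V S :: "'e::euclidean_space set"
    and \<pi> :: "'e \<Rightarrow> 'e \<Rightarrow> 'e" and p p2 :: "'e \<Rightarrow> 'e dual \<Rightarrow> 'e dual \<Rightarrow> real" and s :: "'e \<Rightarrow> 'e \<Rightarrow> 'e \<Rightarrow> real"
  assumes V: "open V" and c: "\<And>u. u \<in> V \<Longrightarrow> coupled S (\<pi> u) (p u) (p2 u) (s u)"
begin

lemma smooth_of_bivector:
  assumes p: "\<And>\<alpha> \<beta>. smooth_on V (\<lambda>u. p u \<alpha> \<beta>)" and S: "subspace S"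
  shows "smooth_on V (\<lambda>u. \<pi> u e)" "smooth_on V (\<lambda>u. s u v w)" "smooth_on V (\<lambda>u. p2 u \<alpha> \<beta>)"
proof -
  define C where "C = {z. \<forall>w\<in>S. z \<bullet> w = 0}"
  note C = orthogonal_complement_subspace[OF S, folded C_def]
  define Q where "Q = proj_along C S"
  have linQ: "linear Q" unfolding Q_def by (rule linear_proj_along[OF C(1) S C(2)])
  have Q: "Q v \<in> C" "v - Q v \<in> S" for v unfolding Q_def by (rule proj_along[OF C(1) S C(2)])+
  have annQ: "blinfun_inner_left (Q e) \<in> ann S" for e
    using Q(1)[of e] by (simp add: C_def ann_def inner_commute)
  \<comment> \<open>\<open>L u\<close> fixes \<open>S\<close> and carries its orthogonal complement,
    read as ann S through the inner product, to the normal space by \<open>sharp\<close>. It thus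
    takes a constant splitting to the varying one, and \<open>\<pi>\<close> and \<open>s\<close> are
    explicit in its inverse.\<close>
  define L where "L u e = sharp (p u) (blinfun_inner_left (Q e)) + (e - Q e)" for u e
  have linL: "linear (L u)" if u: "u \<in> V" for u
  proof -
    have "linear (\<lambda>e. sharp (p u) (blinfun_inner_left (Q e)))"
      using linear_compose[OF linear_compose[OF linQ bounded_linear.linear[OF bounded_linear_blinfun_inner_left]]
        linear_sharp[OF coupledD(5)[OF c[OF u]]]] by (simp add: o_def)
    then show ?thesis unfolding L_def by (intro linear_compose_add linear_compose_sub linear_ident linQ)
  qed
  have \<pi>L: "\<pi> u (L u e) = L u e - (e - Q e)" if u: "u \<in> V" for u e
    by (simp add: L_def linear_add[OF coupledD(2)[OF c[OF u]]] coupledD(3)[OF c[OF u] Q(2)]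
        coupled_pi_sharp[OF c[OF u] annQ])
  have sL: "s u (L u e) w = - (Q e \<bullet> w)" if u: "u \<in> V" for u e w
    using coupledD(11)[OF c[OF u] annQ, of e w] coupledD(8)[OF c[OF u] Q(2), of e w]
    by (simp add: L_def linear_add[OF alternating_bilinear_linear(2)[OF coupledD(7)[OF c[OF u]]]] inner_commute)
  have zero: "e = 0" if u: "u \<in> V" and e: "L u e = 0" for u e
  proof -
    have "Q e \<bullet> w = 0" for w
      using sL[OF u, of e w] linear_0[OF alternating_bilinear_linear(2)[OF coupledD(7)[OF c[OF u]]]] by (simp add: e)
    then have "Q e = 0" using inner_eq_zero_iff by blast
    then show ?thesis using e linear_0[OF linear_sharp[OF coupledD(5)[OF c[OF u]]]]
      by (simp add: L_def linear_0[OF bounded_linear.linear[OF bounded_linear_blinfun_inner_left]])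
  qed
  have "smooth_on V (\<lambda>u. \<Sum>b\<in>Basis. p u \<alpha> (blinfun_inner_left b) *\<^sub>R b)" for \<alpha>
    by (rule smooth_on_sum[OF V finite_Basis], rule smooth_on_bilinear[OF V bounded_bilinear_scaleR], rule p, rule smooth_on_const)
  then have "smooth_on V (\<lambda>u. sharp (p u) \<alpha>)" for \<alpha>
    by (rule smooth_on_transform[OF V]) (rule sharp_eq_sum[OF coupledD(5)[OF c]])
  then have smL: "smooth_on V (\<lambda>u. L u e)" for e
    unfolding L_def by (intro smooth_on_add[OF V] smooth_on_const)
  have G: "smooth_on V (\<lambda>u. inv (L u) w)" for w
    by (rule smooth_on_inv[OF V linL smL zero smooth_on_const])
  have LG: "L u (inv (L u) w) = w" if "u \<in> V" for u w
    by (rule inj_linear_solution(2)[OF linL[OF that] zero[OF that]])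
  have "smooth_on V (\<lambda>u. e - (inv (L u) e - Q (inv (L u) e)))" for e
    using linQ by (intro smooth_on_diff[OF V] smooth_on_const G smooth_on_linear[OF V _ G]) (simp add: linear_conv_bounded_linear)
  moreover have "\<pi> u e = e - (inv (L u) e - Q (inv (L u) e))" if "u \<in> V" for u e
    using \<pi>L[OF that, of "inv (L u) e"] by (simp only: LG[OF that])
  ultimately show pi: "smooth_on V (\<lambda>u. \<pi> u e)" for e
    by (rule smooth_on_transform[OF V])
  have lin: "bounded_linear (\<lambda>g. - (Q g \<bullet> w))"
    using linear_compose_neg[OF linear_compose[OF linQ bounded_linear.linear[OF bounded_linear_inner_left]]]
    by (simp add: linear_conv_bounded_linear o_def)
  have "smooth_on V (\<lambda>u. - (Q (inv (L u) v) \<bullet> w))"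
    by (rule smooth_on_linear[OF V lin G])
  moreover have "s u v w = - (Q (inv (L u) v) \<bullet> w)" if "u \<in> V" for u
    using sL[OF that, of "inv (L u) v" w] by (simp only: LG[OF that])
  ultimately show "smooth_on V (\<lambda>u. s u v w)"
    by (rule smooth_on_transform[OF V])
  have ap: "smooth_on V (\<lambda>u. blinfun_apply \<alpha> (\<pi> u b))" for b and \<alpha> :: "'e dual"
    by (rule smooth_on_linear[OF V blinfun.bounded_linear_right pi])
  \<comment> \<open>The leaf component is \<open>p\<close> minus its (2,0) component, and the latter
    is a polynomial in functions already known to be smooth.\<close>
  have "smooth_on V (\<lambda>u. p u \<alpha> \<beta> - (\<Sum>b\<in>Basis. \<Sum>c\<in>Basis. blinfun_apply \<alpha> (\<pi> u b) *
      (blinfun_apply \<beta> (\<pi> u c) * p u (blinfun_inner_left b) (blinfun_inner_left c))))"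
    by (intro smooth_on_diff[OF V] p smooth_on_sum[OF V finite_Basis] smooth_on_bilinear[OF V bounded_bilinear_mult] ap)
  moreover have "p2 u \<alpha> \<beta> = p u \<alpha> \<beta> - (\<Sum>b\<in>Basis. \<Sum>c\<in>Basis. blinfun_apply \<alpha> (\<pi> u b) *
      (blinfun_apply \<beta> (\<pi> u c) * p u (blinfun_inner_left b) (blinfun_inner_left c)))" if "u \<in> V" for u
    using coupled_decompose[OF c[OF that], of \<alpha> \<beta>] coupled_dual_expand[OF c[OF that], of \<alpha> \<beta>] by linarith
  ultimately show "smooth_on V (\<lambda>u. p2 u \<alpha> \<beta>)"
    by (rule smooth_on_transform[OF V])
qed

lemma smooth_of_form:
  assumes p2: "\<And>\<alpha> \<beta>. smooth_on V (\<lambda>u. p2 u \<alpha> \<beta>)" and s: "\<And>v w. smooth_on V (\<lambda>u. s u v w)"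
    and pi: "\<And>e. smooth_on V (\<lambda>u. \<pi> u e)"
  shows "smooth_on V (\<lambda>u. p u \<alpha> \<beta>)"
proof -
  \<comment> \<open>The endomorphism of \<open>flat_bij\<close>, now depending on the point. It
    extends the map \<open>flat\<close> on \<open>H\<close> to an invertible map of the whole space
    with smooth coefficients.\<close>
  define L where "L u v = (\<Sum>b\<in>Basis. (s u v b + (v - \<pi> u v) \<bullet> (b - \<pi> u b)) *\<^sub>R b)" for u v
  have lin: "linear (s u v)" "linear (\<lambda>v. s u v w)" if "u \<in> V" for u v w
    by (rule alternating_bilinear_linear[OF coupledD(7)[OF c[OF that]]])+
  have linpi: "linear (\<pi> u)" if "u \<in> V" for u by (rule coupledD(2)[OF c[OF that]])
  have L: "L u v \<bullet> w = s u v w + (v - \<pi> u v) \<bullet> (w - \<pi> u w)" if u: "u \<in> V" for u v w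
  proof -
    have "linear (\<lambda>w. w - \<pi> u w)" by (intro linear_compose_sub linear_ident linpi[OF u])
    from linear_compose[OF this bounded_linear.linear[OF bounded_linear_inner_right]]
    have "linear (\<lambda>w. s u v w + (v - \<pi> u v) \<bullet> (w - \<pi> u w))"
      unfolding o_def by (intro linear_compose_add lin[OF u])
    from linear_eq_sum_Basis[OF this, of w] show ?thesis
      by (simp only: L_def inner_sum_left inner_scaleR_left real_scaleR_def inner_commute[of w] mult.commute)
  qed
  have linL: "linear (L u)" if u: "u \<in> V" for u
  proof (rule linearI)
    show "L u (v + w) = L u v + L u w" for v w
      by (simp add: L_def linear_add[OF lin(2)[OF u]] linear_add[OF linpi[OF u]] inner_add_left inner_diff_left
          algebra_simps sum.distrib[symmetric])
    show "L u (r *\<^sub>R v) = r *\<^sub>R L u v" for r v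
      by (simp add: L_def linear_cmul[OF lin(2)[OF u]] linear_cmul[OF linpi[OF u]] scaleR_sum_right
          inner_diff_left algebra_simps)
  qed
  have zero: "v = 0" if u: "u \<in> V" and v: "L u v = 0" for u v
  proof -
    have "0 = L u v \<bullet> (v - \<pi> u v)" by (simp add: v)
    also have "\<dots> = (v - \<pi> u v) \<bullet> (v - \<pi> u v)"
      unfolding L[OF u] using coupled_form_F[OF c[OF u] coupledD(4)[OF c[OF u]]] coupledD(3)[OF c[OF u] coupledD(4)[OF c[OF u]]]
      by simp
    finally have *: "v - \<pi> u v = 0" by simp
    then have "s u v w = 0" for w using L[OF u, of v w] by (simp add: v)
    moreover have "v \<in> range (\<pi> u)" using * by (simp add: image_iff) (metis)
    ultimately show ?thesis using coupled_nondegenerate[OF c[OF u]] unfolding nondegenerate_on_def by blast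
  qed
  have smL: "smooth_on V (\<lambda>u. L u v)" for v
    unfolding L_def
    by (intro smooth_on_sum[OF V finite_Basis] smooth_on_bilinear[OF V bounded_bilinear_scaleR] smooth_on_add[OF V] s
        smooth_on_bilinear[OF V bounded_bilinear_inner] smooth_on_diff[OF V] pi smooth_on_const)
  \<comment> \<open>\<open>f \<alpha> u\<close> represents the covector
    \<open>- \<alpha> \<circ> \<pi>\<close> in the inner product. It is the right-hand side of the
    equation that \<open>s (sharp a) = - a\<close> imposes on \<open>sharp a\<close> for
    \<open>a = \<alpha> \<circ> \<pi>\<close>.\<close>
  define f where "f \<alpha> u = (\<Sum>b\<in>Basis. (- blinfun_apply \<alpha> (\<pi> u b)) *\<^sub>R b)" for \<alpha> u
  have bl: "bounded_linear (\<lambda>v. - blinfun_apply \<alpha> v)" for \<alpha> :: "'e dual"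
    by (intro bounded_linear_minus blinfun.bounded_linear_right)
  have smf: "smooth_on V (f \<alpha>)" for \<alpha>
    unfolding f_def
    by (intro smooth_on_sum[OF V finite_Basis] smooth_on_bilinear[OF V bounded_bilinear_scaleR]
        smooth_on_linear[OF V bl pi] smooth_on_const)
  have sharp: "inv (L u) (f \<alpha> u) = sharp (p u) (\<alpha> o\<^sub>L Blinfun (\<pi> u))" if u: "u \<in> V" for u \<alpha>
  proof -
    let ?a = "\<alpha> o\<^sub>L Blinfun (\<pi> u)"
    have "L u (sharp (p u) ?a) = f \<alpha> u"
    proof (rule euclidean_eqI)
      fix b :: 'e assume b: "b \<in> Basis"
      have "L u (sharp (p u) ?a) \<bullet> b = - blinfun_apply \<alpha> (\<pi> u b)"
        unfolding L[OF u] coupled_pi_sharp[OF c[OF u] coupled_compose_ann[OF c[OF u]]]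
          coupledD(11)[OF c[OF u] coupled_compose_ann[OF c[OF u]]] coupled_compose[OF c[OF u]] by simp
      also have "\<dots> = f \<alpha> u \<bullet> b"
        using b by (simp add: f_def inner_sum_left inner_Basis if_distrib cong: if_cong)
      finally show "L u (sharp (p u) ?a) \<bullet> b = f \<alpha> u \<bullet> b" .
    qed
    then show ?thesis using inv_f_f[OF inj_linear_solution(1)[OF linL[OF u] zero[OF u]]] by metis
  qed
  have "smooth_on V (\<lambda>u. blinfun_apply \<beta> (inv (L u) (f \<alpha> u)) + p2 u \<alpha> \<beta>)"
    by (intro smooth_on_add[OF V] smooth_on_linear[OF V blinfun.bounded_linear_right] smooth_on_inv[OF V linL smL zero smf] p2)
  moreover have "p u \<alpha> \<beta> = blinfun_apply \<beta> (inv (L u) (f \<alpha> u)) + p2 u \<alpha> \<beta>" if u: "u \<in> V" for u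
    unfolding sharp[OF u] apply_sharp[OF coupledD(5)[OF c[OF u]]]
    using coupled_decompose[OF c[OF u], of \<alpha> \<beta>] coupledD(9)[OF c[OF u] coupled_compose_ann[OF c[OF u]], of \<alpha> \<beta>]
    by simp
  ultimately show ?thesis
    by (rule smooth_on_transform[OF V])
qed

end

text \<open>A reference point of \<open>W\<close> is chosen, and the splitting there is carried to
  every other point by matching the frames. The case of empty \<open>W\<close> is separate because
  there is no reference point.\<close>

lemma smooth_projection:
  fixes X :: "nat \<Rightarrow> 'e::euclidean_space \<Rightarrow> 'e"
  assumes W: "open W" and S: "subspace S" and X: "\<And>i. i < k \<Longrightarrow> smooth_on W (X i)"
    and frame: "\<And>u. u \<in> W \<Longrightarrow> inj_on (\<lambda>i. X i u) {..<k}" "\<And>u. u \<in> W \<Longrightarrow> independent ((\<lambda>i. X i u) ` {..<k})"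
      "\<And>u. u \<in> W \<Longrightarrow> span ((\<lambda>i. X i u) ` {..<k}) = H u"
    and comp: "\<And>u. u \<in> W \<Longrightarrow> complementary (H u) S"
  shows "smooth_on W (\<lambda>u. proj_along (H u) S e)"
proof (cases "W = {}")
  case True
  show ?thesis unfolding True by (rule smooth_on_local) simp
next
  case False
  then obtain x where x: "x \<in> W" by blast
  have subH: "subspace (H u)" if "u \<in> W" for u using frame(3)[OF that] subspace_span by metis
  define \<pi> where "\<pi> = proj_along (H x) S"
  have lin\<pi>: "linear \<pi>" unfolding \<pi>_def by (rule linear_proj_along[OF subH[OF x] S comp[OF x]])
  have \<pi>: "\<pi> v \<in> span ((\<lambda>i. X i x) ` {..<k})" "v - \<pi> v \<in> S" for v
    unfolding \<pi>_def frame(3)[OF x] by (rule proj_along[OF subH[OF x] S comp[OF x]])+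
  define r where "r i e = representation ((\<lambda>i. X i x) ` {..<k}) (\<pi> e) (X i x)" for i e
  have linr: "r i (v + w) = r i v + r i w" "r i (t *\<^sub>R v) = t * r i v" for i v w t
    by (simp_all add: r_def linear_add[OF lin\<pi>] linear_cmul[OF lin\<pi>] representation_add[OF frame(2)[OF x]]
        representation_scale[OF frame(2)[OF x]] \<pi>(1))
  have exp: "(\<Sum>i<k. r i e *\<^sub>R X i x) = \<pi> e" for e
  proof -
    have "(\<Sum>b\<in>(\<lambda>i. X i x) ` {..<k}. representation ((\<lambda>i. X i x) ` {..<k}) (\<pi> e) b *\<^sub>R b) = \<pi> e"
      by (rule sum_representation_eq[OF frame(2)[OF x] \<pi>(1)]) simp_all
    then show ?thesis by (simp add: sum.reindex[OF frame(1)[OF x]] r_def)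
  qed
  \<comment> \<open>\<open>r i\<close> are the frame coordinates at \<open>x\<close>.
    \<open>L u\<close> sends each frame vector at \<open>x\<close> to the one at \<open>u\<close>
    and fixes \<open>S\<close>; it is invertible on all of \<open>W\<close>, so no shrinking is
    required.\<close>
  define L where "L u e = (\<Sum>i<k. r i e *\<^sub>R X i u) + (e - \<pi> e)" for u e
  have linL: "linear (L u)" for u
    by (rule linearI) (simp_all add: L_def linr linear_add[OF lin\<pi>] linear_cmul[OF lin\<pi>] algebra_simps
        sum.distrib scaleR_sum_right)
  have mem: "L u e - (e - \<pi> e) \<in> H u" if "u \<in> W" for u e
    unfolding L_def frame(3)[OF that, symmetric] add_diff_cancel_right'
    by (intro span_sum span_scale span_base imageI)
  have zero: "e = 0" if u: "u \<in> W" and e: "L u e = 0" for u e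
  proof -
    have "- (e - \<pi> e) \<in> H u" using mem[OF u, of e] e by simp
    then have "e - \<pi> e \<in> H u \<inter> S" using subspace_neg[OF subH[OF u]] \<pi>(2) by fastforce
    also have "\<dots> = {0}" using comp[OF u] by (simp only: complementary_def)
    finally have 1: "e - \<pi> e = 0" by (rule singletonD)
    then have "(\<Sum>i<k. r i e *\<^sub>R X i u) = 0" using e by (simp add: L_def)
    \<comment> \<open>Independence is a property of the set of frame vectors, so the indexed sum is
      rewritten over that set, with the index recovered from the vector.\<close>
    then have "(\<Sum>b\<in>(\<lambda>i. X i u) ` {..<k}. r (the_inv_into {..<k} (\<lambda>i. X i u) b) e *\<^sub>R b) = 0"
      by (simp add: sum.reindex[OF frame(1)[OF u]] the_inv_into_f_f[OF frame(1)[OF u]])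
    then have "r i e = 0" if "i < k" for i
      using independentD[OF frame(2)[OF u] _ subset_refl, of "\<lambda>b. r (the_inv_into {..<k} (\<lambda>i. X i u) b) e" "X i u"] that
      by (simp add: the_inv_into_f_f[OF frame(1)[OF u]])
    then have "\<pi> e = 0" using exp[of e] by simp
    then show ?thesis using 1 by simp
  qed
  have "smooth_on W (\<lambda>u. L u e)" for e
    unfolding L_def
    by (intro smooth_on_add[OF W] smooth_on_sum[OF W] smooth_on_bilinear[OF W bounded_bilinear_scaleR] smooth_on_const X) auto
  then have G: "smooth_on W (\<lambda>u. inv (L u) e)"
    by (rule smooth_on_inv[OF W linL _ zero smooth_on_const])
  have "bounded_linear (\<lambda>g. g - \<pi> g)"
    using linear_compose_sub[OF linear_ident lin\<pi>] by (simp add: linear_conv_bounded_linear)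
  then have "smooth_on W (\<lambda>u. e - (inv (L u) e - \<pi> (inv (L u) e)))"
    by (intro smooth_on_diff[OF W] smooth_on_const smooth_on_linear[OF W _ G])
  moreover have "proj_along (H u) S e = e - (inv (L u) e - \<pi> (inv (L u) e))" if "u \<in> W" for u
    by (rule proj_along_solution[OF subH[OF that] S comp[OF that] linL zero[OF that] mem[OF that] \<pi>(2)])
  ultimately show ?thesis
    by (rule smooth_on_transform[OF W])
qed

section \<open>Charts of a foliated manifold\<close>

text \<open>A linear functional that vanishes on \<open>S\<close> is constantly 0 along
  \<open>f\<close>, so it kills the derivative.\<close>

lemma derivative_in_subspace:
  fixes S :: "'b::euclidean_space set"
  assumes S: "subspace S" and f: "(f has_derivative f') (at x)"
    and W: "open W" "x \<in> W" "\<And>u. u \<in> W \<Longrightarrow> f u \<in> S"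
  shows "f' v \<in> S"
proof (rule ann_ann_subspace[OF S])
  fix a assume a: "a \<in> ann S"
  have "((\<lambda>u. blinfun_apply a (f u)) has_derivative (\<lambda>v. blinfun_apply a (f' v))) (at x)"
    by (rule bounded_linear.has_derivative[OF blinfun.bounded_linear_right f])
  moreover have "((\<lambda>u. blinfun_apply a (f u)) has_derivative (\<lambda>v. 0)) (at x)"
    by (rule has_derivative_transform_within_open[OF has_derivative_const W(1,2)])
      (use a W(3) in \<open>simp add: ann_def\<close>)
  ultimately show "blinfun_apply a (f' v) = 0" by (rule has_derivative_unique[THEN fun_cong])
qed

lemma directional_derivative_in_subspace:
  fixes S :: "'b::euclidean_space set"
  assumes S: "subspace S" and f: "(f has_derivative f') (at x)"
    and W: "open W" "x \<in> W" "\<And>t. x + t *\<^sub>R v \<in> W \<Longrightarrow> f (x + t *\<^sub>R v) - f x \<in> S"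
  shows "f' v \<in> S"
proof -
  have line: "((\<lambda>t. x + t *\<^sub>R v) has_derivative (\<lambda>t. t *\<^sub>R v)) (at 0)"
    by (auto intro!: derivative_eq_intros)
  have "(f has_derivative f') (at (x + 0 *\<^sub>R v))" using f by simp
  from has_derivative_compose[OF line this]
  have D: "((\<lambda>t. f (x + t *\<^sub>R v) - f x) has_derivative (\<lambda>t. f' (t *\<^sub>R v) - 0)) (at 0)"
    by (intro has_derivative_diff has_derivative_const)
  have "open ((\<lambda>t. x + t *\<^sub>R v) -` W)"
    by (intro open_vimage W(1) continuous_intros)
  from derivative_in_subspace[OF S D this, of 1] W show ?thesis by simp
qed

text \<open>Indexed by the point of the manifold instead of its coordinate, so that the chain rule
  reads as plain composition at \<open>y\<close>. Both \<open>dchart\<close> and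
  \<open>dchart_inv\<close> are instances with the preferred chart on one side.\<close>

definition tchart :: "('m, 'e::euclidean_space) chart \<Rightarrow> ('m, 'e) chart \<Rightarrow> 'm \<Rightarrow> 'e \<Rightarrow> 'e" where
  "tchart c c' y = frechet_derivative (transition c c') (at (snd c y))"

context
  fixes A :: "('m::t2_space, 'e::euclidean_space) chart set" and S :: "'e set"
  assumes fol: "foliated_atlas A S"
begin

lemma subspace_S: "subspace S"
  and smooth_atlas: "smooth_atlas A"
  using fol by (auto simp: foliated_atlas_def)

lemma chart_open:
  assumes "c \<in> A"
  shows "open (fst c)" "open (snd c ` fst c)"
    "homeomorphism (fst c) (snd c ` fst c) (snd c) (chart_inv c)"
  using smooth_atlas assms by (auto simp: smooth_atlas_def)

lemma chart_at: "chart_at A x \<in> A" "x \<in> fst (chart_at A x)"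
proof -
  have "x \<in> (\<Union>c\<in>A. fst c)" using smooth_atlas by (simp only: smooth_atlas_def UNIV_I)
  then have "\<exists>c. c \<in> A \<and> x \<in> fst c" by blast
  from someI_ex[OF this] show "chart_at A x \<in> A" "x \<in> fst (chart_at A x)"
    by (simp_all add: chart_at_def)
qed

lemma chart_inverse:
  assumes "c \<in> A"
  shows "y \<in> fst c \<Longrightarrow> chart_inv c (snd c y) = y" "u \<in> snd c ` fst c \<Longrightarrow> snd c (chart_inv c u) = u"
    "u \<in> snd c ` fst c \<Longrightarrow> chart_inv c u \<in> fst c"
  using chart_open(3)[OF assms] by (auto simp: homeomorphism_def)

lemma chart_inj: "c \<in> A \<Longrightarrow> y \<in> fst c \<Longrightarrow> z \<in> fst c \<Longrightarrow> snd c y = snd c z \<Longrightarrow> y = z"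
  by (metis chart_inverse(1))

lemma chart_image_iff:
  assumes "c \<in> A"
  shows "u \<in> snd c ` (fst c \<inter> W) \<longleftrightarrow> u \<in> snd c ` fst c \<and> chart_inv c u \<in> W"
proof
  assume "u \<in> snd c ` (fst c \<inter> W)"
  then obtain y where "y \<in> fst c" "y \<in> W" "u = snd c y" by blast
  then show "u \<in> snd c ` fst c \<and> chart_inv c u \<in> W" using chart_inverse(1)[OF assms] by simp
next
  assume "u \<in> snd c ` fst c \<and> chart_inv c u \<in> W"
  then show "u \<in> snd c ` (fst c \<inter> W)"
    using chart_inverse(2,3)[OF assms] by (metis IntI image_eqI)
qed

lemma open_chart_image:
  assumes "c \<in> A" "open W"
  shows "open (snd c ` (fst c \<inter> W))"
proof -
  have "snd c ` (fst c \<inter> W) = snd c ` fst c \<inter> chart_inv c -` W"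
    using chart_image_iff[OF assms(1), of _ W] by blast
  moreover have "continuous_on (snd c ` fst c) (chart_inv c)"
    using chart_open(3)[OF assms(1)] by (simp add: homeomorphism_def)
  ultimately show ?thesis
    using continuous_open_preimage[OF _ chart_open(2)[OF assms(1)] assms(2)] by metis
qed

lemma transition_apply: "c \<in> A \<Longrightarrow> y \<in> fst c \<Longrightarrow> transition c c' (snd c y) = snd c' y"
  by (simp add: transition_def chart_inverse)

lemma smooth_transition:
  assumes "c \<in> A" "c' \<in> A"
  shows "smooth_on (snd c ` (fst c \<inter> fst c')) (transition c c')"
  using smooth_atlas assms by (auto simp: smooth_atlas_def)

lemma transition_has_derivative:
  assumes "c \<in> A" "c' \<in> A" "y \<in> fst c" "y \<in> fst c'"
  shows "(transition c c' has_derivative tchart c c' y) (at (snd c y))"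
  unfolding tchart_def
  using smooth_on_differentiable[OF smooth_transition[OF assms(1,2)], of "snd c y"] assms(3,4)
  by (simp only: frechet_derivative_works) blast

lemma tchart_linear:
  assumes "c \<in> A" "c' \<in> A" "y \<in> fst c" "y \<in> fst c'"
  shows "linear (tchart c c' y)"
  by (rule bounded_linear.linear[OF has_derivative_bounded_linear[OF transition_has_derivative[OF assms]]])

lemma tchart_compose:
  assumes c: "c \<in> A" "c' \<in> A" "c'' \<in> A" and y: "y \<in> fst c" "y \<in> fst c'" "y \<in> fst c''"
  shows "tchart c' c'' y (tchart c c' y v) = tchart c c'' y v"
proof -
  have "(transition c' c'' has_derivative tchart c' c'' y) (at (transition c c' (snd c y)))"
    using transition_has_derivative[OF c(2,3) y(2,3)] by (simp only: transition_apply[OF c(1) y(1)])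
  from has_derivative_compose[OF transition_has_derivative[OF c(1,2) y(1,2)] this]
  have "((\<lambda>u. transition c' c'' (transition c c' u)) has_derivative
      (\<lambda>v. tchart c' c'' y (tchart c c' y v))) (at (snd c y))" .
  then have "(transition c c'' has_derivative (\<lambda>v. tchart c' c'' y (tchart c c' y v))) (at (snd c y))"
  proof (rule has_derivative_transform_within_open[OF _ open_chart_image[OF c(1) chart_open(1)[OF c(2)]]])
    show "snd c y \<in> snd c ` (fst c \<inter> fst c')" using y by blast
    fix u assume "u \<in> snd c ` (fst c \<inter> fst c')"
    then obtain z where "z \<in> fst c" "z \<in> fst c'" "u = snd c z" by blast
    then show "transition c' c'' (transition c c' u) = transition c c'' u"
      by (simp add: transition_apply c)
  qed
  from has_derivative_unique[OF this transition_has_derivative[OF c(1,3) y(1,3)]]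
  show ?thesis by (rule fun_cong)
qed

lemma tchart_self:
  assumes "c \<in> A" "y \<in> fst c"
  shows "tchart c c y v = v"
proof -
  have "(transition c c has_derivative (\<lambda>v. v)) (at (snd c y))"
  proof (rule has_derivative_transform_within_open[OF has_derivative_ident chart_open(2)[OF assms(1)]])
    show "snd c y \<in> snd c ` fst c" using assms(2) by blast
  qed (auto simp: transition_apply assms(1))
  from has_derivative_unique[OF transition_has_derivative[OF assms(1,1,2,2)] this]
  show ?thesis by (rule fun_cong)
qed

lemma tchart_inverse:
  assumes "c \<in> A" "c' \<in> A" "y \<in> fst c" "y \<in> fst c'"
  shows "tchart c' c y (tchart c c' y v) = v"
  using tchart_compose[OF assms(1,2,1,3,4,3)] tchart_self[OF assms(1,3)] by simp

lemma plaque_transition: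
  assumes "c \<in> A" "c' \<in> A" "y \<in> fst c" "y \<in> fst c'"
  obtains W where "open W" "snd c y \<in> W" "W \<subseteq> snd c ` (fst c \<inter> fst c')"
    "\<And>v w. v \<in> W \<Longrightarrow> w \<in> W \<Longrightarrow> v - w \<in> S \<Longrightarrow> transition c c' v - transition c c' w \<in> S"
proof -
  have "snd c y \<in> snd c ` (fst c \<inter> fst c')" using assms(3,4) by blast
  then have "\<exists>W. open W \<and> snd c y \<in> W \<and> W \<subseteq> snd c ` (fst c \<inter> fst c') \<and>
      (\<forall>v\<in>W. \<forall>w\<in>W. v - w \<in> S \<longrightarrow> transition c c' v - transition c c' w \<in> S)"
    using fol assms(1,2) unfolding foliated_atlas_def by blast
  then show thesis using that by blast
qed

lemma tchart_S:
  assumes "c \<in> A" "c' \<in> A" "y \<in> fst c" "y \<in> fst c'" "v \<in> S"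
  shows "tchart c c' y v \<in> S"
proof -
  obtain W where W: "open W" "snd c y \<in> W" "W \<subseteq> snd c ` (fst c \<inter> fst c')"
    "\<And>v w. v \<in> W \<Longrightarrow> w \<in> W \<Longrightarrow> v - w \<in> S \<Longrightarrow> transition c c' v - transition c c' w \<in> S"
    using plaque_transition[OF assms(1-4)] by metis
  have "t *\<^sub>R v \<in> S" for t by (rule subspace_scale[OF subspace_S assms(5)])
  then show ?thesis
    by (intro directional_derivative_in_subspace[OF subspace_S transition_has_derivative[OF assms(1-4)] W(1,2)] W(4))
      (simp_all add: W(2))
qed

lemma tchart_S_iff:
  assumes "c \<in> A" "c' \<in> A" "y \<in> fst c" "y \<in> fst c'"
  shows "tchart c c' y v \<in> S \<longleftrightarrow> v \<in> S"
  using tchart_S[OF assms] tchart_S[OF assms(2,1,4,3), of "tchart c c' y v"] tchart_inverse[OF assms] by metis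

text \<open>Modulo \<open>S\<close> the Jacobian of a coordinate change is constant along plaques.
  For \<open>d\<close> in \<open>S\<close>, the difference between the transition at
  \<open>u + d\<close> and at \<open>u\<close> stays in \<open>S\<close>, and so does its derivative
  in \<open>u\<close>. Constant fields are projectable for this reason.\<close>

lemma tchart_plaque:
  assumes c: "c \<in> A" "c' \<in> A" and W: "open W" "W \<subseteq> snd c ` (fst c \<inter> fst c')"
    "\<And>v w. v \<in> W \<Longrightarrow> w \<in> W \<Longrightarrow> v - w \<in> S \<Longrightarrow> transition c c' v - transition c c' w \<in> S"
    and yz: "y \<in> fst c" "z \<in> fst c" "snd c y \<in> W" "snd c z \<in> W" "snd c y - snd c z \<in> S"
  shows "tchart c c' y e - tchart c c' z e \<in> S"
proof -
  have mem: "x \<in> fst c'" if "x \<in> fst c" "snd c x \<in> W" for x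
    using W(2) that chart_inj[OF c(1)] by blast
  let ?d = "snd c y - snd c z"
  have "((\<lambda>u. u + ?d) has_derivative (\<lambda>v. v)) (at (snd c z))"
    by (auto intro!: derivative_eq_intros)
  moreover have "(transition c c' has_derivative tchart c c' y) (at (snd c z + ?d))"
    using transition_has_derivative[OF c yz(1) mem[OF yz(1,3)]] by simp
  ultimately have "((\<lambda>u. transition c c' (u + ?d)) has_derivative tchart c c' y) (at (snd c z))"
    by (rule has_derivative_compose)
  from has_derivative_diff[OF this transition_has_derivative[OF c yz(2) mem[OF yz(2,4)]]]
  have D: "((\<lambda>u. transition c c' (u + ?d) - transition c c' u) has_derivative
      (\<lambda>v. tchart c c' y v - tchart c c' z v)) (at (snd c z))" .
  have "open (W \<inter> (\<lambda>u. u + ?d) -` W)"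
    by (intro open_Int open_vimage W(1) continuous_intros)
  then show ?thesis
    by (rule derivative_in_subspace[OF subspace_S D]) (use yz W(3) in simp_all)
qed

lemma dchart_eq: "dchart A c x = tchart (chart_at A x) c x"
  and dchart_inv_eq: "dchart_inv A c x = tchart c (chart_at A x) x"
  by (simp_all add: dchart_def dchart_inv_def tchart_def coord_at_def)

text \<open>Coordinate changes preserve \<open>S\<close>, so the condition in all charts reduces to
  the one in the preferred chart, where the differential is the identity. The tangent bundle of the
  foliation thereby becomes a constant subspace.\<close>

lemma tangent_bundle_eq: "tangent_bundle A S x = S"
proof -
  have "v \<in> tangent_bundle A S x \<longleftrightarrow> v \<in> S" for v
  proof
    assume "v \<in> tangent_bundle A S x"
    then have "dchart A (chart_at A x) x v \<in> S" using chart_at unfolding tangent_bundle_def by blast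
    then show "v \<in> S" by (simp add: dchart_eq tchart_self chart_at)
  next
    assume "v \<in> S"
    then show "v \<in> tangent_bundle A S x"
      by (simp add: tangent_bundle_def dchart_eq tchart_S chart_at)
  qed
  then show ?thesis by blast
qed

lemma dchart_iso:
  assumes "c \<in> A" "y \<in> fst c"
  shows "linear (dchart A c y)" "linear (dchart_inv A c y)"
    "dchart_inv A c y (dchart A c y v) = v" "dchart A c y (dchart_inv A c y v) = v"
    "dchart A c y v \<in> S \<longleftrightarrow> v \<in> S"
  using assms chart_at
  by (simp_all only: dchart_eq dchart_inv_eq tchart_linear tchart_inverse tchart_S_iff)

lemma dchart_dchart_inv:
  assumes "c \<in> A" "c' \<in> A" "y \<in> fst c" "y \<in> fst c'"
  shows "dchart A c' y (dchart_inv A c y v) = tchart c c' y v"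
  using assms chart_at by (simp only: dchart_eq dchart_inv_eq tchart_compose)

lemma dchart_at: "dchart A (chart_at A x) x = (\<lambda>v. v)" "dchart_inv A (chart_at A x) x = (\<lambda>v. v)"
  by (simp_all add: fun_eq_iff dchart_eq dchart_inv_eq tchart_self chart_at)

lemma coord_at: "coord_at A x \<in> snd (chart_at A x) ` fst (chart_at A x)"
  "chart_inv (chart_at A x) (coord_at A x) = x"
  using chart_at by (simp_all add: coord_at_def chart_inverse)

lemma rep_at:
  "vec_rep A (chart_at A x) X (coord_at A x) = X x"
  "form_rep A (chart_at A x) \<sigma> (coord_at A x) = \<sigma> x"
  "bivec_rep A (chart_at A x) P (coord_at A x) = P x"
proof -
  have "Blinfun (\<lambda>v. v) = (id_blinfun :: 'e \<Rightarrow>\<^sub>L 'e)"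
    by (rule blinfun_eqI) (simp add: bounded_linear_Blinfun_apply bounded_linear_ident)
  then have "\<alpha> o\<^sub>L Blinfun (\<lambda>v. v) = \<alpha>" for \<alpha> :: "'e dual"
    by (intro blinfun_eqI) simp
  then show "vec_rep A (chart_at A x) X (coord_at A x) = X x"
    "form_rep A (chart_at A x) \<sigma> (coord_at A x) = \<sigma> x"
    "bivec_rep A (chart_at A x) P (coord_at A x) = P x"
    by (simp_all add: vec_rep_def form_rep_def bivec_rep_def coord_at dchart_at fun_eq_iff)
qed

definition proj_rep :: "('m, 'e) chart \<Rightarrow> ('m \<Rightarrow> 'e set) \<Rightarrow> 'e \<Rightarrow> 'e \<Rightarrow> 'e" where
  "proj_rep c H u v = dchart A c (chart_inv c u) (proj_along (H (chart_inv c u)) S (dchart_inv A c (chart_inv c u) v))"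

lemma proj_rep_at: "proj_rep (chart_at A x) H (coord_at A x) = proj_along (H x) S"
  by (simp add: proj_rep_def coord_at dchart_at fun_eq_iff)

lemma coupled_rep:
  assumes "c \<in> A" "u \<in> snd c ` fst c"
    and "\<And>x. coupled S (proj_along (H x) S) (P x) (P2 x) (\<sigma> x)"
  shows "coupled S (proj_rep c H u) (bivec_rep A c P u) (bivec_rep A c P2 u) (form_rep A c \<sigma> u)"
proof -
  note D = dchart_iso[OF assms(1) chart_inverse(3)[OF assms(1,2)]]
  from coupled_transport[OF assms(3) D(1,2,3,4) subspace_S D(5)[symmetric]]
  show ?thesis
    by (simp only: proj_rep_def[abs_def] bivec_rep_def[abs_def] form_rep_def[abs_def] Let_def)
qed

text \<open>A local frame of \<open>H\<close> becomes a frame in the coordinate space through the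
  chart differential. Since that differential preserves \<open>S\<close>, it intertwines the two
  projections.\<close>

lemma smooth_proj_rep:
  assumes c: "c \<in> A" and H: "normal_bundle A S H"
  shows "smooth_on (snd c ` fst c) (\<lambda>u. proj_rep c H u e)"
proof (rule smooth_on_local)
  fix x assume x: "x \<in> snd c ` fst c"
  have comp: "complementary (H y) S" for y using H by (simp add: normal_bundle_def tangent_bundle_eq)
  obtain U k and X :: "nat \<Rightarrow> 'm \<Rightarrow> 'e" where U: "open U" "chart_inv c x \<in> U" "\<And>i. i < k \<Longrightarrow> smooth_field A U (X i)"
    and frame: "\<And>y. y \<in> U \<Longrightarrow> inj_on (\<lambda>i. X i y) {..<k}" "\<And>y. y \<in> U \<Longrightarrow> independent ((\<lambda>i. X i y) ` {..<k})"
      "\<And>y. y \<in> U \<Longrightarrow> span ((\<lambda>i. X i y) ` {..<k}) = H y"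
    using H unfolding normal_bundle_def smooth_subbundle_def by metis
  let ?W = "snd c ` (fst c \<inter> U)"
  have W: "open ?W" by (rule open_chart_image[OF c U(1)])
  let ?H = "\<lambda>u. dchart A c (chart_inv c u) ` H (chart_inv c u)"
  have in_U: "chart_inv c u \<in> U" "chart_inv c u \<in> fst c" if "u \<in> ?W" for u
    using that by (auto simp: chart_inverse c)
  note D = dchart_iso[OF c in_U(2)]
  have inj: "inj (dchart A c (chart_inv c u))" if "u \<in> ?W" for u
    by (rule injI) (metis D(3)[OF that])
  have img: "(\<lambda>i. vec_rep A c (X i) u) ` {..<k} = dchart A c (chart_inv c u) ` (\<lambda>i. X i (chart_inv c u)) ` {..<k}" for u
    by (simp only: vec_rep_def image_image)
  have subH: "subspace (H y)" if "y \<in> U" for y using frame(3)[OF that] subspace_span by metis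
  have compD: "complementary (?H u) S" if u: "u \<in> ?W" for u
    unfolding complementary_def
  proof
    show "?H u \<inter> S = {0}"
    proof -
      have "h = 0" if "h \<in> H (chart_inv c u)" "dchart A c (chart_inv c u) h \<in> S" for h
      proof -
        have "h \<in> H (chart_inv c u) \<inter> S" using that D(5)[OF u] by blast
        then show ?thesis using comp[of "chart_inv c u"] unfolding complementary_def by blast
      qed
      then show ?thesis
        using linear_0[OF D(1)[OF u]] subspace_0[OF subH[OF in_U(1)[OF u]]] subspace_0[OF subspace_S] by force
    qed
    have "\<exists>d\<in>?H u. \<exists>e\<in>S. v = d + e" for v
    proof -
      obtain d e where de: "d \<in> H (chart_inv c u)" "e \<in> S" "dchart_inv A c (chart_inv c u) v = d + e"
        using comp[of "chart_inv c u"] unfolding complementary_def by blast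
      have "v = dchart A c (chart_inv c u) d + dchart A c (chart_inv c u) e"
        unfolding linear_add[OF D(1)[OF u], symmetric] de(3)[symmetric] by (simp only: D(4)[OF u])
      then show ?thesis using de(1,2) D(5)[OF u] by blast
    qed
    then show "{d + e |d e. d \<in> ?H u \<and> e \<in> S} = UNIV" by blast
  qed
  have "smooth_on ?W (\<lambda>u. proj_along (?H u) S e)"
  proof (rule smooth_projection[where X = "\<lambda>i. vec_rep A c (X i)" and k = k, OF W subspace_S])
    show "smooth_on ?W (vec_rep A c (X i))" if "i < k" for i
      using U(3)[OF that] c unfolding smooth_field_def by blast
    fix u assume u: "u \<in> ?W"
    show "inj_on (\<lambda>i. vec_rep A c (X i) u) {..<k}"
      using comp_inj_on[OF frame(1)[OF in_U(1)[OF u]] inj_on_subset[OF inj[OF u] subset_UNIV]]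
      by (simp only: vec_rep_def o_def)
    show "independent ((\<lambda>i. vec_rep A c (X i) u) ` {..<k})"
      unfolding img by (rule linear_independent_injective_image[OF D(1)[OF u] frame(2)[OF in_U(1)[OF u]]
          inj_on_subset[OF inj[OF u] subset_UNIV]])
    show "span ((\<lambda>i. vec_rep A c (X i) u) ` {..<k}) = ?H u"
      unfolding img linear_span_image[OF D(1)[OF u]] frame(3)[OF in_U(1)[OF u]] ..
    show "complementary (?H u) S" by (rule compD[OF u])
  qed
  then have "smooth_on ?W (\<lambda>u. proj_rep c H u e)"
  proof (rule smooth_on_transform[OF W])
    fix u assume u: "u \<in> ?W"
    note P = proj_along[OF subH[OF in_U(1)[OF u]] subspace_S comp, of "dchart_inv A c (chart_inv c u) e"]
    have "e - proj_rep c H u e = dchart A c (chart_inv c u) (dchart_inv A c (chart_inv c u) e -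
        proj_along (H (chart_inv c u)) S (dchart_inv A c (chart_inv c u) e))"
      unfolding linear_diff[OF D(1)[OF u]] proj_rep_def D(4)[OF u] ..
    then have "e - proj_rep c H u e \<in> S" using P(2) D(5)[OF u] by metis
    moreover have "proj_rep c H u e \<in> ?H u" unfolding proj_rep_def using P(1) by blast
    ultimately show "proj_rep c H u e = proj_along (?H u) S e"
      using proj_along_unique[OF linear_subspace_image[OF D(1)[OF u] subH[OF in_U(1)[OF u]]] subspace_S compD[OF u]] by metis
  qed
  moreover have "?W \<subseteq> snd c ` fst c" "x \<in> ?W"
    using chart_image_iff[OF c, of x U] x U(2) by blast+
  ultimately show "\<exists>W. open W \<and> x \<in> W \<and> W \<subseteq> snd c ` fst c \<and> smooth_on W (\<lambda>u. proj_rep c H u e)"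
    using W by blast
qed

end

section \<open>Projectable vector fields\<close>

context
  fixes A :: "('m::t2_space, 'e::euclidean_space) chart set" and S :: "'e set"
  assumes fol: "foliated_atlas A S"
begin

text \<open>In the coordinate of \<open>c\<close> the differential of the change from
  \<open>c'\<close> to \<open>c\<close> would be a composite. Viewed as the inverse of the
  derivative of \<open>transition c c'\<close>, it is the solution of a linear equation with smooth
  coefficients in that same coordinate.\<close>

lemma smooth_tchart:
  assumes c: "c \<in> A" "c' \<in> A"
  shows "smooth_on (snd c ` (fst c \<inter> fst c')) (\<lambda>u. tchart c' c (chart_inv c u) e)"
proof (rule smooth_on_linear_solution[where L = "\<lambda>u. frechet_derivative (transition c c') (at u)"])
  let ?V = "snd c ` (fst c \<inter> fst c')"
  show V: "open ?V" by (rule open_chart_image[OF fol c(1) chart_open(1)[OF fol c(2)]])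
  fix u assume "u \<in> ?V"
  then obtain y where y: "y \<in> fst c" "y \<in> fst c'" "u = snd c y" by blast
  have eq: "frechet_derivative (transition c c') (at u) = tchart c c' y" by (simp only: tchart_def y(3))
  have inv: "chart_inv c u = y" by (simp add: y chart_inverse(1)[OF fol c(1)])
  show "linear (frechet_derivative (transition c c') (at u))"
    unfolding eq by (rule tchart_linear[OF fol c y(1,2)])
  show "inj (frechet_derivative (transition c c') (at u))"
    unfolding eq by (rule injI) (metis tchart_inverse[OF fol c y(1,2)])
  show "frechet_derivative (transition c c') (at u) (tchart c' c (chart_inv c u) e) = e"
    unfolding eq inv by (rule tchart_inverse[OF fol c(2,1) y(2,1)])
qed (rule smooth_on_frechet_derivative[OF smooth_transition[OF fol c]] smooth_on_const)+

lemma dvec_rep_has_derivative: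
  assumes X: "smooth_field A U X" and x: "x \<in> U"
  shows "(vec_rep A (chart_at A x) X has_derivative dvec_rep A X x) (at (coord_at A x))"
proof -
  have "smooth_on (snd (chart_at A x) ` (fst (chart_at A x) \<inter> U)) (vec_rep A (chart_at A x) X)"
    using X chart_at(1)[OF fol] unfolding smooth_field_def by blast
  moreover have "coord_at A x \<in> snd (chart_at A x) ` (fst (chart_at A x) \<inter> U)"
    using chart_at(2)[OF fol] x unfolding coord_at_def by blast
  ultimately show ?thesis
    unfolding dvec_rep_def by (intro frechet_derivative_works[THEN iffD1] smooth_on_differentiable)
qed

lemma tangent_field_derivative:
  assumes U: "open U" "x \<in> U" and Y: "smooth_field A U Y" "\<And>y. y \<in> U \<Longrightarrow> Y y \<in> S"
  shows "dvec_rep A Y x v \<in> S"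
proof (rule derivative_in_subspace[OF subspace_S[OF fol] dvec_rep_has_derivative[OF Y(1) U(2)]])
  let ?c = "chart_at A x"
  show "open (snd ?c ` (fst ?c \<inter> U))" by (rule open_chart_image[OF fol chart_at(1)[OF fol] U(1)])
  show "coord_at A x \<in> snd ?c ` (fst ?c \<inter> U)"
    using chart_at(2)[OF fol] U(2) unfolding coord_at_def by blast
  fix u assume "u \<in> snd ?c ` (fst ?c \<inter> U)"
  then obtain y where y: "y \<in> fst ?c" "y \<in> U" "u = snd ?c y" by blast
  show "vec_rep A ?c Y u \<in> S"
    unfolding vec_rep_def y(3) chart_inverse(1)[OF fol chart_at(1)[OF fol] y(1)]
      dchart_iso(5)[OF fol chart_at(1)[OF fol] y(1)] by (rule Y(2)[OF y(2)])
qed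

text \<open>A bump function is needed here because the test fields \<open>Y\<close> must be defined on all of \<open>U\<close>.\<close>

lemma exists_tangent_field:
  assumes s: "s \<in> S"
  shows "\<exists>Y r. smooth_field A UNIV Y \<and> (\<forall>y. Y y \<in> S) \<and> r > 0 \<and> Y x = r *\<^sub>R s"
proof -
  let ?c0 = "chart_at A x" and ?u0 = "coord_at A x"
  note c0 = chart_at[OF fol, of x]
  have "?u0 \<in> snd ?c0 ` fst ?c0" by (rule coord_at(1)[OF fol])
  then obtain r where r: "r > 0" "cball ?u0 r \<subseteq> snd ?c0 ` fst ?c0"
    using chart_open(2)[OF fol c0(1)] open_contains_cball by blast
  \<comment> \<open>Positive inside the ball of radius \<open>r\<close> about \<open>?u0\<close> and
    zero from its boundary on, where it is flat to all orders.\<close>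
  define h where "h u = flat_exp 0 (r * r - (u - ?u0) \<bullet> (u - ?u0))" for u
  define Y where "Y y = (if y \<in> fst ?c0 then h (snd ?c0 y) *\<^sub>R dchart_inv A ?c0 y s else 0)" for y
  define K where "K = chart_inv ?c0 ` cball ?u0 r"
  have "continuous_on (snd ?c0 ` fst ?c0) (chart_inv ?c0)"
    using chart_open(3)[OF fol c0(1)] by (simp add: homeomorphism_def)
  then have "compact K"
    unfolding K_def by (rule compact_continuous_image[OF continuous_on_subset[OF _ r(2)] compact_cball])
  \<comment> \<open>The Hausdorff property enters here. The chart domain and the complement of
    \<open>K\<close> form an open cover, and on the second set the extended field is 0.\<close>
  then have openK: "open (- K)" using compact_imp_closed by (simp add: open_closed)
  have Y0: "Y y = 0" if "y \<notin> K" for y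
  proof (cases "y \<in> fst ?c0")
    case True
    have "snd ?c0 y \<notin> cball ?u0 r"
      using that chart_inverse(1)[OF fol c0(1) True] unfolding K_def by (metis imageI)
    then have "r < norm (snd ?c0 y - ?u0)" by (simp add: dist_norm norm_minus_commute)
    then have "r * r < norm (snd ?c0 y - ?u0) * norm (snd ?c0 y - ?u0)"
      using r(1) by (intro mult_strict_mono) auto
    then have "h (snd ?c0 y) = 0"
      by (simp add: h_def flat_exp_def dot_square_norm power2_eq_square)
    then show ?thesis by (simp add: Y_def)
  qed (simp add: Y_def)
  have "smooth_on (snd c ` (fst c \<inter> UNIV)) (vec_rep A c Y)" if c: "c \<in> A" for c
  proof -
    let ?V1 = "snd c ` (fst c \<inter> fst ?c0)" and ?V2 = "snd c ` (fst c \<inter> - K)"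
    have V: "open ?V1" "open ?V2"
      by (rule open_chart_image[OF fol c] chart_open(1)[OF fol c0(1)] openK)+
    have "K \<subseteq> fst ?c0" unfolding K_def using r(2) chart_inverse(3)[OF fol c0(1)] by blast
    then have un: "snd c ` (fst c \<inter> UNIV) = ?V1 \<union> ?V2" by blast
    have "smooth_on ?V1 (\<lambda>u. flat_exp 0 (r * r - (transition c ?c0 u - ?u0) \<bullet> (transition c ?c0 u - ?u0))
        *\<^sub>R tchart ?c0 c (chart_inv c u) s)"
      by (rule smooth_on_bilinear[OF V(1) bounded_bilinear_scaleR smooth_on_flat_exp[OF V(1)]
           smooth_tchart[OF c c0(1)]])
        (intro smooth_on_diff[OF V(1)] smooth_on_bilinear[OF V(1) bounded_bilinear_inner] smooth_on_const
           smooth_transition[OF fol c c0(1)])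
    then have 1: "smooth_on ?V1 (vec_rep A c Y)"
    proof (rule smooth_on_transform[OF V(1)])
      fix u assume "u \<in> ?V1"
      then obtain y where y: "y \<in> fst c" "y \<in> fst ?c0" "u = snd c y" by blast
      show "vec_rep A c Y u = flat_exp 0 (r * r - (transition c ?c0 u - ?u0) \<bullet> (transition c ?c0 u - ?u0))
          *\<^sub>R tchart ?c0 c (chart_inv c u) s"
        by (simp add: vec_rep_def y chart_inverse(1)[OF fol c] transition_apply[OF fol c] Y_def h_def
            linear_cmul[OF dchart_iso(1)[OF fol c y(1)]] dchart_dchart_inv[OF fol c0(1) c y(2,1)])
    qed
    have 2: "smooth_on ?V2 (vec_rep A c Y)"
    proof (rule smooth_on_transform[OF V(2) smooth_on_const[of _ 0]])
      fix u assume "u \<in> ?V2"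
      then obtain y where y: "y \<in> fst c" "y \<notin> K" "u = snd c y" by blast
      show "vec_rep A c Y u = 0"
        by (simp add: vec_rep_def y chart_inverse(1)[OF fol c] Y0 linear_0[OF dchart_iso(1)[OF fol c y(1)]])
    qed
    show ?thesis unfolding un by (rule smooth_on_Un[OF V 1 2])
  qed
  then have "smooth_field A UNIV Y" by (simp add: smooth_field_def)
  moreover have "Y y \<in> S" for y
  proof (cases "y \<in> fst ?c0")
    case True
    have "dchart_inv A ?c0 y s \<in> S"
      using dchart_iso(4,5)[OF fol c0(1) True] s by metis
    then show ?thesis using subspace_scale[OF subspace_S[OF fol]] by (simp add: Y_def True)
  qed (simp add: Y_def subspace_0[OF subspace_S[OF fol]])
  moreover have "Y x = flat_exp 0 (r * r) *\<^sub>R s"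
    by (simp add: Y_def h_def c0(2) dchart_at[OF fol] coord_at_def)
  moreover have "flat_exp 0 (r * r) > 0" using r(1) by (simp add: flat_exp_def)
  ultimately show ?thesis by blast
qed

text \<open>Of the two terms of the bracket with a leaf-tangent field \<open>Y\<close>, the
  derivative of \<open>Y\<close> is in \<open>S\<close> anyway. Projectability therefore constrains
  exactly the derivative of \<open>X\<close> in the direction of \<open>Y\<close>, and
  \<open>Y\<close> can be given any direction in \<open>S\<close>.\<close>

lemma projectable_field_derivative:
  assumes X: "X \<in> projectable_fields A S H U" and x: "x \<in> U" "open U" and s: "s \<in> S"
  shows "dvec_rep A X x s \<in> S"
proof -
  obtain Y r where Y: "smooth_field A UNIV Y" "\<And>y. Y y \<in> S" "r > 0" "Y x = r *\<^sub>R s"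
    using exists_tangent_field[OF s, of x] by blast
  have YU: "smooth_field A U Y"
    unfolding smooth_field_def
  proof
    fix c assume "c \<in> A"
    then have "smooth_on (snd c ` (fst c \<inter> UNIV)) (vec_rep A c Y)" using Y(1) unfolding smooth_field_def by blast
    then show "smooth_on (snd c ` (fst c \<inter> U)) (vec_rep A c Y)" by (rule smooth_on_subset) blast
  qed
  have XU: "smooth_field A U X" using X unfolding projectable_fields_def by blast
  have "lie_bracket A Y X x \<in> S"
    using X YU Y(2) x(1) unfolding projectable_fields_def tangent_bundle_eq[OF fol] by blast
  moreover have "dvec_rep A Y x (X x) \<in> S" by (rule tangent_field_derivative[OF x(2,1) YU Y(2)])
  ultimately have "lie_bracket A Y X x + dvec_rep A Y x (X x) \<in> S" by (rule subspace_add[OF subspace_S[OF fol]])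
  then have "r *\<^sub>R dvec_rep A X x s \<in> S"
    using linear_cmul[OF bounded_linear.linear[OF has_derivative_bounded_linear[OF dvec_rep_has_derivative[OF XU x(1)]]]]
    by (simp add: lie_bracket_def Y(4))
  from subspace_scale[OF subspace_S[OF fol] this, of "inverse r"] show ?thesis using Y(3) by simp
qed

context
  fixes H :: "'m \<Rightarrow> 'e set"
  assumes H: "normal_bundle A S H"
begin

lemma normal_complementary: "complementary (H x) S"
  using H by (simp add: normal_bundle_def tangent_bundle_eq[OF fol])

lemma normal_subspace: "subspace (H x)"
proof -
  obtain k and X :: "nat \<Rightarrow> 'm \<Rightarrow> 'e" where "span ((\<lambda>i. X i x) ` {..<k}) = H x"
    using H unfolding normal_bundle_def smooth_subbundle_def by metis
  then show ?thesis using subspace_span by metis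
qed

lemmas normal = normal_subspace subspace_S[OF fol] normal_complementary

lemma projectable_germ_rep:
  assumes X: "X \<in> projectable_fields A S H U" and x: "x \<in> U" "open U"
  shows "projectable_germ (snd (chart_at A x) ` fst (chart_at A x)) S (proj_rep A S (chart_at A x) H) (coord_at A x)
    (vec_rep A (chart_at A x) X) (dvec_rep A X x)"
  unfolding projectable_germ_def
proof (intro conjI exI ballI)
  let ?c = "chart_at A x"
  let ?W = "snd ?c ` (fst ?c \<inter> U)"
  note c = chart_at[OF fol, of x]
  show "(vec_rep A ?c X has_derivative dvec_rep A X x) (at (coord_at A x))"
    by (rule dvec_rep_has_derivative[OF _ x(1)]) (use X in \<open>simp add: projectable_fields_def\<close>)
  show "dvec_rep A X x v \<in> S" if "v \<in> S" for v by (rule projectable_field_derivative[OF X x that])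
  show "open ?W" by (rule open_chart_image[OF fol c(1) x(2)])
  show "coord_at A x \<in> ?W" using c(2) x(1) unfolding coord_at_def by blast
  show "?W \<subseteq> snd ?c ` fst ?c" by blast
  fix u assume "u \<in> ?W"
  then obtain y where y: "y \<in> fst ?c" "y \<in> U" "u = snd ?c y" by blast
  have "X y \<in> H y" using X y(2) unfolding projectable_fields_def by blast
  then have "proj_along (H y) S (X y) = X y"
    by (intro proj_along_unique[OF normal]) (simp_all add: subspace_0[OF subspace_S[OF fol]])
  then show "proj_rep A S ?c H u (vec_rep A ?c X u) = vec_rep A ?c X u"
    by (simp add: proj_rep_def[OF fol] vec_rep_def y(3) chart_inverse(1)[OF fol c(1) y(1)] dchart_iso(3)[OF fol c(1) y(1)])
qed

text \<open>The field that is constantly \<open>e\<close> in the coordinates of the chart, projected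
  to \<open>H\<close>. Projecting changes it only by vectors of \<open>S\<close>, so it stays
  projectable.\<close>

lemma exists_projectable_field:
  assumes e: "e \<in> H x"
  shows "\<exists>X\<in>projectable_fields A S H (fst (chart_at A x)). X x = e"
proof -
  let ?c0 = "chart_at A x"
  note c0 = chart_at[OF fol, of x]
  define X where "X y = proj_along (H y) S (dchart_inv A ?c0 y e)" for y
  have value_x: "X x = e"
    unfolding X_def dchart_at[OF fol]
    by (intro proj_along_unique[OF normal] e) (simp_all add: subspace_0[OF subspace_S[OF fol]])
  have rep: "vec_rep A c X (snd c y) = proj_rep A S c H (snd c y) (tchart ?c0 c y e)"
    if c: "c \<in> A" and y: "y \<in> fst c" "y \<in> fst ?c0" for c y
    by (simp add: vec_rep_def X_def proj_rep_def[OF fol] chart_inverse(1)[OF fol c y(1)]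
        dchart_dchart_inv[OF fol c0(1) c y(2,1), symmetric] dchart_iso(3)[OF fol c y(1)])
  have rep_mod: "vec_rep A c X (snd c y) - tchart ?c0 c y e \<in> S"
    if c: "c \<in> A" and y: "y \<in> fst c" "y \<in> fst ?c0" for c y
  proof -
    have "dchart_inv A ?c0 y e - X y \<in> S" unfolding X_def by (rule proj_along(2)[OF normal])
    then have "X y - dchart_inv A ?c0 y e \<in> S" using subspace_neg[OF subspace_S[OF fol]] by fastforce
    then have "dchart A c y (X y - dchart_inv A ?c0 y e) \<in> S" by (simp only: dchart_iso(5)[OF fol c y(1)])
    then show ?thesis
      by (simp add: linear_diff[OF dchart_iso(1)[OF fol c y(1)]] vec_rep_def chart_inverse(1)[OF fol c y(1)]
          dchart_dchart_inv[OF fol c0(1) c y(2,1)])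
  qed
  have smooth: "smooth_field A (fst ?c0) X"
    unfolding smooth_field_def
  proof
    fix c assume c: "c \<in> A"
    let ?V = "snd c ` (fst c \<inter> fst ?c0)"
    have V: "open ?V" by (rule open_chart_image[OF fol c chart_open(1)[OF fol c0(1)]])
    have lin: "linear (proj_rep A S c H u)" if "u \<in> ?V" for u
    proof -
      have y: "chart_inv c u \<in> fst c" using that chart_inverse(3)[OF fol c] by blast
      show ?thesis
        using linear_compose[OF linear_compose[OF dchart_iso(2)[OF fol c y] linear_proj_along[OF normal]] dchart_iso(1)[OF fol c y]]
        by (simp add: proj_rep_def[OF fol, abs_def] o_def)
    qed
    have "smooth_on ?V (\<lambda>u. proj_rep A S c H u v)" for v
      by (rule smooth_on_subset[OF smooth_proj_rep[OF fol c H]]) blast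
    from smooth_on_linear_family[where L = "proj_rep A S c H", OF V lin this smooth_tchart[OF c c0(1), of e]]
    show "smooth_on ?V (vec_rep A c X)"
    proof (rule smooth_on_transform[OF V])
      fix u assume "u \<in> ?V"
      then obtain y where y: "y \<in> fst c" "y \<in> fst ?c0" "u = snd c y" by blast
      show "vec_rep A c X u = proj_rep A S c H u (tchart ?c0 c (chart_inv c u) e)"
        unfolding y(3) chart_inverse(1)[OF fol c y(1)] by (rule rep[OF c y(1,2)])
    qed
  qed
  have deriv: "dvec_rep A X y s \<in> S" if y: "y \<in> fst ?c0" and s: "s \<in> S" for y s
  proof -
    let ?c1 = "chart_at A y"
    note c1 = chart_at[OF fol, of y]
    obtain W where W: "open W" "snd ?c1 y \<in> W" "W \<subseteq> snd ?c1 ` (fst ?c1 \<inter> fst ?c0)"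
      "\<And>v w. v \<in> W \<Longrightarrow> w \<in> W \<Longrightarrow> v - w \<in> S \<Longrightarrow> transition ?c1 ?c0 v - transition ?c1 ?c0 w \<in> S"
      using plaque_transition[OF fol c1(1) c0(1) c1(2) y] by metis
    show ?thesis
    proof (rule directional_derivative_in_subspace[OF subspace_S[OF fol] dvec_rep_has_derivative[OF smooth y] W(1)])
      show "coord_at A y \<in> W" using W(2) by (simp add: coord_at_def)
      fix t assume t: "coord_at A y + t *\<^sub>R s \<in> W"
      then obtain z where z: "z \<in> fst ?c1" "z \<in> fst ?c0" "coord_at A y + t *\<^sub>R s = snd ?c1 z" using W(3) by blast
      let ?g = "\<lambda>z. tchart ?c0 ?c1 z e"
      have "snd ?c1 y - snd ?c1 z = (- t) *\<^sub>R s" using z(3)[symmetric] by (simp add: coord_at_def)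
      then have yz: "snd ?c1 y - snd ?c1 z \<in> S" using subspace_scale[OF subspace_S[OF fol] s] by metis
      \<comment> \<open>The plaque property on \<open>W\<close> concerns the passage from
        \<open>?c1\<close> to \<open>?c0\<close>, whereas \<open>?g\<close> goes the other way.
        Comparing the two Jacobians on the single vector \<open>?g z\<close>, which the one at
        \<open>z\<close> sends back to \<open>e\<close>, transfers the statement to
        \<open>?g\<close>.\<close>
      have "tchart ?c1 ?c0 y (?g z) - tchart ?c1 ?c0 z (?g z) \<in> S"
        by (rule tchart_plaque[OF fol c1(1) c0(1) W(1,3,4) c1(2) z(1) W(2) _ yz]) (use t z(3) in simp_all)
      then have "tchart ?c1 ?c0 y (?g z) - tchart ?c1 ?c0 y (?g y) \<in> S"
        by (simp add: tchart_inverse[OF fol c0(1) c1(1) z(2,1)] tchart_inverse[OF fol c0(1) c1(1) y c1(2)])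
      then have "?g z - ?g y \<in> S"
        by (simp only: linear_diff[OF tchart_linear[OF fol c1(1) c0(1) c1(2) y], symmetric]
            tchart_S_iff[OF fol c1(1) c0(1) c1(2) y])
      from subspace_add[OF subspace_S[OF fol] this subspace_diff[OF subspace_S[OF fol]
          rep_mod[OF c1(1) z(1,2)] rep_mod[OF c1(1) c1(2) y]]]
      show "vec_rep A ?c1 X (coord_at A y + t *\<^sub>R s) - vec_rep A ?c1 X (coord_at A y) \<in> S"
        unfolding z(3) by (simp add: coord_at_def algebra_simps)
    qed
  qed
  have "X \<in> projectable_fields A S H (fst ?c0)"
    unfolding projectable_fields_def tangent_bundle_eq[OF fol]
  proof (intro CollectI conjI ballI allI impI smooth)
    show "X y \<in> H y" for y unfolding X_def by (rule proj_along(1)[OF normal])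
    fix Y y assume Y: "smooth_field A (fst ?c0) Y \<and> (\<forall>y\<in>fst ?c0. Y y \<in> S)" and y: "y \<in> fst ?c0"
    have "dvec_rep A Y y (X y) \<in> S"
      by (rule tangent_field_derivative[OF chart_open(1)[OF fol c0(1)] y]) (use Y in simp_all)
    moreover have "dvec_rep A X y (Y y) \<in> S" using deriv[OF y] Y y by blast
    ultimately show "lie_bracket A Y X y \<in> S"
      unfolding lie_bracket_def by (intro subspace_diff[OF subspace_S[OF fol]])
  qed
  with value_x show ?thesis by blast
qed

section \<open>The structure equations\<close>

lemma schouten_jacobiator:
  "schouten_bracket A P P x \<alpha> \<beta> \<gamma> = 2 * jacobiator (bivec_rep A (chart_at A x) P) (coord_at A x) \<alpha> \<beta> \<gamma>"
  by (simp add: schouten_bracket_def jacobiator_def dbivec_rep_def rep_at[OF fol])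

context
  fixes P P2 :: "'m \<Rightarrow> 'e dual \<Rightarrow> 'e dual \<Rightarrow> real" and \<sigma> :: "'m \<Rightarrow> 'e \<Rightarrow> 'e \<Rightarrow> real"
  assumes P: "bivector_field A P" and P2: "bivector_field A P2" and \<sigma>: "two_form A \<sigma>"
    and cpl: "\<And>x. coupled S (proj_along (H x) S) (P x) (P2 x) (\<sigma> x)"
begin

lemma rep_differentiable:
  assumes "c \<in> A" "u \<in> snd c ` fst c"
  shows "(\<lambda>u. proj_rep A S c H u e) differentiable (at u)"
    "(\<lambda>u. bivec_rep A c P u \<alpha> \<beta>) differentiable (at u)"
    "(\<lambda>u. bivec_rep A c P2 u \<alpha> \<beta>) differentiable (at u)"
    "(\<lambda>u. form_rep A c \<sigma> u v w) differentiable (at u)"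
  by (rule smooth_on_differentiable[OF _ assms(2)], use P P2 \<sigma> assms(1) smooth_proj_rep[OF fol assms(1) H] in
      \<open>simp add: bivector_field_def two_form_def\<close>)+

text \<open>Ordered like the assumptions of the pointwise results, so that one \<open>OF\<close>
  instantiates them in the preferred chart.\<close>

lemmas rep_facts = chart_open(2)[OF fol chart_at(1)[OF fol]] coord_at(1)[OF fol]
  coupled_rep[OF fol chart_at(1)[OF fol] _ cpl] rep_differentiable[OF chart_at(1)[OF fol] coord_at(1)[OF fol]]

lemma range_proj: "range (proj_along (H x) S) = H x"
proof
  show "range (proj_along (H x) S) \<subseteq> H x" using proj_along(1)[OF normal] by blast
  have "proj_along (H x) S v = v" if "v \<in> H x" for v
    by (intro proj_along_unique[OF normal] that) (simp add: subspace_0[OF subspace_S[OF fol]])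
  then show "H x \<subseteq> range (proj_along (H x) S)" by (metis rangeI subsetI)
qed

lemma normal_sharp: "H x = sharp (P x) ` ann S"
  using coupled_range_pi[OF cpl, of x] by (simp only: range_proj)

abbreviation (input) jac where
  "jac x \<equiv> jacobiator (bivec_rep A (chart_at A x) P) (coord_at A x)"

lemma d_prime_iff:
  "(\<forall>v1 v2 v3. d_prime A S H \<sigma> x v1 v2 v3 = 0) \<longleftrightarrow> (\<forall>a\<in>ann S. \<forall>b\<in>ann S. \<forall>c\<in>ann S. jac x a b c = 0)"
proof -
  have J: "jac x a b c = - ext_deriv A \<sigma> x (sharp (P x) a) (sharp (P x) b) (sharp (P x) c)"
    if "a \<in> ann S" "b \<in> ann S" "c \<in> ann S" for a b c
    using jacobiator_ann_F[OF rep_facts that] by (simp only: ext_deriv_def dform_rep_def rep_at[OF fol])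
  have d: "d_prime A S H \<sigma> x v1 v2 v3 =
      ext_deriv A \<sigma> x (proj_along (H x) S v1) (proj_along (H x) S v2) (proj_along (H x) S v3)" for v1 v2 v3
    by (simp add: d_prime_def tangent_bundle_eq[OF fol] Let_def)
  show ?thesis
  proof (intro iffI ballI allI)
    fix a b c assume *: "\<forall>v1 v2 v3. d_prime A S H \<sigma> x v1 v2 v3 = 0" "a \<in> ann S" "b \<in> ann S" "c \<in> ann S"
    then show "jac x a b c = 0"
      using d[of "sharp (P x) a" "sharp (P x) b" "sharp (P x) c"] by (simp add: J coupled_pi_sharp[OF cpl])
  next
    fix v1 v2 v3 assume *: "\<forall>a\<in>ann S. \<forall>b\<in>ann S. \<forall>c\<in>ann S. jac x a b c = 0"
    obtain a b c where abc: "a \<in> ann S" "b \<in> ann S" "c \<in> ann S" "proj_along (H x) S v1 = sharp (P x) a"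
      "proj_along (H x) S v2 = sharp (P x) b" "proj_along (H x) S v3 = sharp (P x) c"
      using coupled_pi_mem_sharp[OF cpl, of x] by metis
    then show "d_prime A S H \<sigma> x v1 v2 v3 = 0" using J[OF abc(1-3)] * by (simp add: d)
  qed
qed

text \<open>The right-hand side depends on the fields only through their values at \<open>x\<close>.
  The curvature equation for one pair of fields is thus equivalent to that for any other pair with
  these values, which reduces the quantifiers over fields to quantifiers over covectors.\<close>

lemma curvature_iff:
  assumes X: "X \<in> projectable_fields A S H U" and Y: "Y \<in> projectable_fields A S H U" and x: "x \<in> U" "open U"
    and a: "a \<in> ann S" "X x = sharp (P x) a" and b: "b \<in> ann S" "Y x = sharp (P x) b"
  shows "sharp (P2 x) (differential A (\<lambda>y. \<sigma> y (X y) (Y y)) x) = - proj_along (tangent_bundle A S x) (H x) (lie_bracket A X Y x)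
    \<longleftrightarrow> (\<forall>\<gamma>\<in>ann (H x). jac x a b \<gamma> = 0)"
proof -
  let ?c = "chart_at A x"
  let ?f = "\<lambda>u. form_rep A ?c \<sigma> u (vec_rep A ?c X u) (vec_rep A ?c Y u)"
  note c = chart_at[OF fol, of x]
  have "(?f has_derivative f') (at (coord_at A x)) \<longleftrightarrow>
      (((\<lambda>y. \<sigma> y (X y) (Y y)) \<circ> chart_inv ?c) has_derivative f') (at (coord_at A x))" for f'
  proof -
    have eq: "?f u = ((\<lambda>y. \<sigma> y (X y) (Y y)) \<circ> chart_inv ?c) u" if "u \<in> snd ?c ` fst ?c" for u
      using dchart_iso(3)[OF fol c(1) chart_inverse(3)[OF fol c(1) that]] by (simp add: form_rep_def vec_rep_def Let_def)
    show ?thesis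
      by (rule iffI; erule has_derivative_transform_within_open[OF _ rep_facts(1,2)]) (simp_all only: eq)
  qed
  then have diff: "differential A (\<lambda>y. \<sigma> y (X y) (Y y)) x = Blinfun (frechet_derivative ?f (at (coord_at A x)))"
    by (simp only: differential_def frechet_derivative_def)
  note rp = rep_at[OF fol] proj_rep_at[OF fol] range_proj
  from curvature_eq_iff[OF rep_facts projectable_germ_rep[OF X x] projectable_germ_rep[OF Y x], of a b]
  show ?thesis
    unfolding rp lie_bracket_def tangent_bundle_eq[OF fol] diff using a b by blast
qed

lemma lie_iff:
  assumes X: "X \<in> projectable_fields A S H U" and x: "x \<in> U" "open U"
    and a: "a \<in> ann S" "X x = sharp (P x) a"
  shows "(\<forall>\<alpha> \<beta>. lie_deriv_bivector A X P2 x \<alpha> \<beta> = 0) \<longleftrightarrow>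
    (\<forall>\<beta>\<in>ann (H x). \<forall>\<gamma>\<in>ann (H x). jac x a \<beta> \<gamma> = 0)"
  using lie_leaf_iff[OF rep_facts projectable_germ_rep[OF X x], of a] a
  unfolding rep_at[OF fol] proj_rep_at[OF fol] range_proj lie_deriv_bivector_def dbivec_rep_def by blast

lemma poisson_iff_structure_equations:
  "poisson A P \<longleftrightarrow> poisson A P2 \<and> (\<forall>x v1 v2 v3. d_prime A S H \<sigma> x v1 v2 v3 = 0) \<and>
     (\<forall>U. open U \<longrightarrow>
        (\<forall>X \<in> projectable_fields A S H U. \<forall>Y \<in> projectable_fields A S H U. \<forall>x\<in>U.
           sharp (P2 x) (differential A (\<lambda>y. \<sigma> y (X y) (Y y)) x)
             = - proj_along (tangent_bundle A S x) (H x) (lie_bracket A X Y x))) \<and>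
     (\<forall>U. open U \<longrightarrow>
        (\<forall>X \<in> projectable_fields A S H U. \<forall>x\<in>U. \<forall>\<alpha> \<beta>. lie_deriv_bivector A X P2 x \<alpha> \<beta> = 0))"
    (is "_ \<longleftrightarrow> _ \<and> ?d \<and> ?curv \<and> ?lie")
proof -
  have P: "poisson A P \<longleftrightarrow> (\<forall>x \<alpha> \<beta> \<gamma>. jac x \<alpha> \<beta> \<gamma> = 0)" using P by (simp add: poisson_def schouten_jacobiator)
  have P2: "poisson A P2 \<longleftrightarrow> (\<forall>x \<alpha> \<beta> \<gamma>. jacobiator (bivec_rep A (chart_at A x) P2) (coord_at A x) \<alpha> \<beta> \<gamma> = 0)"
    using P2 by (simp add: poisson_def schouten_jacobiator)
  have field_value: "\<exists>a\<in>ann S. X x = sharp (P x) a" if "X \<in> projectable_fields A S H U" "x \<in> U" for X U x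
    using that normal_sharp[of x] unfolding projectable_fields_def by blast
  \<comment> \<open>The extension lives on a chart domain only; the equations over arbitrary open
    sets are tested on such domains.\<close>
  have field: "\<exists>X\<in>projectable_fields A S H (fst (chart_at A x)). X x = sharp (P x) a" if "a \<in> ann S" for x a
    by (rule exists_projectable_field) (use that normal_sharp[of x] in blast)
  have opn: "open (fst (chart_at A x))" "x \<in> fst (chart_at A x)" for x
    by (rule chart_open(1)[OF fol chart_at(1)[OF fol]] chart_at(2)[OF fol])+
  have curv: "?curv \<longleftrightarrow> (\<forall>x. \<forall>a\<in>ann S. \<forall>b\<in>ann S. \<forall>\<gamma>\<in>ann (H x). jac x a b \<gamma> = 0)"
  proof (rule iffI)
    assume L: ?curv
    show "\<forall>x. \<forall>a\<in>ann S. \<forall>b\<in>ann S. \<forall>\<gamma>\<in>ann (H x). jac x a b \<gamma> = 0"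
    proof (intro allI ballI)
      fix x a b \<gamma> assume ab: "a \<in> ann S" "b \<in> ann S" "\<gamma> \<in> ann (H x)"
      obtain X Y where X: "X \<in> projectable_fields A S H (fst (chart_at A x))" "X x = sharp (P x) a"
        and Y: "Y \<in> projectable_fields A S H (fst (chart_at A x))" "Y x = sharp (P x) b"
        using field[OF ab(1)] field[OF ab(2)] by blast
      show "jac x a b \<gamma> = 0"
        using curvature_iff[OF X(1) Y(1) opn(2,1) ab(1) X(2) ab(2) Y(2)] L X(1) Y(1) opn ab(3) by blast
    qed
  next
    assume R: "\<forall>x. \<forall>a\<in>ann S. \<forall>b\<in>ann S. \<forall>\<gamma>\<in>ann (H x). jac x a b \<gamma> = 0"
    show ?curv
    proof (intro allI impI ballI)
      fix U X Y x assume U: "open U" and X: "X \<in> projectable_fields A S H U"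
        and Y: "Y \<in> projectable_fields A S H U" and x: "x \<in> U"
      obtain a b where a: "a \<in> ann S" "X x = sharp (P x) a" and b: "b \<in> ann S" "Y x = sharp (P x) b"
        using field_value[OF X x] field_value[OF Y x] by blast
      show "sharp (P2 x) (differential A (\<lambda>y. \<sigma> y (X y) (Y y)) x) =
          - proj_along (tangent_bundle A S x) (H x) (lie_bracket A X Y x)"
        using curvature_iff[OF X Y x U a b] R a(1) b(1) by blast
    qed
  qed
  have lie: "?lie \<longleftrightarrow> (\<forall>x. \<forall>a\<in>ann S. \<forall>\<beta>\<in>ann (H x). \<forall>\<gamma>\<in>ann (H x). jac x a \<beta> \<gamma> = 0)"
  proof (rule iffI)
    assume L: ?lie
    show "\<forall>x. \<forall>a\<in>ann S. \<forall>\<beta>\<in>ann (H x). \<forall>\<gamma>\<in>ann (H x). jac x a \<beta> \<gamma> = 0"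
    proof (intro allI ballI)
      fix x a \<beta> \<gamma> assume a: "a \<in> ann S" "\<beta> \<in> ann (H x)" "\<gamma> \<in> ann (H x)"
      obtain X where X: "X \<in> projectable_fields A S H (fst (chart_at A x))" "X x = sharp (P x) a"
        using field[OF a(1)] by blast
      show "jac x a \<beta> \<gamma> = 0"
        using lie_iff[OF X(1) opn(2,1) a(1) X(2)] L X(1) opn a(2,3) by blast
    qed
  next
    assume R: "\<forall>x. \<forall>a\<in>ann S. \<forall>\<beta>\<in>ann (H x). \<forall>\<gamma>\<in>ann (H x). jac x a \<beta> \<gamma> = 0"
    show ?lie
    proof (intro allI impI ballI)
      fix U X x \<alpha> \<beta> assume U: "open U" and X: "X \<in> projectable_fields A S H U" and x: "x \<in> U"
      obtain a where a: "a \<in> ann S" "X x = sharp (P x) a" using field_value[OF X x] by blast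
      show "lie_deriv_bivector A X P2 x \<alpha> \<beta> = 0" using lie_iff[OF X x U a] R a(1) by blast
    qed
  qed
  have d: "?d \<longleftrightarrow> (\<forall>x. \<forall>a\<in>ann S. \<forall>b\<in>ann S. \<forall>c\<in>ann S. jac x a b c = 0)"
    by (simp only: d_prime_iff)
  have J: "(\<forall>\<alpha> \<beta> \<gamma>. jac x \<alpha> \<beta> \<gamma> = 0) \<longleftrightarrow>
     (\<forall>a\<in>ann S. \<forall>b\<in>ann S. \<forall>c\<in>ann S. jac x a b c = 0) \<and>
     (\<forall>a\<in>ann S. \<forall>b\<in>ann S. \<forall>\<gamma>\<in>ann (H x). jac x a b \<gamma> = 0) \<and>
     (\<forall>a\<in>ann S. \<forall>\<beta>\<in>ann (H x). \<forall>\<gamma>\<in>ann (H x). jac x a \<beta> \<gamma> = 0) \<and>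
     (\<forall>\<alpha> \<beta> \<gamma>. jacobiator (bivec_rep A (chart_at A x) P2) (coord_at A x) \<alpha> \<beta> \<gamma> = 0)" for x
    using jacobiator_zero_iff[OF rep_facts, of x] unfolding proj_rep_at[OF fol] range_proj .
  have all: "(\<forall>x \<alpha> \<beta> \<gamma>. jac x \<alpha> \<beta> \<gamma> = 0) \<longleftrightarrow>
     (\<forall>x. \<forall>a\<in>ann S. \<forall>b\<in>ann S. \<forall>c\<in>ann S. jac x a b c = 0) \<and>
     (\<forall>x. \<forall>a\<in>ann S. \<forall>b\<in>ann S. \<forall>\<gamma>\<in>ann (H x). jac x a b \<gamma> = 0) \<and>
     (\<forall>x. \<forall>a\<in>ann S. \<forall>\<beta>\<in>ann (H x). \<forall>\<gamma>\<in>ann (H x). jac x a \<beta> \<gamma> = 0) \<and>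
     (\<forall>x \<alpha> \<beta> \<gamma>. jacobiator (bivec_rep A (chart_at A x) P2) (coord_at A x) \<alpha> \<beta> \<gamma> = 0)"
    by (simp only: J all_conj_distrib)
  \<comment> \<open>Propositional glue with letters in place of the long formulas, whose
    equivalences are then plugged in.\<close>
  have "p \<longleftrightarrow> q \<and> d \<and> c \<and> l"
    if "p = B" "B = (Q1 \<and> Q2 \<and> Q3 \<and> Q4)" "d = Q1" "c = Q2" "l = Q3" "q = Q4" for p q d c l B Q1 Q2 Q3 Q4
    using that by blast
  from this[OF P all d curv lie P2] show ?thesis .
qed

section \<open>Evaluation of both maps on coupled data, and the correspondence of the
  conditions\<close>

lemma coupling_form_eq:
  assumes HP: "coupling_normal_bundle A S P = H"
  shows "coupling_form A S P x = \<sigma> x"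
proof -
  define P' where "P' = bivec_component_20 A S H P x"
  have P': "P' = (\<lambda>\<xi> \<eta>. P x (\<xi> o\<^sub>L Blinfun (proj_along (H x) S)) (\<eta> o\<^sub>L Blinfun (proj_along (H x) S)))"
    by (simp add: P'_def fun_eq_iff bivec_component_20_def covec_ann_F_def tangent_bundle_eq[OF fol] proj_along_ann(1)[OF normal refl])
  have alt: "alternating_bilinear P'"
    unfolding P' by (rule alternating_pullback[OF coupledD(5)[OF cpl] linear_compose_pi[OF normal refl]])
  have P'_eq: "P' a b = P x a b" if "a \<in> ann S" "b \<in> ann S" for a b
    by (simp only: P' coupled_compose_eq[OF cpl that(1)] coupled_compose_eq[OF cpl that(2)])
  \<comment> \<open>\<open>coupling_form\<close> is stated with the (2,0) component; on ann F it has
    the same \<open>sharp\<close> as \<open>P\<close>, so the uniqueness statement for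
    \<open>P\<close> applies.\<close>
  have sharp: "sharp P' a = sharp (P x) a" if a: "a \<in> ann S" for a
  proof (rule sharp_eqI[OF alt])
    fix \<beta>
    show "blinfun_apply \<beta> (sharp (P x) a) = P' a \<beta>"
      by (simp only: P' coupled_compose_eq[OF cpl a] apply_sharp[OF coupledD(5)[OF cpl]] coupledD(9)[OF cpl a, of x \<beta>, symmetric])
  qed
  show ?thesis
    unfolding coupling_form_def HP Let_def tangent_bundle_eq[OF fol] P'_def[symmetric] in_wedge2_ann_F_def
  proof (rule the_equality)
    show "(alternating_bilinear (\<sigma> x) \<and> (\<forall>v\<in>S. \<forall>w. \<sigma> x v w = 0)) \<and>
        (\<forall>\<alpha>\<in>ann S. \<forall>\<beta>\<in>ann S. \<sigma> x (sharp P' \<alpha>) (sharp P' \<beta>) = P' \<alpha> \<beta>)"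
      by (intro conjI ballI allI coupledD(7)[OF cpl] coupledD(8)[OF cpl])
        (simp_all only: sharp P'_eq coupled_form_sharp[OF cpl])
  next
    fix s assume s: "(alternating_bilinear s \<and> (\<forall>v\<in>S. \<forall>w. s v w = 0)) \<and>
        (\<forall>\<alpha>\<in>ann S. \<forall>\<beta>\<in>ann S. s (sharp P' \<alpha>) (sharp P' \<beta>) = P' \<alpha> \<beta>)"
    have "s (sharp (P x) a) (sharp (P x) b) = P x a b" if "a \<in> ann S" "b \<in> ann S" for a b
      using s that by (simp only: sharp[OF that(1), symmetric] sharp[OF that(2), symmetric] P'_eq[OF that, symmetric])
    moreover have "alternating_bilinear s" "\<And>v w. v \<in> S \<Longrightarrow> s v w = 0" using s by blast+
    ultimately show "s = \<sigma> x" by (intro coupled_form_unique[OF cpl])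
  qed
qed

lemma component_02_eq: "bivec_component_02 A S H P = P2"
proof (intro ext)
  fix x \<xi> \<eta>
  show "bivec_component_02 A S H P x \<xi> \<eta> = P2 x \<xi> \<eta>"
    by (simp only: bivec_component_02_def covec_ann_H_def tangent_bundle_eq[OF fol] proj_along_ann(2)[OF normal refl]
        coupledD(10)[OF cpl, of x \<xi> \<eta>])
qed

lemma bivector_of_triple_eq: "bivector_of_triple A S (P2, H, \<sigma>) = P"
proof (intro ext)
  fix x \<xi> \<eta>
  show "bivector_of_triple A S (P2, H, \<sigma>) x \<xi> \<eta> = P x \<xi> \<eta>"
    using coupled_reconstruct[OF cpl, of x \<xi> \<eta>]
    by (simp only: bivector_of_triple_def prod.case covec_ann_F_def covec_ann_H_def tangent_bundle_eq[OF fol]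
        proj_along_ann[OF normal refl] range_proj)
qed

lemma coupling_normal_bundle_eq: "coupling_normal_bundle A S P = H"
  by (rule ext) (simp only: coupling_normal_bundle_def tangent_bundle_eq[OF fol] normal_sharp[symmetric])

lemma triple_of_bivector_eq: "triple_of_bivector A S P = (P2, H, \<sigma>)"
  unfolding triple_of_bivector_def coupling_normal_bundle_eq Let_def component_02_eq
  using coupling_form_eq[OF coupling_normal_bundle_eq] by (simp add: fun_eq_iff)

text \<open>For coupled data, the requirements of bidegree and non-degeneracy hold automatically on
  both sides. What remains is the Jacobi identity against the structure equations and the Jacobi
  identity of \<open>P2\<close>.\<close>

lemma coupling_correspondence: "P \<in> coupling_poisson A S \<longleftrightarrow> (P2, H, \<sigma>) \<in> coupling_triples A S"
proof -
  have "\<forall>x. in_wedge2_ann_F A S x (\<sigma> x)"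
    using coupledD(7,8)[OF cpl] unfolding in_wedge2_ann_F_def tangent_bundle_eq[OF fol] by blast
  moreover have "\<forall>x. nondegenerate_on (H x) (\<sigma> x)"
    using coupled_nondegenerate[OF cpl] unfolding range_proj by blast
  moreover have "leaf_tangent_poisson A S P2 \<longleftrightarrow> poisson A P2"
    using coupled_p2_ann[OF cpl] unfolding leaf_tangent_poisson_def tangent_bundle_eq[OF fol] by blast
  moreover have "P \<in> coupling_poisson A S \<longleftrightarrow> poisson A P"
    using H by (simp only: coupling_poisson_def mem_Collect_eq coupling_normal_bundle_eq simp_thms)
  ultimately show ?thesis
    unfolding poisson_iff_structure_equations coupling_triples_def using H \<sigma>
    by (simp only: mem_Collect_eq prod.case simp_thms)
qed

end

end

text \<open>The form is chosen independently at each point. It is smooth nonetheless, because the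
  coupling relations express it through the inverse of a smooth family of matrices built from
  \<open>P\<close>.\<close>

lemma coupling_of_bivector:
  assumes P: "P \<in> coupling_poisson A S"
  obtains H P2 \<sigma> where "normal_bundle A S H" "bivector_field A P" "bivector_field A P2" "two_form A \<sigma>"
    "\<And>x. coupled S (proj_along (H x) S) (P x) (P2 x) (\<sigma> x)"
proof -
  define H where "H = coupling_normal_bundle A S P"
  have H: "normal_bundle A S H" using P unfolding coupling_poisson_def H_def by blast
  have bf: "bivector_field A P" using P unfolding coupling_poisson_def poisson_def by blast
  then have alt: "alternating_bilinear (P x)" for x by (simp add: bivector_field_def)
  have Hx: "H x = sharp (P x) ` ann S" for x
    by (simp only: H_def coupling_normal_bundle_def tangent_bundle_eq[OF fol])
  define P2 where "P2 x = (\<lambda>\<alpha> \<beta>. P x (\<alpha> - (\<alpha> o\<^sub>L Blinfun (proj_along (H x) S))) (\<beta> - (\<beta> o\<^sub>L Blinfun (proj_along (H x) S))))" for x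
  have "\<exists>s. coupled S (proj_along (H x) S) (P x) (P2 x) s" for x
    unfolding P2_def by (rule bivector_coupled[OF normal[OF H] refl alt Hx])
  then obtain \<sigma> where cpl: "\<And>x. coupled S (proj_along (H x) S) (P x) (P2 x) (\<sigma> x)" by metis
  have smooth: "smooth_on (snd c ` fst c) (\<lambda>u. form_rep A c \<sigma> u v w)"
    "smooth_on (snd c ` fst c) (\<lambda>u. bivec_rep A c P2 u \<alpha> \<beta>)" if c: "c \<in> A" for c v w \<alpha> \<beta>
  proof -
    have p: "smooth_on (snd c ` fst c) (\<lambda>u. bivec_rep A c P u \<alpha> \<beta>)" for \<alpha> \<beta>
      using bf c unfolding bivector_field_def by blast
    note * = smooth_of_bivector[OF chart_open(2)[OF fol c] coupled_rep[OF fol c _ cpl] p subspace_S[OF fol]]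
    show "smooth_on (snd c ` fst c) (\<lambda>u. form_rep A c \<sigma> u v w)" by (rule *(2))
    show "smooth_on (snd c ` fst c) (\<lambda>u. bivec_rep A c P2 u \<alpha> \<beta>)" by (rule *(3))
  qed
  have "two_form A \<sigma>" "bivector_field A P2"
    unfolding two_form_def bivector_field_def by (intro conjI allI ballI coupledD(6,7)[OF cpl] smooth; assumption)+
  then show thesis using that H bf cpl by metis
qed

text \<open>Only the existence of a coupled bivector at each point is kept. That it is the one given
  by the reconstruction formula follows later from the coupling relations, which also yield its
  smoothness.\<close>

lemma coupling_of_triple:
  assumes t: "(P2, H, \<sigma>) \<in> coupling_triples A S"
  obtains P where "normal_bundle A S H" "bivector_field A P" "bivector_field A P2" "two_form A \<sigma>"
    "\<And>x. coupled S (proj_along (H x) S) (P x) (P2 x) (\<sigma> x)"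
proof -
  note t' = t[unfolded coupling_triples_def mem_Collect_eq prod.case]
  have leaf: "leaf_tangent_poisson A S P2" using t' by (rule conjunct1)
  have H: "normal_bundle A S H" using t' by (rule conjunct2[THEN conjunct1])
  have \<sigma>: "two_form A \<sigma>" using t' by (rule conjunct2[THEN conjunct2, THEN conjunct1])
  have w: "\<forall>x. in_wedge2_ann_F A S x (\<sigma> x)"
    using t' by (rule conjunct2[THEN conjunct2, THEN conjunct2, THEN conjunct1])
  have "\<forall>x. nondegenerate_on (H x) (\<sigma> x)"
    using t' by (rule conjunct2[THEN conjunct2, THEN conjunct2, THEN conjunct2, THEN conjunct1])
  then have nd: "nondegenerate_on (H x) (\<sigma> x)" for x by (rule spec)
  have P2: "bivector_field A P2" using leaf by (simp only: leaf_tangent_poisson_def poisson_def)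
  have P2F: "P2 x \<alpha> \<beta> = 0" if "\<alpha> \<in> ann S" for x \<alpha> \<beta>
    using leaf that by (simp only: leaf_tangent_poisson_def tangent_bundle_eq[OF fol])
  have \<sigma>F: "\<sigma> x v w = 0" if "v \<in> S" for x v w
    using w that by (simp only: in_wedge2_ann_F_def tangent_bundle_eq[OF fol])
  have alt: "alternating_bilinear (P2 x)" "alternating_bilinear (\<sigma> x)" for x
    using P2 \<sigma> by (simp_all add: bivector_field_def two_form_def)
  have "\<exists>p. coupled S (proj_along (H x) S) p (P2 x) (\<sigma> x)" for x
    using triple_coupled[OF normal[OF H] refl alt(1) P2F alt(2) \<sigma>F nd] by blast
  then obtain P where cpl: "\<And>x. coupled S (proj_along (H x) S) (P x) (P2 x) (\<sigma> x)" by metis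
  have smooth: "smooth_on (snd c ` fst c) (\<lambda>u. bivec_rep A c P u \<alpha> \<beta>)" if c: "c \<in> A" for c \<alpha> \<beta>
  proof (rule smooth_of_form[OF chart_open(2)[OF fol c] coupled_rep[OF fol c _ cpl] _ _ smooth_proj_rep[OF fol c H]])
    show "smooth_on (snd c ` fst c) (\<lambda>u. bivec_rep A c P2 u \<alpha> \<beta>)" for \<alpha> \<beta>
      using P2 c unfolding bivector_field_def by blast
    show "smooth_on (snd c ` fst c) (\<lambda>u. form_rep A c \<sigma> u v w)" for v w
      using \<sigma> c unfolding two_form_def by blast
  qed
  have "bivector_field A P"
    unfolding bivector_field_def by (intro conjI allI ballI coupledD(5)[OF cpl] smooth; assumption)
  then show thesis using that H P2 \<sigma> cpl by metis
qed

end

theorem proposition3p2: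
  fixes A :: "('m::{t2_space, second_countable_topology}, 'e::euclidean_space) chart set"
    and S :: "'e set"
  assumes "foliated_atlas A S"
  shows "bij_betw (triple_of_bivector A S) (coupling_poisson A S) (coupling_triples A S)
    \<and> (\<forall>P \<in> coupling_poisson A S.
          bivector_of_triple A S (triple_of_bivector A S P) = P)
    \<and> (\<forall>t \<in> coupling_triples A S.
          bivector_of_triple A S t \<in> coupling_poisson A S \<and>
          triple_of_bivector A S (bivector_of_triple A S t) = t)"
proof -
  have P: "triple_of_bivector A S P \<in> coupling_triples A S \<and> bivector_of_triple A S (triple_of_bivector A S P) = P"
    if P: "P \<in> coupling_poisson A S" for P
  proof -
    obtain H P2 \<sigma> where *: "normal_bundle A S H" "bivector_field A P" "bivector_field A P2" "two_form A \<sigma>"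
      "\<And>x. coupled S (proj_along (H x) S) (P x) (P2 x) (\<sigma> x)"
      using coupling_of_bivector[OF assms P] by metis
    show ?thesis
      using triple_of_bivector_eq[OF assms *] bivector_of_triple_eq[OF assms *]
        coupling_correspondence[OF assms *] P by simp
  qed
  have t: "bivector_of_triple A S t \<in> coupling_poisson A S \<and> triple_of_bivector A S (bivector_of_triple A S t) = t"
    if t: "t \<in> coupling_triples A S" for t
  proof -
    obtain P2 H \<sigma> where teq: "t = (P2, H, \<sigma>)" by (cases t)
    obtain P where *: "normal_bundle A S H" "bivector_field A P" "bivector_field A P2" "two_form A \<sigma>"
      "\<And>x. coupled S (proj_along (H x) S) (P x) (P2 x) (\<sigma> x)"
      using coupling_of_triple[OF assms t[unfolded teq]] by metis
    show ?thesis
      using triple_of_bivector_eq[OF assms *] bivector_of_triple_eq[OF assms *]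
        coupling_correspondence[OF assms *] t by (simp add: teq)
  qed
  have "bij_betw (triple_of_bivector A S) (coupling_poisson A S) (coupling_triples A S)"
    by (rule bij_betw_byWitness[where f' = "bivector_of_triple A S"]) (use P t in blast)+
  then show ?thesis using P t by blast
qed

end
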